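(* Let $0<\rho<\infty$ and let $n,M\ge 1$ be integers. Then there exists a meromorphic function $f\in\mathcal{B}$ on $\mathbb{C}$ of $n$-th order $\rho_n(f)=\rho$, for which all poles have multiplicity $M$ and $\infty$ is not an asymptotic value, such that the following holds: for every $\gamma>8/(M\rho)$, if $h(t)=t^{2}\left(\log^{n}\frac{1}{t}\right)^{\gamma}$ for $t\in(0,\delta_n]$ with $\delta_n=1/\exp^{n}(\gamma)$, then $\mu_h(I(f))=\infty$.
   Context: Notation: $\log^{k}$ and $\exp^{k}$ denote the $k$-th iterates of $\log$ and $\exp$; $\log_+ x=\max\{\log x,0\}$ and $\log_+^{k}$ is its $k$-th iterate. For a meromorphic function $f$ on $\mathbb{C}$ with Nevanlinna characteristic $T(r,f)$, the $n$-th order is $$\rho_n(f)=\limsup_{r\to\infty}\frac{\log_+^{n+1}T(r,f)}{\log r}.$$ The class $\mathcal{B}$ (Eremenko–Lyubich class) consists of the meromorphic functions $f$ for which the set of finite singularities of the inverse $f^{-1}$ (i.e. the finite critical values and finite asymptotic values, and their finite limit points) is bounded. A value $a\in\mathbb{C}\cup\{\infty\}$ is an asymptotic value of $f$ if there is a curve tending to $\infty$ along which $f$ tends to $a$. $f^{k}$ denotes the $k$-th iterate of $f$, and the escaping set is $I(f)=\{z\in\mathbb{C}: f^{k}(z)\to\infty \text{ as } k\to\infty\}$ (in particular all iterates $f^k(z)$ are defined and finite). A gauge function is a continuous increasing function $h:(0,\alpha]\to(0,\infty)$, $\alpha>0$, with $\lim_{t\to0}h(t)=0$ (put $h(0)=0$).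 For $A\subset\mathbb{C}$, a $\delta$-cover of $A$ is a sequence $(A_j)_{j\in\mathbb{N}}$ of subsets of $\mathbb{C}$ with $A\subset\bigcup_j A_j$ and $\operatorname{diam}(A_j)\le\delta$ for all $j$ (Euclidean diameter). The Hausdorff measure with respect to $h$ is $$\mu_h(A)=\lim_{\delta\to0}\inf\Big\{\sum_{j=1}^\infty h(\operatorname{diam}A_j): (A_j)_{j\in\mathbb{N}}\text{ a }\delta\text{-cover of }A\Big\}.$$ *)

theory Defs
  imports "HOL-Complex_Analysis.Complex_Analysis"
begin

text \<open>
  A meromorphic function on the plane is a function \<open>f\<close> with \<open>f nicely_meromorphic_on UNIV\<close>:
  it is continuous (hence analytic) off its poles, and takes the junk value \<open>0\<close> at them.
  Wherever a pole should contribute the value \<open>\<infinity>\<close>, it is therefore treated explicitly.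
\<close>

subsection \<open>Nevanlinna characteristic and \<open>n\<close>-th order\<close>

text \<open>The case \<open>x \<le> 0\<close> reflects the convention \<open>log 0 = -\<infinity>\<close>.\<close>

definition log_plus :: "real \<Rightarrow> real" where
  "log_plus x = (if 0 < x then max (ln x) 0 else 0)"

definition proximity_function :: "real \<Rightarrow> (complex \<Rightarrow> complex) \<Rightarrow> real" where
  "proximity_function r f =
     1 / (2 * pi) * integral {0..2 * pi} (\<lambda>\<theta>. log_plus (norm (f (of_real r * cis \<theta>))))"

text \<open>Number of poles in the closed disc of radius \<open>t\<close>, with multiplicity.\<close>

definition pole_count :: "real \<Rightarrow> (complex \<Rightarrow> complex) \<Rightarrow> nat" where
  "pole_count t f = (\<Sum>z | is_pole f z \<and> norm z \<le> t. nat (- zorder f z))"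

definition pole_counting_function :: "real \<Rightarrow> (complex \<Rightarrow> complex) \<Rightarrow> real" where
  "pole_counting_function r f =
     integral {0..r} (\<lambda>t. (real (pole_count t f) - real (pole_count 0 f)) / t)
       + real (pole_count 0 f) * ln r"

definition nevanlinna_characteristic :: "real \<Rightarrow> (complex \<Rightarrow> complex) \<Rightarrow> real" where
  "nevanlinna_characteristic r f = proximity_function r f + pole_counting_function r f"

definition nth_order :: "nat \<Rightarrow> (complex \<Rightarrow> complex) \<Rightarrow> ereal" where
  "nth_order n f =
     Limsup at_top (\<lambda>r. ereal ((log_plus ^^ (n + 1)) (nevanlinna_characteristic r f) / ln r))"

subsection \<open>Singularities of the inverse and the Eremenko--Lyubich class\<close>

definition curve_to_infinity :: "(real \<Rightarrow> complex) \<Rightarrow> bool" where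
  "curve_to_infinity c \<longleftrightarrow> continuous_on {0..} c \<and> filterlim c at_infinity at_top"

definition finite_critical_values :: "(complex \<Rightarrow> complex) \<Rightarrow> complex set" where
  "finite_critical_values f = {f z | z. \<not> is_pole f z \<and> deriv f z = 0}"

definition finite_asymptotic_values :: "(complex \<Rightarrow> complex) \<Rightarrow> complex set" where
  "finite_asymptotic_values f =
     {a. \<exists>c. curve_to_infinity c \<and> (\<forall>\<^sub>F t in at_top. \<not> is_pole f (c t)) \<and>
             ((\<lambda>t. f (c t)) \<longlongrightarrow> a) at_top}"

text \<open>Convergence to \<open>\<infinity>\<close> is in the sphere: the curve may pass through poles.\<close>

definition infinity_asymptotic_value :: "(complex \<Rightarrow> complex) \<Rightarrow> bool" where
  "infinity_asymptotic_value f \<longleftrightarrow>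
     (\<exists>c. curve_to_infinity c \<and>
          (\<forall>R. \<forall>\<^sub>F t in at_top. is_pole f (c t) \<or> R < norm (f (c t))))"

text \<open>The closure adds the finite limit points.\<close>

definition finite_inverse_singularities :: "(complex \<Rightarrow> complex) \<Rightarrow> complex set" where
  "finite_inverse_singularities f =
     closure (finite_critical_values f \<union> finite_asymptotic_values f)"

definition eremenko_lyubich_class :: "(complex \<Rightarrow> complex) set" where
  "eremenko_lyubich_class =
     {f. f nicely_meromorphic_on UNIV \<and> bounded (finite_inverse_singularities f)}"

subsection \<open>Escaping set\<close>

definition escaping_set :: "(complex \<Rightarrow> complex) \<Rightarrow> complex set" where
  "escaping_set f =
     {z. (\<forall>k. \<not> is_pole f ((f ^^ k) z)) \<and>
         filterlim (\<lambda>k. (f ^^ k) z) at_infinity sequentially}"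

subsection \<open>Hausdorff measure\<close>

text \<open>
  Boundedness is required explicitly because \<^const>\<open>diameter\<close> is real-valued and
  unspecified on unbounded sets.
\<close>

definition delta_cover :: "real \<Rightarrow> complex set \<Rightarrow> (nat \<Rightarrow> complex set) \<Rightarrow> bool" where
  "delta_cover \<delta> A U \<longleftrightarrow>
     A \<subseteq> (\<Union>j. U j) \<and> (\<forall>j. bounded (U j) \<and> diameter (U j) \<le> \<delta>)"

text \<open>
  The convention \<open>h 0 = 0\<close> is built in. Since \<open>\<delta>\<close> tends to \<open>0\<close>, only the values of the gauge
  function on an arbitrarily small interval \<open>{0<..\<alpha>}\<close> matter, so \<open>h\<close> may be a total function
  with arbitrary values elsewhere.
\<close>

definition hausdorff_premeasure :: "(real \<Rightarrow> real) \<Rightarrow> real \<Rightarrow> complex set \<Rightarrow> ennreal" where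
  "hausdorff_premeasure h \<delta> A =
     (INF U \<in> {U. delta_cover \<delta> A U}.
        \<Sum>j. ennreal (if diameter (U j) = 0 then 0 else h (diameter (U j))))"

definition hausdorff_measure :: "(real \<Rightarrow> real) \<Rightarrow> complex set \<Rightarrow> ennreal" where
  "hausdorff_measure h A = Lim (at_right 0) (\<lambda>\<delta>. hausdorff_premeasure h \<delta> A)"

lemma hausdorff_premeasure_antimono:
  assumes "\<delta> \<le> \<delta>'"
  shows "hausdorff_premeasure h \<delta>' A \<le> hausdorff_premeasure h \<delta> A"
proof -
  have "{U. delta_cover \<delta> A U} \<subseteq> {U. delta_cover \<delta>' A U}"
    unfolding delta_cover_def using assms by (blast intro: order_trans)
  then show ?thesis
    unfolding hausdorff_premeasure_def by (rule INF_superset_mono) (rule order_refl)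
qed

lemma hausdorff_premeasure_tendsto:
  "((\<lambda>\<delta>. hausdorff_premeasure h \<delta> A) \<longlongrightarrow> (SUP \<delta>\<in>{0<..}. hausdorff_premeasure h \<delta> A)) (at_right 0)"
proof (rule order_tendstoI)
  fix a assume "a < (SUP \<delta>\<in>{0<..}. hausdorff_premeasure h \<delta> A)"
  then obtain d where d: "d > 0" "a < hausdorff_premeasure h d A"
    by (auto simp: less_SUP_iff)
  have "eventually (\<lambda>\<delta>. \<delta> \<in> {0<..<d}) (at_right 0)"
    using d(1) by (rule eventually_at_right_real)
  then show "eventually (\<lambda>\<delta>. a < hausdorff_premeasure h \<delta> A) (at_right 0)"
  proof eventually_elim
    case (elim \<delta>)
    then have "hausdorff_premeasure h d A \<le> hausdorff_premeasure h \<delta> A"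
      by (intro hausdorff_premeasure_antimono) simp
    with d(2) show ?case by (rule less_le_trans)
  qed
next
  fix a assume a: "(SUP \<delta>\<in>{0<..}. hausdorff_premeasure h \<delta> A) < a"
  have "eventually (\<lambda>\<delta>. \<delta> \<in> {0<..<1::real}) (at_right 0)"
    by (rule eventually_at_right_real) simp
  then show "eventually (\<lambda>\<delta>. hausdorff_premeasure h \<delta> A < a) (at_right 0)"
  proof eventually_elim
    case (elim \<delta>)
    then have "hausdorff_premeasure h \<delta> A \<le> (SUP \<delta>\<in>{0<..}. hausdorff_premeasure h \<delta> A)"
      by (intro SUP_upper) simp
    then show ?case using a by (rule le_less_trans)
  qed
qed

lemma hausdorff_measure_eq_SUP:
  "hausdorff_measure h A = (SUP \<delta>\<in>{0<..}. hausdorff_premeasure h \<delta> A)"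
  unfolding hausdorff_measure_def
  by (rule tendsto_Lim[OF _ hausdorff_premeasure_tendsto]) simp

end

theory Submission
  imports Defs "HOL-Real_Asymp.Real_Asymp"
begin

text \<open>
  Put \<open>R\<^sub>k = R\<^sub>0^(2^k)\<close> and divide a square \<open>Q\<^sub>k\<close> of side \<open>R\<^sub>k\<close> at distance \<open>R\<^sub>k\<close> from the
  origin into \<open>N\<^sub>k\<^sup>2\<close> cells, \<open>N\<^sub>k \<approx> exp^n (R\<^sub>k^\<rho>)\<close>. In every cell place a copy of
  \<open>4 / (w^4 - 1)\<close>, rescaled to the size of the cell. The decay \<open>w^-4\<close> makes the sum \<open>g\<close> of all these
  copies bounded off small disjoint discs about its simple poles, although the spacing of the poles is
  comparable to the discs. Hence \<open>f = g^M\<close> has bounded singular values and \<open>\<infinity>\<close> is not asymptotic: a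
  curve on which \<open>f\<close> is large stays in one disc. The number of poles gives the \<open>n\<close>-th order.

  Near a pole in each cell of \<open>Q\<^sub>k\<close> there is an inverse branch of \<open>f\<close> on \<open>Q\<^sub>k\<^sub>+\<^sub>1\<close>, and the limit set of
  these branches consists of escaping points. Its pieces of generation \<open>k\<close> have relative density
  about \<open>C^k (R\<^sub>1 \<dots> R\<^sub>k)^(-2/M)\<close>, at least \<open>C^k R\<^sub>k\<^sub>-\<^sub>1^(-8/M)\<close>, while
  \<open>log^n (1/t)\<close> is at least of order \<open>R\<^sub>k\<^sub>-\<^sub>1^\<rho>\<close> at their scales \<open>t\<close>. So the factor \<open>(log^n (1/t))^\<gamma>\<close>
  outweighs the loss of density as soon as \<open>\<gamma> \<rho> > 8/M\<close>. Squaring the radius in each step is the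
  optimal choice: \<open>R\<^sub>k\<^sub>+\<^sub>1 = R\<^sub>k^a\<close> would give \<open>2 a\<^sup>2 / (a - 1)\<close> in place of 8.
\<close>

section \<open>Cantor schemes and Hausdorff measure\<close>

text \<open>The 8 is 2 * 2 * 2. One 2 turns ratios of lengths into ratios of areas. One comes from
  \<open>R 1 * ... * R k \<le> (R k)\<^sup>2\<close>. The last is a shift of index: a set whose
  pull-back stops at generation \<open>Suc k\<close> is only known to be narrower than the gap
  \<open>sc k\<close>, so the logarithm supplies a power of \<open>R k\<close>, while the density
  has cost a power of \<open>R (Suc k) = (R k)\<^sup>2\<close>. The number of cells cancels from the
  density, so it can be dictated by the order alone.

  One simple pole per cell would not do: the \<open>N\<^sup>2\<close> terms of size 1/|w| are not
  bounded uniformly in N. Four poles at the fourth roots of unity cancel the terms in 1/w,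
  \<open>1/w\<^sup>2\<close> and \<open>1/w\<^sup>3\<close>. The residue of 4/(w^4 - 1) at a root
  \<omega> is \<omega>, so after rescaling each residue has the modulus of the scale of its disc,
  and one constant bounds g off the discs at all levels.

  The squares lie in the upper half-plane. Hence the principal M-th root is continuous on them, and
  the arguments of the poles lie between 0 and pi, so that no wrap-around occurs when angles on a
  circle are compared.\<close>

definition width_le :: "complex set \<Rightarrow> real \<Rightarrow> bool" where
  "width_le U t \<longleftrightarrow> (\<forall>x\<in>U. \<forall>y\<in>U. dist x y \<le> t)"

text \<open>\<open>s k\<close> bounds the gaps between the pieces of \<open>Q k\<close> from below,
  \<open>l k\<close> bounds the contraction of the branches into \<open>Q k\<close> from below, so
  that pulling a set back widens it by at most the factor \<open>1 / l k\<close>, and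
  \<open>A k\<close> expresses that a set at least as wide as the gaps meets no more pieces than a
  spread proportional to area would allow.\<close>

locale cantor_scheme =
  fixes Q :: "nat \<Rightarrow> complex set" and I :: "nat \<Rightarrow> 'i set"
    and \<psi> :: "nat \<Rightarrow> 'i \<Rightarrow> complex \<Rightarrow> complex"
    and s l A :: "nat \<Rightarrow> real"
  assumes compact_Q: "compact (Q k)" and Q_ne: "Q k \<noteq> {}"
    and finite_I: "finite (I k)" and card_I: "2 \<le> card (I k)"
    and s_pos: "0 < s k" and s_le: "s k \<le> 1"
    and l_pos: "0 < l k" and l_le: "l k \<le> 1/2"
    and cont: "c \<in> I k \<Longrightarrow> continuous_on (Q (Suc k)) (\<psi> k c)"
    and maps: "c \<in> I k \<Longrightarrow> y \<in> Q (Suc k) \<Longrightarrow> \<psi> k c y \<in> Q k"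
    and expand: "c \<in> I k \<Longrightarrow> x \<in> Q (Suc k) \<Longrightarrow> y \<in> Q (Suc k) \<Longrightarrow>
                   l k * dist x y \<le> dist (\<psi> k c x) (\<psi> k c y)"
    and sep: "c \<in> I k \<Longrightarrow> c' \<in> I k \<Longrightarrow> c \<noteq> c' \<Longrightarrow> x \<in> Q (Suc k) \<Longrightarrow> y \<in> Q (Suc k) \<Longrightarrow>
                   s k \<le> dist (\<psi> k c x) (\<psi> k c' y)"
    and count: "s k \<le> t \<Longrightarrow> width_le U t \<Longrightarrow>
                   real (card {c \<in> I k. \<exists>y\<in>Q (Suc k). \<psi> k c y \<in> U}) \<le> A k * t\<^sup>2 * real (card (I k))"
begin

text \<open>The recursion peels off the outermost branch, which leads from \<open>Q (Suc k)\<close>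
  to \<open>Q k\<close>. The starting index is therefore a parameter, and inductions on the
  generation generalise it.\<close>

primrec E :: "nat \<Rightarrow> nat \<Rightarrow> complex set" where
  "E 0 k = Q k"
| "E (Suc m) k = (\<Union>c\<in>I k. \<psi> k c ` E m (Suc k))"

text \<open>The proportion of the \<open>m\<close>-th generation pieces of \<^term>\<open>Q k\<close> that meet \<open>U\<close>. Since covers
  of a compact set can be made finite, these set functions replace a limit measure.\<close>

primrec mu :: "nat \<Rightarrow> nat \<Rightarrow> complex set \<Rightarrow> real" where
  "mu 0 k U = (if Q k \<inter> U = {} then 0 else 1)"
| "mu (Suc m) k U = (\<Sum>c\<in>I k. mu m (Suc k) {y \<in> Q (Suc k). \<psi> k c y \<in> U}) / real (card (I k))"

lemma card_I_pos: "0 < real (card (I k))"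
  using card_I[of k] by simp

lemma E_subset_Q: "E m k \<subseteq> Q k"
  by (induction m arbitrary: k) (use maps in fastforce)+

lemma compact_E: "compact (E m k)"
proof (induction m arbitrary: k)
  case (Suc m)
  show ?case unfolding E.simps
    by (intro compact_UN finite_I compact_continuous_image Suc)
       (rule continuous_on_subset[OF cont E_subset_Q])
qed (simp add: compact_Q)

lemma E_Suc_subset: "E (Suc m) k \<subseteq> E m k"
proof (induction m arbitrary: k)
  case 0
  then show ?case using E_subset_Q[of 1 k] by simp
next
  case (Suc m)
  show ?case unfolding E.simps(2)[of "Suc m"] E.simps(2)[of m k] using Suc[of "Suc k"] by blast
qed

lemma E_antimono: "m \<le> m' \<Longrightarrow> E m' k \<subseteq> E m k"
  by (rule lift_Suc_antimono_le[of "\<lambda>m. E m k"]) (use E_Suc_subset in auto)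

lemma mu_le_1: "mu m k U \<le> 1"
proof (induction m arbitrary: k U)
  case (Suc m)
  have "(\<Sum>c\<in>I k. mu m (Suc k) {y \<in> Q (Suc k). \<psi> k c y \<in> U}) \<le> (\<Sum>c\<in>I k. 1)"
    by (intro sum_mono Suc)
  then show ?case using card_I_pos[of k] by simp
qed simp

lemma mu_empty: "mu m k {} = 0"
  by (induction m arbitrary: k) auto

lemma mu_UN_le:
  assumes "finite F"
  shows "mu m k (\<Union>i\<in>F. U i) \<le> (\<Sum>i\<in>F. mu m k (U i))"
proof (induction m arbitrary: k U)
  case 0
  show ?case
  proof (cases "\<exists>i\<in>F. Q k \<inter> U i \<noteq> {}")
    case True
    then obtain i where i: "i \<in> F" "Q k \<inter> U i \<noteq> {}" by blast
    have "1 = mu 0 k (U i)" using i by simp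
    also have "\<dots> \<le> (\<Sum>i\<in>F. mu 0 k (U i))"
      by (rule member_le_sum) (use i assms in auto)
    finally show ?thesis using mu_le_1[of 0 k "\<Union>i\<in>F. U i"] by linarith
  next
    case False
    then have "Q k \<inter> (\<Union>i\<in>F. U i) = {}" by blast
    then show ?thesis by (simp add: sum_nonneg)
  qed
next
  case (Suc m)
  have eq: "{y \<in> Q (Suc k). \<psi> k c y \<in> (\<Union>i\<in>F. U i)} = (\<Union>i\<in>F. {y \<in> Q (Suc k). \<psi> k c y \<in> U i})" for c
    by blast
  have "mu (Suc m) k (\<Union>i\<in>F. U i)
      \<le> (\<Sum>c\<in>I k. \<Sum>i\<in>F. mu m (Suc k) {y \<in> Q (Suc k). \<psi> k c y \<in> U i}) / real (card (I k))"
    unfolding mu.simps eq by (intro divide_right_mono sum_mono Suc) auto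
  also have "\<dots> = (\<Sum>i\<in>F. mu (Suc m) k (U i))"
    by (subst sum.swap) (simp add: sum_divide_distrib)
  finally show ?case .
qed

lemma mu_eq_1: "E m k \<subseteq> U \<Longrightarrow> mu m k U = 1"
proof (induction m arbitrary: k U)
  case 0
  then show ?case using Q_ne[of k] by auto
next
  case (Suc m)
  have "mu m (Suc k) {y \<in> Q (Suc k). \<psi> k c y \<in> U} = 1" if "c \<in> I k" for c
    by (rule Suc.IH) (use Suc.prems that E_subset_Q[of m "Suc k"] in auto)
  then show ?case using card_I_pos[of k] by simp
qed

text \<open>Only the pieces counted by \<open>count\<close> can contribute, each at most its full
  share.\<close>

lemma mu_large:
  assumes "s k \<le> t" "width_le U t"
  shows "mu (Suc m) k U \<le> A k * t\<^sup>2"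
proof -
  let ?J = "{c \<in> I k. \<exists>y\<in>Q (Suc k). \<psi> k c y \<in> U}"
  have "(\<Sum>c\<in>I k. mu m (Suc k) {y \<in> Q (Suc k). \<psi> k c y \<in> U})
      = (\<Sum>c\<in>?J. mu m (Suc k) {y \<in> Q (Suc k). \<psi> k c y \<in> U})"
  proof (rule sum.mono_neutral_right)
    show "\<forall>c\<in>I k - ?J. mu m (Suc k) {y \<in> Q (Suc k). \<psi> k c y \<in> U} = 0"
    proof
      fix c assume "c \<in> I k - ?J"
      then have "{y \<in> Q (Suc k). \<psi> k c y \<in> U} = {}" by blast
      then show "mu m (Suc k) {y \<in> Q (Suc k). \<psi> k c y \<in> U} = 0" by (simp only: mu_empty)
    qed
  qed (use finite_I in auto)
  also have "\<dots> \<le> (\<Sum>c\<in>?J. 1)" by (intro sum_mono mu_le_1)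
  also have "\<dots> \<le> A k * t\<^sup>2 * real (card (I k))" using count[OF assms] by simp
  finally show ?thesis using card_I_pos[of k] by (simp add: pos_divide_le_eq)
qed

text \<open>A set narrower than the gaps meets at most one piece, so its mass is that of its
  preimage under a single branch, divided by the number of branches.\<close>

lemma mu_small:
  assumes "t < s k" "width_le U t"
  obtains U' where "width_le U' (t / l k)" "mu (Suc m) k U \<le> mu m (Suc k) U' / real (card (I k))"
proof (cases "\<exists>c\<in>I k. \<exists>y\<in>Q (Suc k). \<psi> k c y \<in> U")
  case False
  then have "{y \<in> Q (Suc k). \<psi> k c y \<in> U} = {}" if "c \<in> I k" for c using that by blast
  then have "mu m (Suc k) {y \<in> Q (Suc k). \<psi> k c y \<in> U} = 0" if "c \<in> I k" for c
    using that mu_empty by metis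
  then have "mu (Suc m) k U = 0" by simp
  moreover have "width_le {} (t / l k)" by (simp add: width_le_def)
  moreover have "0 \<le> mu m (Suc k) {} / real (card (I k))" by (simp add: mu_empty)
  ultimately show thesis using that[of "{}"] by (simp only:)
next
  case True
  then obtain c y where c: "c \<in> I k" "y \<in> Q (Suc k)" "\<psi> k c y \<in> U" by blast
  let ?U' = "\<lambda>c. {y \<in> Q (Suc k). \<psi> k c y \<in> U}"
  have "?U' c' = {}" if "c' \<in> I k" "c' \<noteq> c" for c'
  proof (rule ccontr)
    assume "?U' c' \<noteq> {}"
    then obtain y' where "y' \<in> Q (Suc k)" "\<psi> k c' y' \<in> U" by blast
    then have "dist (\<psi> k c' y') (\<psi> k c y) \<le> t" "s k \<le> dist (\<psi> k c' y') (\<psi> k c y)"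
      using assms(2) c sep that unfolding width_le_def by auto
    then show False using assms(1) by simp
  qed
  then have "mu m (Suc k) (?U' c') = 0" if "c' \<in> I k - {c}" for c'
    using that mu_empty by (metis DiffE singletonI)
  then have "(\<Sum>c'\<in>I k. mu m (Suc k) (?U' c')) = (\<Sum>c'\<in>{c}. mu m (Suc k) (?U' c'))"
    by (intro sum.mono_neutral_right) (use c finite_I in auto)
  then have "mu (Suc m) k U = mu m (Suc k) (?U' c) / real (card (I k))" by simp
  moreover have "width_le (?U' c) (t / l k)"
    unfolding width_le_def
  proof (intro ballI)
    fix x y assume "x \<in> ?U' c" "y \<in> ?U' c"
    then have "l k * dist x y \<le> t"
      using expand[OF c(1), of x y] assms(2) unfolding width_le_def by force
    then show "dist x y \<le> t / l k" using l_pos[of k] by (simp add: pos_le_divide_eq mult.commute)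
  qed
  ultimately show thesis using that[of "?U' c"] by (simp only: order_refl)
qed

section \<open>Mass bounds by pulling a set back until it is as wide as the gaps\<close>

definition scaled :: "real \<Rightarrow> nat \<Rightarrow> real" where
  "scaled t i = t / (\<Prod>j<i. l j)"

lemma scaled_simps: "scaled t 0 = t" "scaled t (Suc i) = scaled t i / l i"
  by (simp_all add: scaled_def)

lemma prod_l_pos: "0 < (\<Prod>j<i. l j)"
  by (intro prod_pos) (simp add: l_pos)

lemma prod_card_pos: "0 < (\<Prod>j<i. real (card (I j)))"
  by (intro prod_pos ballI) (rule card_I_pos)

lemma mu_descend:
  assumes "\<And>j. j < i \<Longrightarrow> scaled t j < s j" "width_le U t"
  shows "\<exists>U'. width_le U' (scaled t i) \<and> mu (i + m) 0 U \<le> mu m i U' / (\<Prod>j<i. real (card (I j)))"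
  using assms
proof (induction i arbitrary: m)
  case 0
  then show ?case by (auto simp: scaled_simps)
next
  case (Suc i)
  have "\<exists>U'. width_le U' (scaled t i) \<and> mu (i + Suc m) 0 U \<le> mu (Suc m) i U' / (\<Prod>j<i. real (card (I j)))"
    by (rule Suc.IH) (use Suc.prems in auto)
  then obtain U' where U': "width_le U' (scaled t i)"
    "mu (i + Suc m) 0 U \<le> mu (Suc m) i U' / (\<Prod>j<i. real (card (I j)))" by blast
  obtain U'' where U'': "width_le U'' (scaled t i / l i)"
    "mu (Suc m) i U' \<le> mu m (Suc i) U'' / real (card (I i))"
    using mu_small[of "scaled t i" i U' m] Suc.prems(1)[of i] U'(1) by auto
  have "mu (i + Suc m) 0 U \<le> mu m (Suc i) U'' / real (card (I i)) / (\<Prod>j<i. real (card (I j)))"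
    using U'(2) U''(2) prod_card_pos[of i]
    by (meson divide_right_mono less_imp_le order_trans)
  then show ?case using U''(1) by (auto simp: scaled_simps mult.commute)
qed

text \<open>At the first index where the pulled-back set is as wide as the gaps,
  \<open>mu_small\<close> gives way to \<open>mu_large\<close>. The \<open>Suc\<close> leaves one
  generation for that count.\<close>

lemma mu_stop:
  assumes "\<And>j. j < i \<Longrightarrow> scaled t j < s j" "s i \<le> scaled t i" "width_le U t"
  shows "mu (i + Suc m) 0 U \<le> A i * t\<^sup>2 / (\<Prod>j<i. (l j)\<^sup>2 * real (card (I j)))"
proof -
  obtain U' where U': "width_le U' (scaled t i)"
    "mu (i + Suc m) 0 U \<le> mu (Suc m) i U' / (\<Prod>j<i. real (card (I j)))"
    using mu_descend[of i t U "Suc m"] assms by blast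
  have "mu (Suc m) i U' \<le> A i * (scaled t i)\<^sup>2" using mu_large assms(2) U'(1) by blast
  then have "mu (i + Suc m) 0 U \<le> A i * (scaled t i)\<^sup>2 / (\<Prod>j<i. real (card (I j)))"
    using U'(2) prod_card_pos[of i] by (meson divide_right_mono less_imp_le order_trans)
  also have "\<dots> = A i * t\<^sup>2 / (\<Prod>j<i. (l j)\<^sup>2 * real (card (I j)))"
    by (simp add: scaled_def power_divide prod.distrib prod_power_distrib)
  finally show ?thesis .
qed

text \<open>Each of the i steps at least halves the mass, because there are at least two branches.
  This serves for the cover members of diameter 0, to which the gauge function assigns
  nothing.\<close>

lemma mu_tiny:
  assumes "\<And>j. j < i \<Longrightarrow> scaled t j < s j" "width_le U t"
  shows "mu (i + m) 0 U \<le> 1 / 2 ^ i"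
proof -
  obtain U' where U': "width_le U' (scaled t i)"
    "mu (i + m) 0 U \<le> mu m i U' / (\<Prod>j<i. real (card (I j)))"
    using mu_descend[of i t U m] assms by blast
  have "(2::real) ^ i = (\<Prod>j<i. 2)" by simp
  also have "\<dots> \<le> (\<Prod>j<i. real (card (I j)))"
    by (intro prod_mono) (use card_I in \<open>auto simp: numeral_le_real_of_nat_iff\<close>)
  finally have "(2::real) ^ i \<le> (\<Prod>j<i. real (card (I j)))" .
  then have "mu m i U' / (\<Prod>j<i. real (card (I j))) \<le> 1 / 2 ^ i"
    by (intro frac_le mu_le_1) auto
  with U'(2) show ?thesis by linarith
qed

lemma scaled_lower:
  assumes "0 < t"
  shows "t * 2 ^ i \<le> scaled t i"
proof (induction i)
  case (Suc i)
  have "t * 2 ^ Suc i \<le> scaled t i * 2" using Suc by simp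
  also have "\<dots> \<le> scaled t i * (1 / l i)"
  proof (rule mult_left_mono)
    show "2 \<le> 1 / l i" using l_le[of i] l_pos[of i] by (simp add: field_simps)
    show "0 \<le> scaled t i" using Suc assms by (smt (verit) zero_le_mult_iff zero_le_power)
  qed
  finally show ?case by (simp add: scaled_simps)
qed (simp add: scaled_simps)

lemma stop_exists:
  assumes "0 < t"
  obtains i where "\<And>j. j < i \<Longrightarrow> scaled t j < s j" "s i \<le> scaled t i"
proof -
  obtain i0 where "1 / t < 2 ^ i0" using real_arch_pow[of 2 "1/t"] by auto
  then have "1 \<le> t * 2 ^ i0" using assms by (simp add: field_simps)
  then have "s i0 \<le> scaled t i0" using scaled_lower[OF assms, of i0] s_le[of i0] by linarith
  then have "s (LEAST i. s i \<le> scaled t i) \<le> scaled t (LEAST i. s i \<le> scaled t i)"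
    by (rule LeastI)
  moreover have "scaled t j < s j" if "j < (LEAST i. s i \<le> scaled t i)" for j
    using not_less_Least[OF that] by simp
  ultimately show thesis using that by blast
qed

lemma tiny_exists: "\<exists>d>0. \<forall>t<d. \<forall>j<i. scaled t j < s j"
proof (induction i)
  case 0
  show ?case by (intro exI[of _ 1]) auto
next
  case (Suc i)
  then obtain d where d: "d > 0" "\<forall>t<d. \<forall>j<i. scaled t j < s j" by blast
  define d' where "d' = min d (s i * (\<Prod>j<i. l j))"
  have "d' > 0" using d s_pos[of i] prod_l_pos[of i] by (simp add: d'_def)
  moreover have "scaled t j < s j" if "t < d'" "j < Suc i" for t j
  proof (cases "j = i")
    case True
    then show ?thesis using that prod_l_pos[of i]
      by (simp add: scaled_def d'_def pos_divide_less_eq)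
  next
    case False
    then show ?thesis using that d by (simp add: d'_def)
  qed
  ultimately show ?case by blast
qed

lemma scaled_less_imp_less:
  assumes "0 < t" "scaled t i < s i"
  shows "t < s i"
proof -
  have "t \<le> t * 2 ^ i" using assms by simp
  also have "\<dots> \<le> scaled t i" by (rule scaled_lower[OF assms(1)])
  finally show ?thesis using assms by simp
qed

text \<open>Mass distribution principle: sets of small width t carry mass at most
  \<open>\<epsilon> * t\<^sup>2 * \<Lambda> t\<close>, and the members of a cover share mass at
  least 1. Since \<open>mu m 0\<close> is only finitely subadditive and depends on m, the cover is
  thickened to an open one, reduced to a finite one by compactness, and m is taken beyond finitely
  many thresholds.\<close>

lemma hausdorff_measure_scheme:
  fixes h \<Lambda> :: "real \<Rightarrow> real"
  assumes \<delta>0: "0 < \<delta>0"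
    and h: "\<And>t. 0 < t \<Longrightarrow> t < \<delta>0 \<Longrightarrow> h t = t\<^sup>2 * \<Lambda> t"
    and \<Lambda>: "\<And>t t'. 0 < t \<Longrightarrow> t \<le> t' \<Longrightarrow> t' < \<delta>0 \<Longrightarrow> \<Lambda> t' \<le> \<Lambda> t"
    and bound: "\<And>\<epsilon>. 0 < \<epsilon> \<Longrightarrow> \<exists>k1. \<forall>k\<ge>k1. \<forall>t. 0 < t \<longrightarrow> t < s k \<longrightarrow>
                  A (Suc k) / (\<Prod>j<Suc k. (l j)\<^sup>2 * real (card (I j))) \<le> \<epsilon> * \<Lambda> t"
    and X: "(\<Inter>m. E m 0) \<subseteq> X"
  shows "hausdorff_measure h X = \<infinity>"
proof -
  \<comment> \<open>18 is 2 * 9: thickening triples the width, hence the 9, and the members of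
    diameter 0 may take up half of the mass.\<close>
  have main: "\<exists>\<delta>>0. ennreal (1 / (18 * \<epsilon>)) \<le> hausdorff_premeasure h \<delta> X" if \<epsilon>: "0 < \<epsilon>" for \<epsilon> :: real
  proof -
    obtain k1 where k1: "\<And>k t. k1 \<le> k \<Longrightarrow> 0 < t \<Longrightarrow> t < s k \<Longrightarrow>
       A (Suc k) / (\<Prod>j<Suc k. (l j)\<^sup>2 * real (card (I j))) \<le> \<epsilon> * \<Lambda> t" using bound[OF \<epsilon>] by blast
    obtain d1 where d1: "d1 > 0" "\<And>t j. t < d1 \<Longrightarrow> j < Suc k1 \<Longrightarrow> scaled t j < s j"
      using tiny_exists[of "Suc k1"] by blast
    \<comment> \<open>A thickened member has width at most \<open>3 * \<delta>\<close>, which is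
      half of the smaller threshold.\<close>
    define \<delta> where "\<delta> = min d1 \<delta>0 / 6"
    have \<delta>: "0 < \<delta>" using d1 \<delta>0 by (simp add: \<delta>_def)
    have mu_bd: "\<exists>i. \<forall>m>i. mu m 0 U \<le> \<epsilon> * t\<^sup>2 * \<Lambda> t"
      if t: "0 < t" "t < d1" "width_le U t" for t U
    proof -
      obtain i where i: "\<And>j. j < i \<Longrightarrow> scaled t j < s j" "s i \<le> scaled t i"
        using stop_exists[OF t(1)] by blast
      \<comment> \<open>A small set has to be pulled back many times, so the hypothesis on the
        densities applies at \<open>i - 1\<close>.\<close>
      have "k1 < i"
      proof (rule ccontr)
        assume "\<not> k1 < i"
        then show False using d1(2)[OF t(2), of i] i(2) by simp
      qed
      then obtain k where k: "i = Suc k" "k1 \<le> k" by (cases i) auto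
      have "t < s k" using scaled_less_imp_less[OF t(1)] i(1)[of k] k by simp
      then have *: "A i / (\<Prod>j<i. (l j)\<^sup>2 * real (card (I j))) \<le> \<epsilon> * \<Lambda> t"
        using k1[OF k(2) t(1)] k(1) by simp
      have "mu m 0 U \<le> \<epsilon> * t\<^sup>2 * \<Lambda> t" if "m > i" for m
      proof -
        obtain m' where m': "m = i + Suc m'" using less_imp_Suc_add[OF \<open>i < m\<close>] by auto
        have "mu m 0 U \<le> A i * t\<^sup>2 / (\<Prod>j<i. (l j)\<^sup>2 * real (card (I j)))"
          unfolding m' by (rule mu_stop) (use i t in auto)
        also have "\<dots> = t\<^sup>2 * (A i / (\<Prod>j<i. (l j)\<^sup>2 * real (card (I j))))" by simp
        also have "\<dots> \<le> t\<^sup>2 * (\<epsilon> * \<Lambda> t)" by (rule mult_left_mono[OF *]) simp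
        finally show ?thesis by (simp add: algebra_simps)
      qed
      then show ?thesis by blast
    qed
    have cover: "ennreal (1 / (18 * \<epsilon>)) \<le> (\<Sum>j. ennreal (if diameter (U j) = 0 then 0 else h (diameter (U j))))"
      if U: "delta_cover \<delta> X U" for U
    proof -
      define d where "d j = diameter (U j)" for j
      have bU: "bounded (U j)" and d_le: "d j \<le> \<delta>" and d_ge: "0 \<le> d j" for j
        using U by (auto simp: delta_cover_def d_def diameter_ge_0)
      \<comment> \<open>Below the width \<open>e j\<close> the pull-back lasts more than
        \<open>j + 2\<close> steps, so a member of diameter 0 can be given mass at most
        \<open>1 / 2 ^ (j + 2)\<close>. These add up to 1/2.\<close>
      have "\<exists>e>0. \<forall>t<e. \<forall>j<i+2. scaled t j < s j" for i by (rule tiny_exists)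
      then have "\<exists>e. \<forall>i. e i > 0 \<and> (\<forall>t<e i. \<forall>j<i+2. scaled t j < s j)"
        by (intro choice[of "\<lambda>i e. e > 0 \<and> (\<forall>t<e. \<forall>j<i+2. scaled t j < s j)"] allI)
      then obtain e where e: "\<And>i. e i > 0" "\<And>i t j. t < e i \<Longrightarrow> j < i + 2 \<Longrightarrow> scaled t j < s j"
        by blast
      \<comment> \<open>Thickening by its own diameter triples the width of a member. A member of
        diameter 0 receives the width \<open>e j / 2\<close> instead.\<close>
      define r where "r j = (if d j = 0 then e j / 4 else d j)" for j
      have r_pos: "r j > 0" for j using e(1)[of j] d_ge[of j] by (auto simp: r_def)
      define V where "V j = (\<Union>u\<in>U j. ball u (r j))" for j
      define t where "t j = d j + 2 * r j" for j
      have wV: "width_le (V j) (t j)" for j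
        unfolding width_le_def
      proof (intro ballI)
        fix x y assume "x \<in> V j" "y \<in> V j"
        then obtain u v where uv: "u \<in> U j" "v \<in> U j" "dist u x < r j" "dist v y < r j"
          by (auto simp: V_def)
        have "dist u v \<le> d j" using diameter_bounded_bound[OF bU uv(1,2)] by (simp add: d_def)
        moreover have "dist x y \<le> dist x u + dist u v + dist v y"
          using dist_triangle[of x y u] dist_triangle[of u y v] by linarith
        ultimately show "dist x y \<le> t j" using uv by (simp add: t_def dist_commute)
      qed
      have t_pos: "0 < t j" for j using r_pos[of j] d_ge[of j] by (simp add: t_def)
      have opV: "open (V j)" for j by (auto simp: V_def)
      have subV: "U j \<subseteq> V j" for j using r_pos[of j] by (auto simp: V_def)
      have "X \<subseteq> (\<Union>j. U j)" using U by (simp add: delta_cover_def)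
      also have "\<dots> \<subseteq> (\<Union>j. V j)" by (intro UN_mono subV order_refl)
      finally have covV: "(\<Inter>m. E m 0) \<subseteq> (\<Union>j. V j)" using X by (rule subset_trans[rotated])
      have "compact (\<Inter>m. E m 0)"
        using compact_E by (intro compact_Inter) auto
      then obtain F where F: "finite F" "(\<Inter>m. E m 0) \<subseteq> (\<Union>j\<in>F. V j)"
        by (rule compactE_image[of "\<Inter>m. E m 0" UNIV V]) (use opV covV in auto)
      obtain m0 where m0: "E m0 0 \<subseteq> (\<Union>j\<in>F. V j)"
      proof -
        let ?O = "\<Union>j\<in>F. V j"
        \<comment> \<open>The open finite cover of the limit set already covers some finite
          generation: otherwise the nested compact sets \<open>E m 0 - ?O\<close> would have a
          common point.\<close>
        have "\<exists>m. E m 0 - ?O = {}"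
        proof (rule ccontr)
          assume *: "\<not> ?thesis"
          have "(\<Inter>m. E m 0 - ?O) \<noteq> {}"
          proof (rule compact_nest)
            show "compact (E m 0 - ?O)" for m
              by (intro compact_diff compact_E open_UN) (simp add: opV)
            show "E m 0 - ?O \<noteq> {}" for m using * by blast
            show "m \<le> m' \<Longrightarrow> E m' 0 - ?O \<subseteq> E m 0 - ?O" for m m' using E_antimono by blast
          qed
          then show False using F(2) by blast
        qed
        then show thesis using that by blast
      qed
      define b where "b j = (if d j = 0 then 1 / 2 ^ (j + 2) else 9 * \<epsilon> * h (d j))" for j
      have "\<exists>i. \<forall>m>i. mu m 0 (V j) \<le> b j" for j
      proof (cases "d j = 0")
        case True
        have "mu m 0 (V j) \<le> b j" if "m > j + 2" for m
        proof -
          obtain m' where m': "m = (j + 2) + m'" using \<open>j + 2 < m\<close> less_imp_add_positive by metis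
          have "t j < e j" using True e(1)[of j] by (simp add: t_def r_def)
          then show ?thesis unfolding m' using mu_tiny[of "j+2" "t j" "V j" m'] wV e(2) True
            by (simp add: b_def)
        qed
        then show ?thesis by blast
      next
        case False
        then have dp: "0 < d j" using d_ge[of j] by simp
        have tj: "t j = 3 * d j" using False by (simp add: t_def r_def)
        have lt: "t j < d1" "t j < \<delta>0"
          using d_le[of j] d1(1) \<delta>0 by (auto simp: tj \<delta>_def min_def split: if_splits)
        have "\<epsilon> * (t j)\<^sup>2 * \<Lambda> (t j) \<le> \<epsilon> * (t j)\<^sup>2 * \<Lambda> (d j)"
          using \<Lambda>[of "d j" "t j"] dp tj lt \<epsilon> by (intro mult_left_mono) auto
        also have "\<dots> = b j" using h[of "d j"] dp tj lt False by (simp add: b_def power2_eq_square)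
        finally have "\<epsilon> * (t j)\<^sup>2 * \<Lambda> (t j) \<le> b j" .
        moreover obtain i where "\<forall>m>i. mu m 0 (V j) \<le> \<epsilon> * (t j)\<^sup>2 * \<Lambda> (t j)"
          using mu_bd[OF t_pos lt(1) wV] by blast
        ultimately show ?thesis by (intro exI[of _ i]) fastforce
      qed
      then have "\<exists>i. \<forall>j. \<forall>m>i j. mu m 0 (V j) \<le> b j"
        by (intro choice[of "\<lambda>j i. \<forall>m>i. mu m 0 (V j) \<le> b j"] allI)
      then obtain i where i: "\<And>j m. m > i j \<Longrightarrow> mu m 0 (V j) \<le> b j" by blast
      define m where "m = m0 + Suc (\<Sum>j\<in>F. i j)"
      have quarter: "(\<lambda>j. 1 / 2 ^ (j + 2) :: real) sums (1 / 2)"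
        using sums_mult2[OF geometric_sums[of "1/2::real"], of "1/4"] by (simp add: power_divide mult.commute)
      have "1 = mu m 0 (\<Union>j\<in>F. V j)"
      proof -
        have "E m 0 \<subseteq> E m0 0" by (rule E_antimono) (simp add: m_def)
        then show ?thesis using mu_eq_1[of m 0] m0 by (metis subset_trans)
      qed
      also have "\<dots> \<le> (\<Sum>j\<in>F. mu m 0 (V j))" by (rule mu_UN_le[OF F(1)])
      also have "\<dots> \<le> (\<Sum>j\<in>F. b j)"
      proof (rule sum_mono)
        fix j assume "j \<in> F"
        then have "i j \<le> (\<Sum>j\<in>F. i j)" using F(1) by (simp add: member_le_sum)
        then show "mu m 0 (V j) \<le> b j" by (intro i) (simp add: m_def)
      qed
      also have "\<dots> \<le> (\<Sum>j\<in>F. 1 / 2 ^ (j + 2) + 9 * \<epsilon> * (if d j = 0 then 0 else h (d j)))"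
        by (intro sum_mono) (auto simp: b_def)
      also have "\<dots> = (\<Sum>j\<in>F. 1 / 2 ^ (j + 2)) + 9 * \<epsilon> * (\<Sum>j\<in>F. if d j = 0 then 0 else h (d j))"
        by (simp add: sum.distrib sum_distrib_left)
      also have "(\<Sum>j\<in>F. 1 / 2 ^ (j + 2)) \<le> (\<Sum>j. (1 / 2 ^ (j + 2) :: real))"
      proof (rule sum_le_suminf)
        show "summable (\<lambda>j. 1 / 2 ^ (j + 2) :: real)"
          using sums_summable[OF quarter] .
      qed (use F in auto)
      also have "(\<Sum>j. (1 / 2 ^ (j + 2) :: real)) = 1 / 2"
        using sums_unique[OF quarter] by simp
      finally have *: "1 / (18 * \<epsilon>) \<le> (\<Sum>j\<in>F. if d j = 0 then 0 else h (d j))"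
        using \<epsilon> by (simp add: field_simps)
      have "ennreal (1 / (18 * \<epsilon>)) \<le> ennreal (\<Sum>j\<in>F. if d j = 0 then 0 else h (d j))"
        by (rule ennreal_leI[OF *])
      also have "\<dots> \<le> (\<Sum>j\<in>F. ennreal (if d j = 0 then 0 else h (d j)))"
      proof -
        \<comment> \<open>\<open>ennreal\<close> truncates negative terms to 0, so only
          subadditivity is available for arbitrary real terms.\<close>
        have "ennreal (\<Sum>j\<in>F. x j) \<le> (\<Sum>j\<in>F. ennreal (x j))" for x :: "nat \<Rightarrow> real"
          using F(1)
        proof (induction F)
          case (insert a F)
          have "ennreal (x a + sum x F) \<le> ennreal (max 0 (x a) + max 0 (sum x F))"
            by (rule ennreal_leI) simp
          also have "\<dots> = ennreal (x a) + ennreal (sum x F)"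
            by (subst ennreal_plus) (auto simp: max_def ennreal_neg)
          also have "\<dots> \<le> ennreal (x a) + (\<Sum>j\<in>F. ennreal (x j))"
            by (rule add_left_mono) (rule insert.IH)
          finally show ?case using insert.hyps by simp
        qed simp
        then show ?thesis .
      qed
      also have "\<dots> \<le> (\<Sum>j. ennreal (if d j = 0 then 0 else h (d j)))"
        by (intro sum_le_suminf) (use F in auto)
      finally show ?thesis by (simp only: d_def)
    qed
    then show ?thesis using \<delta> unfolding hausdorff_premeasure_def
      by (intro exI[of _ \<delta>] conjI INF_greatest) auto
  qed
  have "ennreal x \<le> hausdorff_measure h X" if "x > 0" for x
  proof -
    obtain \<delta> where "\<delta> > 0" "ennreal (1 / (18 * (1 / (18 * x)))) \<le> hausdorff_premeasure h \<delta> X"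
      using main[of "1 / (18 * x)"] \<open>0 < x\<close> by auto
    then show ?thesis unfolding hausdorff_measure_eq_SUP using that
      by (auto intro: SUP_upper2)
  qed
  then have *: "ennreal x \<le> hausdorff_measure h X" if "x > 0" for x using that by blast
  show ?thesis
  proof (cases "hausdorff_measure h X")
    case (real r)
    then show ?thesis using *[of "r + 1"] by (simp add: ennreal_le_iff)
  qed simp
qed

end

section \<open>Functions bounded away from sparse simple poles\<close>

text \<open>\<open>\<alpha> p\<close> is the residue at \<open>p\<close>. As its modulus equals the
  scale \<open>s p\<close>, the principal part has modulus 2 on the boundary of the disc of radius
  \<open>s p / 2\<close>, whatever the scale; this is why one constant \<open>C\<close> can serve
  for all poles. The value 0 at poles is the convention of
  \<open>nicely_meromorphic_on\<close>.\<close>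

locale pole_field =
  fixes g :: "complex \<Rightarrow> complex" and P :: "complex set" and s :: "complex \<Rightarrow> real"
    and \<alpha> :: "complex \<Rightarrow> complex" and C :: real
  assumes s_pos: "p \<in> P \<Longrightarrow> 0 < s p"
    and norm_\<alpha>: "p \<in> P \<Longrightarrow> norm (\<alpha> p) = s p"
    and disj: "p \<in> P \<Longrightarrow> q \<in> P \<Longrightarrow> p \<noteq> q \<Longrightarrow> s p / 2 + s q / 2 \<le> dist p q"
    and fin: "finite (P \<inter> cball 0 r)"
    and hol: "g holomorphic_on - P"
    and loc: "p \<in> P \<Longrightarrow> \<exists>e. e holomorphic_on ball p (s p / 2) \<and>
                (\<forall>z\<in>ball p (s p / 2). norm (e z) \<le> C) \<and>
                (\<forall>z\<in>ball p (s p / 2) - {p}. g z = \<alpha> p / (z - p) + e z)"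
    and off: "z \<notin> (\<Union>p\<in>P. ball p (s p / 2)) \<Longrightarrow> norm (g z) \<le> C"
    and zero: "p \<in> P \<Longrightarrow> g p = 0"
    and C_ge: "1 \<le> C"
begin

lemma not_islimpt_P: "\<not> x islimpt P"
proof
  assume "x islimpt P"
  then have "infinite (P \<inter> ball x 1)" unfolding islimpt_eq_infinite_ball by simp
  moreover have "P \<inter> ball x 1 \<subseteq> P \<inter> cball 0 (norm x + 1)"
  proof
    fix y assume "y \<in> P \<inter> ball x 1"
    then show "y \<in> P \<inter> cball 0 (norm x + 1)"
      using norm_triangle_ineq2[of y x] by (auto simp: dist_norm norm_minus_commute)
  qed
  ultimately show False using fin[of "norm x + 1"] finite_subset by blast
qed

lemma closed_P: "closed P"
  using not_islimpt_P by (auto simp: closed_limpt)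

lemma balls_eq:
  assumes "p \<in> P" "q \<in> P" "z \<in> ball p (s p / 2)" "z \<in> ball q (s q / 2)"
  shows "p = q"
  using disj[OF assms(1,2)] assms(3,4) dist_triangle[of p q z] by (auto simp: dist_commute)

definition rem :: "complex \<Rightarrow> complex \<Rightarrow> complex" where
  "rem p = (SOME e. e holomorphic_on ball p (s p / 2) \<and>
                (\<forall>z\<in>ball p (s p / 2). norm (e z) \<le> C) \<and>
                (\<forall>z\<in>ball p (s p / 2) - {p}. g z = \<alpha> p / (z - p) + e z))"

lemma rem:
  assumes "p \<in> P"
  shows "rem p holomorphic_on ball p (s p / 2)"
    and "z \<in> ball p (s p / 2) \<Longrightarrow> norm (rem p z) \<le> C"
    and "z \<in> ball p (s p / 2) \<Longrightarrow> z \<noteq> p \<Longrightarrow> g z = \<alpha> p / (z - p) + rem p z"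
  using someI_ex[OF loc[OF assms]] unfolding rem_def[symmetric] by blast+

lemma rem_has_deriv:
  assumes "p \<in> P" "z \<in> ball p (s p / 2)"
  shows "(rem p has_field_derivative deriv (rem p) z) (at z)"
  by (rule holomorphic_derivI[OF rem(1)[OF assms(1)] open_ball assms(2)])

text \<open>Cauchy's estimate on the disc of radius \<open>s p / 4\<close> about \<open>z\<close>,
  which lies where the remainder is bounded by \<open>C\<close>.\<close>

lemma deriv_rem_le:
  assumes p: "p \<in> P" and z: "z \<in> cball p (s p / 8)"
  shows "norm (deriv (rem p) z) \<le> 4 * C / s p"
proof -
  have sub: "cball z (s p / 4) \<subseteq> ball p (s p / 2)"
  proof
    fix x assume "x \<in> cball z (s p / 4)"
    then show "x \<in> ball p (s p / 2)"
      using z s_pos[OF p] dist_triangle[of p x z] by auto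
  qed
  have "norm ((deriv ^^ 1) (rem p) z) \<le> fact 1 * C / (s p / 4) ^ 1"
  proof (rule Cauchy_inequality)
    show "rem p holomorphic_on ball z (s p / 4)"
      by (rule holomorphic_on_subset[OF rem(1)[OF p]]) (use sub in auto)
    show "continuous_on (cball z (s p / 4)) (rem p)"
      by (rule holomorphic_on_imp_continuous_on, rule holomorphic_on_subset[OF rem(1)[OF p] sub])
    show "norm (rem p x) \<le> C" if "norm (z - x) = s p / 4" for x
      by (rule rem(2)[OF p], rule subsetD[OF sub]) (use that in \<open>simp add: dist_norm\<close>)
  qed (use s_pos[OF p] in simp)
  then show ?thesis by (simp add: mult.commute)
qed

lemma rem_lipschitz:
  assumes p: "p \<in> P" and z: "z \<in> cball p (s p / 8)" and w: "w \<in> cball p (s p / 8)"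
  shows "norm (rem p z - rem p w) \<le> 4 * C / s p * norm (z - w)"
proof (rule field_differentiable_bound[OF convex_cball _ _ z w])
  fix x assume x: "x \<in> cball p (s p / 8)"
  show "(rem p has_field_derivative deriv (rem p) x) (at x within cball p (s p / 8))"
    by (rule has_field_derivative_at_within, rule rem_has_deriv[OF p]) (use x s_pos[OF p] in auto)
  show "norm (deriv (rem p) x) \<le> 4 * C / s p" by (rule deriv_rem_le[OF p x])
qed

lemma large_imp_near:
  assumes "norm (g z) > C"
  obtains p where "p \<in> P" "z \<in> ball p (s p / 2)" "z \<noteq> p"
proof -
  obtain p where p: "p \<in> P" "z \<in> ball p (s p / 2)" using off[of z] assms by (cases "z \<in> (\<Union>p\<in>P. ball p (s p / 2))") auto
  then have "z \<noteq> p" using zero[of p] assms C_ge by auto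
  with p show thesis using that by blast
qed

text \<open>The threshold \<open>9 * C\<close> leaves \<open>8 * C\<close> for the principal part
  after the remainder is subtracted, which puts \<open>z\<close> within \<open>s p / (8 * C)\<close>
  of the pole.\<close>

lemma very_large_imp_close:
  assumes p: "p \<in> P" "z \<in> ball p (s p / 2)" "z \<noteq> p" and large: "norm (g z) \<ge> 9 * C"
  shows "8 * C * norm (z - p) \<le> s p" "z \<in> cball p (s p / 8)"
proof -
  have "norm (\<alpha> p / (z - p)) \<ge> norm (g z) - norm (rem p z)"
    using rem(3)[OF p] norm_triangle_ineq[of "\<alpha> p / (z - p)" "rem p z"] by simp
  also have "norm (g z) - norm (rem p z) \<ge> 8 * C" using rem(2)[OF p(1,2)] large by simp
  finally show 1: "8 * C * norm (z - p) \<le> s p"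
    using p by (simp add: norm_divide norm_\<alpha> pos_le_divide_eq)
  have "8 * norm (z - p) \<le> 8 * C * norm (z - p)" using C_ge mult_right_mono[of 1 C "8 * norm (z - p)"] by (simp add: mult.commute mult.left_commute)
  then show "z \<in> cball p (s p / 8)" using 1 by (simp add: dist_norm norm_minus_commute)
qed

text \<open>Where g is large, z is so close to its pole that the derivative of the principal part
  has modulus at least \<open>64 * C\<^sup>2 / s p\<close>, against at most
  \<open>4 * C / s p\<close> for the remainder.\<close>

lemma deriv_g_nonzero:
  assumes large: "norm (g z) \<ge> 9 * C" and z: "z \<notin> P"
  shows "deriv g z \<noteq> 0"
proof
  assume 0: "deriv g z = 0"
  obtain p where p: "p \<in> P" "z \<in> ball p (s p / 2)" "z \<noteq> p"
    using large_imp_near[of z] large C_ge by auto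
  note close = very_large_imp_close[OF p large]
  have sp: "0 < s p" using s_pos p by blast
  have "((\<lambda>w. \<alpha> p / (w - p) + rem p w) has_field_derivative - \<alpha> p / (z - p)^2 + deriv (rem p) z) (at z)"
    using p by (auto intro!: derivative_eq_intros rem_has_deriv simp: power2_eq_square)
  moreover have "eventually (\<lambda>w. g w = \<alpha> p / (w - p) + rem p w) (nhds z)"
  proof -
    have "eventually (\<lambda>w. w \<in> ball p (s p / 2) - {p}) (nhds z)"
      by (rule eventually_nhds_in_open) (use p in auto)
    then show ?thesis by eventually_elim (use rem(3)[OF p(1)] in auto)
  qed
  ultimately have "(g has_field_derivative - \<alpha> p / (z - p)^2 + deriv (rem p) z) (at z)"
    by (subst DERIV_cong_ev[OF refl _ refl])
  then have "\<alpha> p / (z - p)^2 = deriv (rem p) z" using 0 by (auto dest: DERIV_imp_deriv)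
  then have "s p / norm (z - p)^2 \<le> 4 * C / s p"
    using deriv_rem_le[OF p(1) close(2)] norm_\<alpha>[OF p(1)] by (metis norm_divide norm_power)
  then have "s p ^ 2 \<le> 4 * C * norm (z - p)^2"
    using sp p(3) by (simp add: field_simps power2_eq_square)
  also have "\<dots> < (8 * C * norm (z - p))^2"
    using C_ge p(3) mult_left_mono[of 1 C C] by (simp add: power_mult_distrib power2_eq_square)
  also have "\<dots> \<le> s p ^ 2" using close(1) C_ge by (intro power_mono) auto
  finally show False by simp
qed

text \<open>The discs about the poles are open and disjoint, so by connectedness the tail of such a
  curve is trapped in one of them and is bounded.\<close>

lemma no_large_curve:
  assumes "curve_to_infinity c" "\<forall>\<^sub>F t in at_top. c t \<in> P \<or> norm (g (c t)) > C"
  shows False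
proof -
  obtain T0 where T0: "\<And>t. t \<ge> T0 \<Longrightarrow> c t \<in> P \<or> norm (g (c t)) > C"
    using assms(2) by (auto simp: eventually_at_top_linorder)
  define T where "T = max 0 T0"
  have in_balls: "c t \<in> (\<Union>p\<in>P. ball p (s p / 2))" if "t \<ge> T" for t
  proof (cases "c t \<in> P")
    case True
    then have "c t \<in> ball (c t) (s (c t) / 2)" using s_pos by simp
    then show ?thesis using True by blast
  next
    case False
    then have "norm (g (c t)) > C" using T0[of t] that by (auto simp: T_def)
    then show ?thesis using large_imp_near[of "c t"] by blast
  qed
  obtain p where p: "p \<in> P" "c T \<in> ball p (s p / 2)" using in_balls[of T] by auto
  have "connected (c ` {T..})"
    using assms(1) by (intro connected_continuous_image) (auto simp: curve_to_infinity_def T_def intro: continuous_on_subset)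
  then have "c ` {T..} \<subseteq> ball p (s p / 2)"
  proof (rule contrapos_pp)
    assume *: "\<not> c ` {T..} \<subseteq> ball p (s p / 2)"
    let ?B = "\<Union>q\<in>P - {p}. ball q (s q / 2)"
    have "open ?B" by auto
    moreover have "ball p (s p / 2) \<inter> ?B = {}" using balls_eq[OF p(1)] by blast
    moreover have "c ` {T..} \<subseteq> ball p (s p / 2) \<union> ?B" using in_balls by fastforce
    moreover have "c T \<in> ball p (s p / 2) \<inter> c ` {T..}" using p by auto
    moreover have "?B \<inter> c ` {T..} \<noteq> {}" using * calculation(3) by blast
    ultimately show "\<not> connected (c ` {T..})"
      unfolding connected_def using open_ball[of p "s p / 2"] by blast
  qed
  then have "norm (c t) \<le> norm p + s p" if "t \<ge> T" for t
  proof -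
    have "dist p (c t) < s p / 2" using that \<open>c ` {T..} \<subseteq> ball p (s p / 2)\<close> by auto
    then show ?thesis using norm_triangle_ineq2[of "c t" p] s_pos[OF p(1)]
      by (simp add: dist_norm norm_minus_commute)
  qed
  moreover have "eventually (\<lambda>t. norm (c t) \<ge> norm p + s p + 1) at_top"
    using assms(1) s_pos[OF p(1)] filterlim_at_infinity[of 0 c at_top]
    by (simp add: curve_to_infinity_def add_nonneg_pos)
  then have "eventually (\<lambda>t. norm (c t) \<ge> norm p + s p + 1 \<and> t \<ge> T) at_top"
    using eventually_ge_at_top by (rule eventually_conj)
  then obtain t where "norm (c t) \<ge> norm p + s p + 1" "t \<ge> T"
    by (metis (mono_tags, lifting) eventually_happens trivial_limit_at_top_linorder)
  ultimately show False by force
qed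

text \<open>The equation \<open>g z = X\<close> is rewritten as the fixed point equation
  \<open>z = p + \<alpha> p / (X - rem p z)\<close>, and Brouwer's theorem is applied on the disc of
  radius \<open>s p / 8\<close>. Uniqueness follows from the second estimate of
  \<open>branch_bounds\<close>.\<close>

lemma branch_exists:
  assumes p: "p \<in> P" and X: "norm X \<ge> 9 * C"
  obtains z where "z \<in> cball p (s p / 8)" "z \<noteq> p" "g z = X"
proof -
  have sp: "0 < s p" by (rule s_pos[OF p])
  let ?B = "cball p (s p / 8)"
  have B: "?B \<subseteq> ball p (s p / 2)" using sp by auto
  have ge: "norm (X - rem p z) \<ge> 8 * C" if "z \<in> ?B" for z
    using norm_triangle_ineq2[of X "rem p z"] rem(2)[OF p, of z] that B X by auto
  have nz: "X - rem p z \<noteq> 0" if "z \<in> ?B" for z using ge[OF that] C_ge by auto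
  have cont: "continuous_on ?B (\<lambda>z. p + \<alpha> p / (X - rem p z))"
    using nz holomorphic_on_imp_continuous_on[OF holomorphic_on_subset[OF rem(1)[OF p] B]]
    by (intro continuous_intros) auto
  have maps: "(\<lambda>z. p + \<alpha> p / (X - rem p z)) \<in> ?B \<rightarrow> ?B"
  proof
    fix z assume z: "z \<in> ?B"
    have "norm (\<alpha> p / (X - rem p z)) \<le> s p / 8"
      unfolding norm_divide norm_\<alpha>[OF p] by (rule divide_left_mono) (use ge[OF z] C_ge sp in auto)
    then show "p + \<alpha> p / (X - rem p z) \<in> ?B" by (simp add: dist_norm)
  qed
  obtain z where z: "z \<in> ?B" "p + \<alpha> p / (X - rem p z) = z"
    using brouwer_ball[OF _ cont maps] sp by auto
  have "\<alpha> p \<noteq> 0" using norm_\<alpha>[OF p] sp by auto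
  then have zp: "z \<noteq> p" using z(2) nz[OF z(1)] by auto
  then have "X - rem p z = \<alpha> p / (z - p)"
    using z(2) nz[OF z(1)] \<open>\<alpha> p \<noteq> 0\<close> by (metis add_diff_cancel_left' divide_divide_eq_right nonzero_mult_div_cancel_left)
  then have "g z = X" using rem(3)[OF p subsetD[OF B z(1)] zp] by (simp add: algebra_simps)
  with z zp show thesis using that by blast
qed

text \<open>g is its principal part plus a Lipschitz remainder that is dominated near the pole. The
  first estimate bounds the contraction of the inverse branch from below; the second gives its
  injectivity of choice and its continuity.\<close>

lemma branch_bounds:
  assumes p: "p \<in> P"
    and z: "z \<in> cball p (s p / 8)" "z \<noteq> p" "norm (g z) \<ge> 9 * C"
    and w: "w \<in> cball p (s p / 8)" "w \<noteq> p" "norm (g w) \<ge> 9 * C"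
  shows "s p * norm (g z - g w) \<le> 8 * (norm (g z) * norm (g w)) * norm (z - w)"
    and "norm (z - w) \<le> s p * norm (g z - g w)"
proof -
  have sp: "0 < s p" by (rule s_pos[OF p])
  have B: "z \<in> ball p (s p / 2)" "w \<in> ball p (s p / 2)" using sp z w by auto
  note gz = rem(3)[OF p B(1) z(2)] and gw = rem(3)[OF p B(2) w(2)]
  have lip: "s p * norm (rem p z - rem p w) \<le> 4 * C * norm (z - w)"
    using rem_lipschitz[OF p z(1) w(1)] sp by (simp add: field_simps)
  \<comment> \<open>Where \<open>norm (g v)\<close> is at least \<open>9 * C\<close>, the remainder
    adds at most one ninth of it.\<close>
  have up: "s p \<le> 10/9 * norm (g v) * norm (v - p)"
    if v: "v \<in> ball p (s p / 2)" "v \<noteq> p" "norm (g v) \<ge> 9 * C" for v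
  proof -
    have "s p / norm (v - p) = norm (g v - rem p v)"
      using rem(3)[OF p v(1,2)] norm_\<alpha>[OF p] by (simp add: norm_divide)
    also have "\<dots> \<le> norm (g v) + norm (rem p v)" by (rule norm_triangle_ineq4)
    also have "\<dots> \<le> 10/9 * norm (g v)" using rem(2)[OF p v(1)] v(3) by simp
    finally show ?thesis using v(2) by (simp add: pos_divide_le_eq)
  qed
  note upz = up[OF B(1) z(2,3)] and upw = up[OF B(2) w(2,3)]
  have diff: "(g z - g w) - (rem p z - rem p w) = \<alpha> p * (w - z) / ((z - p) * (w - p))"
  proof -
    have "(g z - g w) - (rem p z - rem p w) = \<alpha> p / (z - p) - \<alpha> p / (w - p)"
      unfolding gz gw by simp
    also have "\<dots> = (\<alpha> p * (w - p) - \<alpha> p * (z - p)) / ((z - p) * (w - p))"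
      by (rule diff_frac_eq) (use z(2) w(2) in auto)
    finally show ?thesis by (simp add: algebra_simps)
  qed
  define D where "D = norm (z - p) * norm (w - p)"
  have D: "0 < D" using z(2) w(2) by (simp add: D_def)
  have nd: "norm ((g z - g w) - (rem p z - rem p w)) = s p * norm (z - w) / D"
    unfolding diff D_def by (simp add: norm_divide norm_mult norm_\<alpha>[OF p] norm_minus_commute)
  have "s p * s p \<le> (10/9 * norm (g z) * norm (z - p)) * (10/9 * norm (g w) * norm (w - p))"
    using upz upw sp by (intro mult_mono) auto
  then have ss: "s p * s p / D \<le> 100/81 * (norm (g z) * norm (g w))"
    using D by (simp add: pos_divide_le_eq D_def algebra_simps)
  have C_le: "4 * C \<le> norm (g z) * norm (g w)"
  proof -
    have "4 * C \<le> (9 * C) * (9 * C)" using C_ge mult_left_mono[of 1 C C] by simp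
    also have "\<dots> \<le> norm (g z) * norm (g w)" using z w C_ge by (intro mult_mono) auto
    finally show ?thesis .
  qed
  have "s p * norm (g z - g w) \<le> s p * (norm ((g z - g w) - (rem p z - rem p w)) + norm (rem p z - rem p w))"
    using sp norm_triangle_ineq[of "(g z - g w) - (rem p z - rem p w)" "rem p z - rem p w"] by simp
  also have "\<dots> = s p * s p / D * norm (z - w) + s p * norm (rem p z - rem p w)"
    unfolding nd by (simp add: algebra_simps)
  also have "\<dots> \<le> 100/81 * (norm (g z) * norm (g w)) * norm (z - w) + norm (g z) * norm (g w) * norm (z - w)"
    by (intro add_mono mult_right_mono ss order_trans[OF lip] C_le) auto
  also have "\<dots> \<le> 8 * (norm (g z) * norm (g w)) * norm (z - w)"
    by (simp add: algebra_simps)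
  finally show "s p * norm (g z - g w) \<le> 8 * (norm (g z) * norm (g w)) * norm (z - w)" .
  have "(8 * C * norm (z - p)) * (8 * C * norm (w - p)) \<le> s p * s p"
    using very_large_imp_close(1)[OF p B(1) z(2,3)] very_large_imp_close(1)[OF p B(2) w(2,3)] C_ge sp
    by (intro mult_mono) auto
  then have DD: "64 * (C * C) * D \<le> s p * s p" by (simp add: D_def algebra_simps)
  have "64 * C * C * norm (z - w) \<le> s p * (s p * norm (z - w) / D)"
    using mult_right_mono[OF DD, of "norm (z - w)"] D by (simp add: field_simps)
  also have "\<dots> = s p * norm ((g z - g w) - (rem p z - rem p w))" by (simp add: nd)
  also have "\<dots> \<le> s p * (norm (g z - g w) + norm (rem p z - rem p w))"
    using sp norm_triangle_ineq4[of "g z - g w" "rem p z - rem p w"] by simp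
  also have "\<dots> \<le> s p * norm (g z - g w) + 4 * C * norm (z - w)"
    using lip by (simp add: algebra_simps)
  finally have "(64 * C * C - 4 * C) * norm (z - w) \<le> s p * norm (g z - g w)"
    by (simp add: algebra_simps)
  moreover have "1 \<le> 64 * C * C - 4 * C"
  proof -
    have "C \<le> C * C" using C_ge mult_left_mono[of 1 C C] by simp
    moreover have "64 * C * C = 64 * (C * C)" by simp
    ultimately show ?thesis using C_ge by linarith
  qed
  then have "1 * norm (z - w) \<le> (64 * C * C - 4 * C) * norm (z - w)"
    by (rule mult_right_mono) simp
  ultimately show "norm (z - w) \<le> s p * norm (g z - g w)" by simp
qed

definition gpow :: "nat \<Rightarrow> complex \<Rightarrow> complex" where
  "gpow M z = g z ^ M"

context
  fixes M :: nat
  assumes M: "1 \<le> M"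
begin

lemma gpow_holomorphic: "gpow M holomorphic_on - P"
  unfolding gpow_def[abs_def] by (intro holomorphic_intros hol)

lemma gpow_local:
  assumes p: "p \<in> P" and z: "z \<in> ball p (s p / 2)" "z \<noteq> p"
  shows "gpow M z = (\<alpha> p + (z - p) * rem p z) ^ M / (z - p) ^ M"
proof -
  have "g z = (\<alpha> p + (z - p) * rem p z) / (z - p)"
    using rem(3)[OF p z] z(2) by (simp add: add_divide_distrib)
  then show ?thesis by (simp add: gpow_def power_divide)
qed

lemma local_numerator_holomorphic:
  "p \<in> P \<Longrightarrow> (\<lambda>z. (\<alpha> p + (z - p) * rem p z) ^ M) holomorphic_on ball p (s p / 2)"
  by (intro holomorphic_intros rem(1))

lemma gpow_pole:
  assumes p: "p \<in> P"
  shows "is_pole (gpow M) p" "zorder (gpow M) p = - int M"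
proof -
  have sp: "0 < s p" by (rule s_pos[OF p])
  have nz: "\<alpha> p \<noteq> 0" using norm_\<alpha>[OF p] sp by auto
  have "is_pole (\<lambda>z. (\<alpha> p + (z - p) * rem p z) ^ M / (z - p) ^ M) p"
    by (rule is_pole_basic[OF local_numerator_holomorphic[OF p]]) (use sp nz M in auto)
  moreover have "eventually (\<lambda>z. (\<alpha> p + (z - p) * rem p z) ^ M / (z - p) ^ M = gpow M z) (at p)"
  proof -
    have "eventually (\<lambda>z. z \<in> ball p (s p / 2) - {p}) (at p)"
      by (rule eventually_at_in_open) (use sp in auto)
    then show ?thesis by eventually_elim (use gpow_local[OF p] in auto)
  qed
  ultimately show "is_pole (gpow M) p" by (rule is_pole_transform) simp
  show "zorder (gpow M) p = - int M"
  proof (rule zorder_eqI[OF open_ball _ local_numerator_holomorphic[OF p]])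
    show "p \<in> ball p (s p / 2)" "(\<alpha> p + (p - p) * rem p p) ^ M \<noteq> 0" using sp nz by auto
    show "gpow M w = (\<alpha> p + (w - p) * rem p w) ^ M * (w - p) powi - int M"
      if "w \<in> ball p (s p / 2)" "w \<noteq> p" for w
      using gpow_local[OF p that] by (simp add: power_int_minus divide_inverse)
  qed
qed

lemma is_pole_gpow_iff: "is_pole (gpow M) z \<longleftrightarrow> z \<in> P"
  using gpow_pole(1) not_is_pole_holomorphic[of "- P" z "gpow M"] gpow_holomorphic closed_P
  by (auto simp: open_Compl)

lemma gpow_nicely_meromorphic: "gpow M nicely_meromorphic_on UNIV"
  unfolding nicely_meromorphic_on_def
proof (intro conjI ballI)
  show "gpow M meromorphic_on UNIV"
  proof (rule meromorphic_onI_open[where pts = P])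
    show "gpow M analytic_on UNIV - P"
      using gpow_holomorphic closed_P by (simp add: analytic_on_open open_Compl Compl_eq_Diff_UNIV[symmetric])
    show "not_essential (gpow M) z" if "z \<in> P" for z
      using gpow_pole(1)[OF that] by (auto simp: not_essential_def)
  qed (use not_islimpt_P in auto)
  fix z :: complex
  show "is_pole (gpow M) z \<and> gpow M z = 0 \<or> gpow M \<midarrow>z\<rightarrow> gpow M z"
  proof (cases "z \<in> P")
    case True
    then show ?thesis using gpow_pole(1)[OF True] zero[OF True] M by (simp add: gpow_def)
  next
    case False
    then have "isCont (gpow M) z"
      using holomorphic_on_imp_continuous_on[OF gpow_holomorphic] closed_P
      by (auto simp: continuous_on_eq_continuous_at open_Compl)
    then show ?thesis by (simp add: isCont_def)
  qed
qed

lemma gpow_large: "norm (gpow M z) > (9 * C) ^ M \<Longrightarrow> norm (g z) > 9 * C"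
  unfolding gpow_def norm_power by (rule power_less_imp_less_base) auto

text \<open>Beyond modulus \<open>(9 * C) ^ M\<close> there are no critical values, since neither g
  nor its derivative vanishes there, and no asymptotic values, since a curve with such a limit would
  be trapped in one disc.\<close>

lemma gpow_class_B: "gpow M \<in> eremenko_lyubich_class"
proof -
  have crit: "norm v \<le> (9 * C) ^ M" if v: "v \<in> finite_critical_values (gpow M)" for v
  proof (rule ccontr)
    assume "\<not> norm v \<le> (9 * C) ^ M"
    moreover from v obtain z where z: "v = gpow M z" "z \<notin> P" "deriv (gpow M) z = 0"
      by (auto simp: finite_critical_values_def is_pole_gpow_iff)
    ultimately have large: "norm (g z) > 9 * C" using gpow_large[of z] by simp
    have "(g has_field_derivative deriv g z) (at z)"
      using hol z(2) closed_P by (intro holomorphic_derivI[of g "- P"]) (auto simp: open_Compl)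
    then have "(gpow M has_field_derivative of_nat M * (deriv g z * g z ^ (M - 1))) (at z)"
      unfolding gpow_def[abs_def] using DERIV_power[of g "deriv g z" z UNIV M] by simp
    then have "of_nat M * (deriv g z * g z ^ (M - 1)) = 0" using z(3) DERIV_imp_deriv by metis
    then show False using M large C_ge deriv_g_nonzero[of z] z(2) by auto
  qed
  have asym: "norm a \<le> (9 * C) ^ M" if a: "a \<in> finite_asymptotic_values (gpow M)" for a
  proof (rule ccontr)
    assume *: "\<not> norm a \<le> (9 * C) ^ M"
    from a obtain c where c: "curve_to_infinity c" "((\<lambda>t. gpow M (c t)) \<longlongrightarrow> a) at_top"
      by (auto simp: finite_asymptotic_values_def)
    have "eventually (\<lambda>t. norm (gpow M (c t)) > (9 * C) ^ M) at_top"
      using order_tendstoD(1)[OF tendsto_norm[OF c(2)]] * by simp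
    then have "eventually (\<lambda>t. c t \<in> P \<or> norm (g (c t)) > C) at_top"
      by eventually_elim (use gpow_large C_ge in force)
    then show False by (rule no_large_curve[OF c(1)])
  qed
  have "bounded (finite_critical_values (gpow M) \<union> finite_asymptotic_values (gpow M))"
    unfolding bounded_iff using crit asym by blast
  then show ?thesis
    using gpow_nicely_meromorphic by (simp add: eremenko_lyubich_class_def finite_inverse_singularities_def bounded_closure)
qed

lemma gpow_no_infinite_asymptotic_value: "\<not> infinity_asymptotic_value (gpow M)"
proof
  assume "infinity_asymptotic_value (gpow M)"
  then obtain c where c: "curve_to_infinity c"
    "\<forall>\<^sub>F t in at_top. is_pole (gpow M) (c t) \<or> (9 * C) ^ M < norm (gpow M (c t))"
    unfolding infinity_asymptotic_value_def by blast
  from c(2) have "\<forall>\<^sub>F t in at_top. c t \<in> P \<or> norm (g (c t)) > C"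
    by eventually_elim (use gpow_large C_ge is_pole_gpow_iff in force)
  then show False by (rule no_large_curve[OF c(1)])
qed

end

end

section \<open>Poles on grids\<close>

text \<open>The subtracted term makes the induction telescope:
  \<open>1 / (1 + (n+2)\<^sup>2)\<close> is at most \<open>1 / (n+1) - 1 / (n+2)\<close>.\<close>

lemma sum_inverse_squares_int: "(\<Sum>d=-int (Suc n)..int (Suc n). 1 / (1 + (of_int d)\<^sup>2 :: real)) \<le> 5 - 2 / (real n + 1)"
proof (induction n)
  case 0
  have "{-1..1} = {-1, 0, 1 :: int}" by auto
  then show ?case by simp
next
  case (Suc n)
  have eq: "{-int (Suc (Suc n))..int (Suc (Suc n))} =
      insert (int n + 2) (insert (- int n - 2) {-int (Suc n)..int (Suc n)})" by auto
  have "(\<Sum>d=-int (Suc (Suc n))..int (Suc (Suc n)). 1 / (1 + (of_int d)\<^sup>2 :: real))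
      = 2 / (1 + (real n + 2)\<^sup>2) + (\<Sum>d=-int (Suc n)..int (Suc n). 1 / (1 + (of_int d)\<^sup>2 :: real))"
    unfolding eq by (simp add: power2_eq_square algebra_simps)
  also have "\<dots> \<le> 2 / ((real n + 1) * (real n + 2)) + (5 - 2 / (real n + 1))"
    by (intro add_mono Suc divide_left_mono) (auto simp: power2_eq_square algebra_simps intro!: add_pos_nonneg)
  also have "2 / ((real n + 1) * (real n + 2)) = 2 / (real n + 1) - 2 / (real n + 2)"
    by (subst diff_frac_eq) auto
  finally show ?case by (simp add: add.commute)
qed

text \<open>Replacing \<xi> by its integer part costs a factor 3, and 15 = 3 * 5. The bound is
  independent of both n and \<xi>.\<close>

lemma sum_inverse_quadratic:
  fixes \<xi> :: real
  shows "(\<Sum>i<n. 1 / (1 + (\<xi> - real i)\<^sup>2)) \<le> 15"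
proof -
  define m where "m = \<lfloor>\<xi>\<rfloor>"
  define D where "D = (\<lambda>i. int i - m) ` {..<n}"
  define K where "K = n + nat \<bar>m\<bar>"
  have "1 / (1 + (\<xi> - real i)\<^sup>2) \<le> 3 / (1 + (of_int (int i - m))\<^sup>2)" for i
  proof -
    define \<theta> d where "\<theta> = \<xi> - of_int m" and "d = real i - of_int m"
    have \<theta>: "0 \<le> \<theta>" "\<theta> \<le> 1" using floor_correct[of \<xi>] unfolding \<theta>_def m_def by linarith+
    have "\<theta>\<^sup>2 \<le> 1" using \<theta> by (simp add: power_le_one)
    \<comment> \<open>The parallelogram law for \<open>\<theta> - d\<close> and
      \<open>\<theta>\<close>; dropping one square gives
      \<open>d\<^sup>2 \<le> 2 * (\<theta> - d)\<^sup>2 + 2\<close>.\<close>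
    moreover have "d\<^sup>2 + (d - 2 * \<theta>)\<^sup>2 = 2 * (\<theta> - d)\<^sup>2 + 2 * \<theta>\<^sup>2" by (simp add: power2_eq_square algebra_simps)
    moreover have "0 \<le> (d - 2 * \<theta>)\<^sup>2" "0 \<le> (\<theta> - d)\<^sup>2" by auto
    moreover have "1 + a \<le> 3 * (1 + c)" if "t \<le> 1" "a + b = 2 * c + 2 * t" "0 \<le> b" "0 \<le> c" for a b c t :: real
      using that by auto
    ultimately have "1 + d\<^sup>2 \<le> 3 * (1 + (\<theta> - d)\<^sup>2)" by blast
    moreover have "\<theta> - d = \<xi> - real i" by (simp add: \<theta>_def d_def)
    ultimately have "1 + d\<^sup>2 \<le> 3 * (1 + (\<xi> - real i)\<^sup>2)" by simp
    then have "1 / (1 + (\<xi> - real i)\<^sup>2) \<le> 3 / (1 + d\<^sup>2)"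
      by (simp add: divide_simps add_nonneg_eq_0_iff add_pos_nonneg)
    then show ?thesis by (simp add: d_def)
  qed
  then have "(\<Sum>i<n. 1 / (1 + (\<xi> - real i)\<^sup>2)) \<le> (\<Sum>i<n. 3 / (1 + (of_int (int i - m))\<^sup>2))"
    by (intro sum_mono)
  also have "\<dots> = (\<Sum>d\<in>D. 3 / (1 + (of_int d)\<^sup>2))"
    unfolding D_def by (subst sum.reindex) (auto simp: inj_on_def)
  also have "\<dots> \<le> (\<Sum>d=-int (Suc K)..int (Suc K). 3 / (1 + (of_int d)\<^sup>2))"
    by (rule sum_mono2) (auto simp: D_def K_def)
  also have "\<dots> = 3 * (\<Sum>d=-int (Suc K)..int (Suc K). 1 / (1 + (of_int d)\<^sup>2))"
    by (simp add: sum_distrib_left)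
  also have "\<dots> \<le> 3 * (5 - 2 / (real K + 1))" by (intro mult_left_mono sum_inverse_squares_int) simp
  also have "\<dots> \<le> 15" by simp
  finally show ?thesis .
qed

section \<open>The kernel with four poles\<close>

definition kern :: "complex \<Rightarrow> complex" where
  "kern w = 4 / (w ^ 4 - 1)"

text \<open>The part of \<open>kern v\<close> that is regular at 1, that is,
  \<open>kern v - 1 / (v - 1)\<close> in closed form.\<close>

definition kern_reg :: "complex \<Rightarrow> complex" where
  "kern_reg v = - (v\<^sup>2 + 2 * v + 3) / ((v + 1) * ((v - \<i>) * (v + \<i>)))"

abbreviation U4 :: "complex set" where
  "U4 \<equiv> {1, -1, \<i>, -\<i>}"

lemma pow4_factor: "w ^ 4 - 1 = (w - 1) * ((w + 1) * ((w - \<i>) * (w + \<i>)))" for w :: complex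
  by (simp add: algebra_simps power4_eq_xxxx)

lemma pow4_eq_1_iff: "w ^ 4 = 1 \<longleftrightarrow> w \<in> U4" for w :: complex
proof -
  have "w ^ 4 = 1 \<longleftrightarrow> w ^ 4 - 1 = 0" by simp
  also have "\<dots> \<longleftrightarrow> w \<in> U4" unfolding pow4_factor by (auto simp: eq_neg_iff_add_eq_0)
  finally show ?thesis .
qed

lemma norm_U4: "\<omega> \<in> U4 \<Longrightarrow> norm \<omega> = 1"
  by auto

lemma U4_nz: "\<omega> \<in> U4 \<Longrightarrow> \<omega> \<noteq> 0"
  by auto

lemma dist_U4: "\<omega> \<in> U4 \<Longrightarrow> \<omega>' \<in> U4 \<Longrightarrow> \<omega> \<noteq> \<omega>' \<Longrightarrow> 7/5 \<le> norm (\<omega> - \<omega>')"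
proof -
  have *: "7/5 \<le> sqrt 2" by (rule real_le_rsqrt) (simp add: power2_eq_square)
  show "\<omega> \<in> U4 \<Longrightarrow> \<omega>' \<in> U4 \<Longrightarrow> \<omega> \<noteq> \<omega>' \<Longrightarrow> 7/5 \<le> norm (\<omega> - \<omega>')"
    using * by (auto simp: cmod_def)
qed

text \<open>The kernel is invariant under multiplication by fourth roots of unity, so the expansion
  at 1 in the variable \<open>w / \<omega>\<close> serves for all four poles.\<close>

lemma kern_eq:
  assumes "\<omega> \<in> U4" "w \<notin> U4"
  shows "kern w = \<omega> / (w - \<omega>) + kern_reg (w / \<omega>)"
proof -
  define v where "v = w / \<omega>"
  have \<omega>: "\<omega> \<noteq> 0" "\<omega> ^ 4 = 1" using assms(1) by (auto simp: pow4_eq_1_iff[symmetric])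
  have w: "w = \<omega> * v" using \<omega> by (simp add: v_def)
  have "v ^ 4 = w ^ 4" using \<omega> by (simp add: v_def power_divide)
  then have v4: "v ^ 4 \<noteq> 1" using assms(2) pow4_eq_1_iff by metis
  have nz: "v - 1 \<noteq> 0" "(v + 1) * ((v - \<i>) * (v + \<i>)) \<noteq> 0"
    using v4 pow4_factor[of v] by auto
  have "kern w = 4 / ((v - 1) * ((v + 1) * ((v - \<i>) * (v + \<i>))))"
    using \<open>v ^ 4 = w ^ 4\<close> by (simp add: kern_def pow4_factor[of v, symmetric])
  also have "\<dots> = 1 / (v - 1) + kern_reg v"
  proof -
    have "1 / (v - 1) + kern_reg v =
      (1 * ((v + 1) * ((v - \<i>) * (v + \<i>))) + - (v\<^sup>2 + 2 * v + 3) * (v - 1)) / ((v - 1) * ((v + 1) * ((v - \<i>) * (v + \<i>))))"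
      unfolding kern_reg_def by (rule add_frac_eq) (use nz in auto)
    also have "1 * ((v + 1) * ((v - \<i>) * (v + \<i>))) + - (v\<^sup>2 + 2 * v + 3) * (v - 1) = 4"
      by (simp add: algebra_simps power2_eq_square)
    finally show ?thesis by simp
  qed
  also have "1 / (v - 1) = \<omega> / (w - \<omega>)"
    using \<omega> nz(1) by (simp add: w field_simps)
  finally show ?thesis by (simp add: v_def)
qed

lemma kern_reg_bound:
  assumes "norm (v - 1) < 1/2"
  shows "norm (kern_reg v) \<le> 8" "v + 1 \<noteq> 0" "(v - \<i>) * (v + \<i>) \<noteq> 0"
proof -
  have v: "norm v \<le> 3/2" using assms norm_triangle_ineq2[of v 1] by simp
  have 1: "norm (v + 1) \<ge> 3/2"
    using assms norm_triangle_ineq2[of 2 "1 - v"] by (simp add: norm_minus_commute add.commute)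
  have far: "norm (v - \<omega>) \<ge> 9/10" if "\<omega> \<in> {\<i>, -\<i>}" for \<omega>
  proof -
    have "7/5 \<le> norm (\<omega> - 1)" by (rule dist_U4) (use that in \<open>auto simp: complex_eq_iff\<close>)
    moreover have "norm (\<omega> - 1) \<le> norm (v - 1) + norm (v - \<omega>)"
      using norm_triangle_ineq4[of "v - 1" "v - \<omega>"] by simp
    ultimately show ?thesis using assms by linarith
  qed
  have "(3/2::real) * (9/10 * (9/10)) \<le> norm (v + 1) * (norm (v - \<i>) * norm (v + \<i>))"
    using 1 far[of \<i>] far[of "-\<i>"] by (intro mult_mono) auto
  then have den: "6/5 \<le> norm ((v + 1) * ((v - \<i>) * (v + \<i>)))" by (simp add: norm_mult)
  have "norm (v\<^sup>2 + 2 * v + 3) \<le> norm v ^ 2 + 2 * norm v + 3"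
    by (metis (no_types, opaque_lifting) norm_triangle_mono norm_mult norm_numeral norm_power order_refl)
  also have "norm v ^ 2 \<le> (3/2) ^ 2" using v by (intro power_mono) auto
  finally have num: "norm (v\<^sup>2 + 2 * v + 3) \<le> 9" using v by (simp add: power2_eq_square)
  have "norm (kern_reg v) \<le> 9 / (6/5)"
    unfolding kern_reg_def norm_divide norm_minus_cancel by (intro frac_le num den) auto
  then show "norm (kern_reg v) \<le> 8" by simp
  show "v + 1 \<noteq> 0" using 1 by auto
  show "(v - \<i>) * (v + \<i>) \<noteq> 0" using far[of \<i>] far[of "-\<i>"] by auto
qed

text \<open>Each of the four linear factors has modulus at least 1/2, and 64 = 4 * 2^4.\<close>

lemma kern_bound_near:
  assumes "\<And>\<omega>. \<omega> \<in> U4 \<Longrightarrow> 1/2 \<le> norm (w - \<omega>)"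
  shows "norm (kern w) \<le> 64"
proof -
  have "(1/2::real) * (1/2 * (1/2 * (1/2))) \<le> norm (w - 1) * (norm (w + 1) * (norm (w - \<i>) * norm (w + \<i>)))"
    using assms[of 1] assms[of "-1"] assms[of \<i>] assms[of "-\<i>"] by (intro mult_mono) auto
  then have "1/16 \<le> norm (w ^ 4 - 1)" unfolding pow4_factor by (simp add: norm_mult)
  then have "4 / norm (w ^ 4 - 1) \<le> 4 / (1/16)" by (intro divide_left_mono) auto
  then show ?thesis by (simp add: kern_def norm_divide)
qed

lemma kern_bound_far:
  assumes "2 \<le> norm w"
  shows "norm (kern w) \<le> 5 / norm w ^ 4"
proof -
  have "(2::real) ^ 4 \<le> norm w ^ 4" using assms by (intro power_mono) auto
  then have 16: "16 \<le> norm w ^ 4" by simp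
  have "norm w ^ 4 - 1 \<le> norm (w ^ 4 - 1)" using norm_triangle_ineq2[of "w ^ 4" 1] by (simp add: norm_power)
  then have "4/5 * norm w ^ 4 \<le> norm (w ^ 4 - 1)" using 16 by linarith
  then have "4 / norm (w ^ 4 - 1) \<le> 4 / (4/5 * norm w ^ 4)"
    using 16 by (intro divide_left_mono mult_pos_pos) auto
  then show ?thesis by (simp add: kern_def norm_divide)
qed

text \<open>For |w| at least 2 the decay of order 4 dominates a product of functions of the two
  coordinates, so that the sum over a square grid factors into two sums over lines.\<close>

lemma kern_bound_product:
  assumes "2 \<le> norm w"
  shows "norm (kern w) \<le> 5 * (1 / (1 + (Re w)\<^sup>2) * (1 / (1 + (Im w)\<^sup>2)))"
proof -
  define r where "r = norm w ^ 2"
  have r: "r = (Re w)\<^sup>2 + (Im w)\<^sup>2" by (simp add: r_def cmod_power2)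
  have "(2::real) ^ 2 \<le> r" unfolding r_def using assms by (intro power_mono) auto
  then have r4: "4 \<le> r" by simp
  have "4 * ((Re w)\<^sup>2 * (Im w)\<^sup>2) \<le> r\<^sup>2"
  proof -
    have "r\<^sup>2 - 4 * ((Re w)\<^sup>2 * (Im w)\<^sup>2) = ((Re w)\<^sup>2 - (Im w)\<^sup>2)\<^sup>2"
      unfolding r by (simp add: power2_eq_square algebra_simps)
    then show ?thesis by (metis diff_ge_0_iff_ge zero_le_power2)
  qed
  moreover have "4 * r \<le> r\<^sup>2" using r4 mult_right_mono[of 4 r r] by (simp add: power2_eq_square)
  ultimately have "(1 + (Re w)\<^sup>2) * (1 + (Im w)\<^sup>2) \<le> r\<^sup>2" using r4 by (simp add: algebra_simps r)
  then have "5 / r\<^sup>2 \<le> 5 / ((1 + (Re w)\<^sup>2) * (1 + (Im w)\<^sup>2))"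
    using r4 by (intro divide_left_mono) (auto intro!: mult_pos_pos add_pos_nonneg)
  then show ?thesis using kern_bound_far[OF assms] by (simp add: r_def power_mult[symmetric])
qed

lemma kern_holomorphic: "(\<And>z. z \<in> S \<Longrightarrow> u z \<notin> U4) \<Longrightarrow> u holomorphic_on S \<Longrightarrow> (\<lambda>z. kern (u z)) holomorphic_on S"
  unfolding kern_def by (intro holomorphic_intros) (simp_all add: pow4_eq_1_iff)

section \<open>Cells and uniformly bounded kernel sums\<close>

locale pole_grid =
  fixes R :: "nat \<Rightarrow> real" and N :: "nat \<Rightarrow> nat"
  assumes R0: "16 \<le> R 0" and R_Suc: "R (Suc k) = (R k)\<^sup>2" and N_ge: "R k \<le> real (N k)"
begin

lemma R_ge: "16 * 2 ^ k \<le> R k"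
proof (induction k)
  case (Suc k)
  have "(2::real) * (16 * 2 ^ k) \<le> R k * R k"
  proof (rule mult_mono[OF _ Suc])
    show "2 \<le> R k" using Suc one_le_power[of "2::real" k] by linarith
  qed (use Suc one_le_power[of "2::real" k] in linarith)+
  then show ?case by (simp add: R_Suc power2_eq_square)
qed (simp add: R0)

lemma R_ge_16: "16 \<le> R k"
  using R_ge[of k] one_le_power[of "2::real" k] by linarith

lemma R_pos: "0 < R k"
  using R_ge_16[of k] by simp

lemma R_Suc_ge: "16 * R k \<le> R (Suc k)"
  using R_ge_16[of k] mult_right_mono[of 16 "R k" "R k"] by (simp add: R_Suc power2_eq_square)

lemma R_less: "k < k' \<Longrightarrow> 16 * R k \<le> R k'"
proof (induction k')
  case (Suc k')
  then show ?case using R_Suc_ge[of k'] R_pos[of k'] by (cases "k = k'") auto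
qed simp

lemma R_mono: "k \<le> k' \<Longrightarrow> R k \<le> R k'"
  using R_less[of k k'] R_pos[of k] by (cases "k = k'") auto

lemma N_ge_2: "2 ^ k \<le> real (N k)" "16 \<le> real (N k)"
  using N_ge[of k] R_ge[of k] R_ge_16[of k] zero_less_power[of "2::real" k] by linarith+

lemma N_pos: "0 < N k"
  using N_ge_2(2)[of k] by simp

text \<open>A quarter of the side of a cell: the poles of a cell lie on the circle of radius
  \<open>sc k\<close> about its centre, and neighbouring centres are \<open>4 * sc k\<close>
  apart.\<close>

definition sc :: "nat \<Rightarrow> real" where
  "sc k = R k / (4 * real (N k))"

lemma sc_pos: "0 < sc k"
  using R_pos[of k] N_pos[of k] by (simp add: sc_def)

lemma sc_le: "sc k \<le> 1/4"
  using N_ge[of k] N_pos[of k] by (simp add: sc_def field_simps)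

lemma sc_N: "4 * sc k * real (N k) = R k"
  using N_pos[of k] by (simp add: sc_def)

definition cells :: "nat \<Rightarrow> (nat \<times> nat) set" where
  "cells k = {..<N k} \<times> {..<N k}"

definition ctr :: "nat \<Rightarrow> nat \<times> nat \<Rightarrow> complex" where
  "ctr k c = Complex (- (R k / 2) + 4 * sc k * (real (fst c) + 1/2)) (R k + 4 * sc k * (real (snd c) + 1/2))"

lemma finite_cells: "finite (cells k)"
  by (simp add: cells_def)

lemma card_cells: "card (cells k) = N k * N k"
  by (simp add: cells_def card_cartesian_product)

lemma cell_coordinate:
  assumes "i < N k"
  shows "2 * sc k \<le> 4 * sc k * (real i + 1/2)" "4 * sc k * (real i + 1/2) \<le> R k - 2 * sc k"
proof -
  show "2 * sc k \<le> 4 * sc k * (real i + 1/2)" using sc_pos[of k] by (simp add: algebra_simps)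
  have "real i + 1 \<le> real (N k)" using assms by simp
  then have "4 * sc k * (real i + 1) \<le> 4 * sc k * real (N k)" using sc_pos[of k] by (intro mult_left_mono) auto
  then show "4 * sc k * (real i + 1/2) \<le> R k - 2 * sc k" unfolding sc_N by (simp add: algebra_simps)
qed

lemma ctr_bounds:
  assumes "c \<in> cells k"
  shows "\<bar>Re (ctr k c)\<bar> \<le> R k / 2 - 2 * sc k" "R k + 2 * sc k \<le> Im (ctr k c)" "Im (ctr k c) \<le> 2 * R k - 2 * sc k"
  using cell_coordinate[of "fst c" k] cell_coordinate[of "snd c" k] assms
  by (auto simp: ctr_def cells_def abs_le_iff)

lemma norm_ctr:
  assumes "c \<in> cells k"
  shows "R k \<le> norm (ctr k c)" "norm (ctr k c) \<le> 5/2 * R k"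
proof -
  note b = ctr_bounds[OF assms]
  show "R k \<le> norm (ctr k c)" using b abs_Im_le_cmod[of "ctr k c"] sc_pos[of k] by linarith
  show "norm (ctr k c) \<le> 5/2 * R k" using b cmod_le[of "ctr k c"] sc_pos[of k] R_pos[of k] by linarith
qed

lemma dist_ctr:
  assumes "c \<noteq> c'"
  shows "4 * sc k \<le> dist (ctr k c) (ctr k c')"
proof -
  have *: "4 * sc k \<le> \<bar>4 * sc k * (real i + 1/2) - 4 * sc k * (real i' + 1/2)\<bar>" if "i \<noteq> i'" for i i' :: nat
  proof -
    have "1 \<le> \<bar>real i - real i'\<bar>" using that by linarith
    then have "4 * sc k * 1 \<le> 4 * sc k * \<bar>real i - real i'\<bar>" using sc_pos[of k] by (intro mult_left_mono) auto
    also have "\<dots> = \<bar>4 * sc k * (real i - real i')\<bar>" using sc_pos[of k] by (simp add: abs_mult)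
    finally show ?thesis by (simp add: algebra_simps)
  qed
  have "fst c \<noteq> fst c' \<or> snd c \<noteq> snd c'" using assms by (auto simp: prod_eq_iff)
  then show ?thesis
  proof
    assume "fst c \<noteq> fst c'"
    from *[OF this] show ?thesis using abs_Re_le_cmod[of "ctr k c - ctr k c'"] by (simp add: ctr_def dist_norm)
  next
    assume "snd c \<noteq> snd c'"
    from *[OF this] show ?thesis using abs_Im_le_cmod[of "ctr k c - ctr k c'"] by (simp add: ctr_def dist_norm)
  qed
qed

definition loc_coord :: "nat \<Rightarrow> nat \<times> nat \<Rightarrow> complex \<Rightarrow> complex" where
  "loc_coord k c z = (z - ctr k c) / of_real (sc k)"

lemma norm_loc_coord: "norm (loc_coord k c z) = dist z (ctr k c) / sc k"
  using sc_pos[of k] by (simp add: loc_coord_def norm_divide dist_norm)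

lemma loc_coord_far:
  assumes "norm (loc_coord k c z) < 2" "c' \<noteq> c"
  shows "2 < norm (loc_coord k c' z)"
proof -
  have "dist z (ctr k c) < 2 * sc k" using assms(1) sc_pos[of k] by (simp add: norm_loc_coord pos_divide_less_eq)
  then have "2 * sc k < dist z (ctr k c')"
    using dist_ctr[OF assms(2), of k] dist_triangle[of "ctr k c'" "ctr k c" z] by (simp add: dist_commute)
  then show ?thesis using sc_pos[of k] by (simp add: norm_loc_coord pos_less_divide_eq)
qed

text \<open>The bound does not depend on the number of cells: the majorant factors, and 1125 = 5 *
  15 * 15.\<close>

lemma kern_sum_bound:
  assumes "J \<subseteq> cells k" "\<And>c. c \<in> J \<Longrightarrow> 2 \<le> norm (loc_coord k c z)"
  shows "norm (\<Sum>c\<in>J. kern (loc_coord k c z)) \<le> 1125"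
proof -
  \<comment> \<open>The position of z in units of the grid, so that cell c is centred at
    \<open>(fst c, snd c)\<close>.\<close>
  define \<xi> \<eta> where "\<xi> = (Re z + R k / 2) / (4 * sc k) - 1/2" and "\<eta> = (Im z - R k) / (4 * sc k) - 1/2"
  have re: "Re (loc_coord k c z) = 4 * (\<xi> - real (fst c))" "Im (loc_coord k c z) = 4 * (\<eta> - real (snd c))" for c
    using sc_pos[of k] by (simp_all add: loc_coord_def ctr_def \<xi>_def \<eta>_def field_simps Re_divide_of_real Im_divide_of_real)
  have product: "(\<Sum>c\<in>cells k. 5 * (a (fst c) * b (snd c))) = 5 * ((\<Sum>i<N k. a i) * (\<Sum>j<N k. b j))"
    for a b :: "nat \<Rightarrow> real"
  proof -
    have "(\<Sum>c\<in>cells k. a (fst c) * b (snd c)) = (\<Sum>i<N k. a i) * (\<Sum>j<N k. b j)"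
      unfolding cells_def sum_product sum.cartesian_product case_prod_beta ..
    then show ?thesis by (simp only: sum_distrib_left[symmetric])
  qed
  have four: "1 / (1 + (4 * x)\<^sup>2) \<le> 1 / (1 + x\<^sup>2)" for x :: real
    by (intro divide_left_mono) (auto simp: power_mult_distrib intro!: add_pos_nonneg mult_pos_pos)
  have "norm (\<Sum>c\<in>J. kern (loc_coord k c z)) \<le> (\<Sum>c\<in>J. norm (kern (loc_coord k c z)))" by (rule norm_sum)
  also have "\<dots> \<le> (\<Sum>c\<in>J. 5 * (1 / (1 + (\<xi> - real (fst c))\<^sup>2) * (1 / (1 + (\<eta> - real (snd c))\<^sup>2))))"
  proof (rule sum_mono)
    fix c assume "c \<in> J"
    have "norm (kern (loc_coord k c z)) \<le> 5 * (1 / (1 + (4 * (\<xi> - real (fst c)))\<^sup>2) * (1 / (1 + (4 * (\<eta> - real (snd c)))\<^sup>2)))"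
      using kern_bound_product[OF assms(2)[OF \<open>c \<in> J\<close>]] unfolding re .
    also have "\<dots> \<le> 5 * (1 / (1 + (\<xi> - real (fst c))\<^sup>2) * (1 / (1 + (\<eta> - real (snd c))\<^sup>2)))"
      by (intro mult_left_mono mult_mono four) (auto intro!: add_nonneg_nonneg)
    finally show "norm (kern (loc_coord k c z)) \<le> 5 * (1 / (1 + (\<xi> - real (fst c))\<^sup>2) * (1 / (1 + (\<eta> - real (snd c))\<^sup>2)))" .
  qed
  also have "\<dots> \<le> (\<Sum>c\<in>cells k. 5 * (1 / (1 + (\<xi> - real (fst c))\<^sup>2) * (1 / (1 + (\<eta> - real (snd c))\<^sup>2))))"
    by (rule sum_mono2[OF finite_cells assms(1)]) (auto intro!: mult_nonneg_nonneg add_nonneg_nonneg)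
  also have "\<dots> = 5 * ((\<Sum>i<N k. 1 / (1 + (\<xi> - real i)\<^sup>2)) * (\<Sum>j<N k. 1 / (1 + (\<eta> - real j)\<^sup>2)))"
    by (rule product)
  also have "\<dots> \<le> 5 * (15 * 15)"
    by (intro mult_left_mono mult_mono sum_inverse_quadratic) (auto intro!: sum_nonneg)
  finally show ?thesis by simp
qed

section \<open>Levels, their decay far away, and the zones\<close>

definition lev :: "nat \<Rightarrow> complex \<Rightarrow> complex" where
  "lev k z = (\<Sum>c\<in>cells k. kern (loc_coord k c z))"

definition far :: "nat \<Rightarrow> complex set" where
  "far k = {z. norm z < R k / 2 \<or> 4 * R k < norm z}"

lemma far_loc_coord:
  assumes "z \<in> far k" "c \<in> cells k"
  shows "2 * real (N k) \<le> norm (loc_coord k c z)"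
proof -
  have "R k / 2 \<le> dist z (ctr k c)"
    using assms(1) norm_ctr[OF assms(2)] norm_triangle_ineq2[of z "ctr k c"] norm_triangle_ineq3[of z "ctr k c"]
    by (auto simp: far_def dist_norm)
  then have "2 * sc k * real (N k) \<le> dist z (ctr k c)" using sc_N[of k] by simp
  then show ?thesis using sc_pos[of k] by (simp add: norm_loc_coord pos_le_divide_eq algebra_simps)
qed

text \<open>At this distance each of the \<open>(N k)\<^sup>2\<close> terms is of order
  \<open>1 / (N k) ^ 4\<close>, so the sum is of order \<open>1 / (N k)\<^sup>2\<close>, which is
  summable over the levels.\<close>

lemma lev_far_bound:
  assumes "z \<in> far k"
  shows "norm (lev k z) \<le> (1/4) ^ k"
proof -
  have "norm (lev k z) \<le> (\<Sum>c\<in>cells k. norm (kern (loc_coord k c z)))"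
    unfolding lev_def by (rule norm_sum)
  also have "\<dots> \<le> (\<Sum>c\<in>cells k. 5 / (2 * real (N k)) ^ 4)"
  proof (rule sum_mono)
    fix c assume c: "c \<in> cells k"
    note f = far_loc_coord[OF assms c]
    then have 2: "2 \<le> norm (loc_coord k c z)" using N_ge_2(2)[of k] by linarith
    have "norm (kern (loc_coord k c z)) \<le> 5 / norm (loc_coord k c z) ^ 4" by (rule kern_bound_far[OF 2])
    also have "\<dots> \<le> 5 / (2 * real (N k)) ^ 4"
      by (intro divide_left_mono power_mono f) (use N_pos[of k] 2 in \<open>auto intro!: mult_pos_pos zero_less_power\<close>)
    finally show "norm (kern (loc_coord k c z)) \<le> 5 / (2 * real (N k)) ^ 4" .
  qed
  also have "\<dots> = 5 / 16 / (real (N k))\<^sup>2"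
    using N_pos[of k] by (simp add: card_cells power_mult_distrib field_simps power4_eq_xxxx power2_eq_square)
  also have "\<dots> \<le> 1 / (real (N k))\<^sup>2" by (intro divide_right_mono) auto
  also have "\<dots> \<le> 1 / (2 ^ k)\<^sup>2"
    using N_ge_2(1)[of k] by (intro divide_left_mono power_mono) (auto simp: N_pos)
  also have "\<dots> = (1/4) ^ k" by (simp add: power_divide power_mult[symmetric] mult.commute[of k] power_mult)
  finally show ?thesis .
qed

lemma loc_coord_holomorphic: "(\<lambda>z. loc_coord k c z) holomorphic_on S"
  unfolding loc_coord_def using sc_pos[of k] by (intro holomorphic_intros) auto

lemma norm_gt_1_not_U4: "1 < norm w \<Longrightarrow> w \<notin> U4"
  using norm_U4[of w] by auto

lemma lev_holomorphic:
  assumes "\<And>z c. z \<in> S \<Longrightarrow> c \<in> cells k \<Longrightarrow> loc_coord k c z \<notin> U4"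
  shows "lev k holomorphic_on S"
  unfolding lev_def[abs_def] by (intro holomorphic_intros kern_holomorphic loc_coord_holomorphic) (rule assms)

lemma lev_holomorphic_far: "lev k holomorphic_on far k"
proof (rule lev_holomorphic)
  fix z c assume "z \<in> far k" "c \<in> cells k"
  then show "loc_coord k c z \<notin> U4" using far_loc_coord[of z k c] N_ge_2(2)[of k] by (intro norm_gt_1_not_U4) linarith
qed

text \<open>Overlapping open annuli that cover the plane; on \<open>zone m\<close> every level other
  than m is far away. The case m = 0 is a disc, and is split off because \<open>0 - 1 = 0\<close>
  for natural numbers.\<close>

definition zone :: "nat \<Rightarrow> complex set" where
  "zone m = {z. (m = 0 \<or> 4 * R (m - 1) < norm z) \<and> norm z < R (Suc m) / 2}"

lemma open_zone: "open (zone m)"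
proof (cases "m = 0")
  case True
  then have "zone m = ball 0 (R (Suc m) / 2)" by (auto simp: zone_def)
  then show ?thesis by simp
next
  case False
  then have "zone m = ball 0 (R (Suc m) / 2) - cball 0 (4 * R (m - 1))" by (auto simp: zone_def)
  then show ?thesis by (metis open_ball closed_cball open_Diff)
qed

lemma zone_far: "z \<in> zone m \<Longrightarrow> k \<noteq> m \<Longrightarrow> z \<in> far k"
proof -
  assume z: "z \<in> zone m" "k \<noteq> m"
  show "z \<in> far k"
  proof (cases "k < m")
    case True
    then have "R k \<le> R (m - 1)" by (intro R_mono) auto
    then show ?thesis using z True by (auto simp: zone_def far_def)
  next
    case False
    then have "R (Suc m) \<le> R k" using z by (intro R_mono) auto
    then show ?thesis using z by (auto simp: zone_def far_def)
  qed
qed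

lemma R_unbounded: "\<exists>m. x < R m"
proof -
  obtain m where "x < 2 ^ m" using real_arch_pow[of 2 x] by auto
  then show ?thesis using R_ge[of m] zero_less_power[of "2::real" m] by (intro exI[of _ m]) linarith
qed

lemma zone_exists: "\<exists>m. z \<in> zone m"
proof -
  obtain m0 where "2 * norm z < R m0" using R_unbounded by blast
  then have m0: "norm z < R (Suc m0) / 2" using R_mono[of m0 "Suc m0"] by simp
  define m where "m = (LEAST m. norm z < R (Suc m) / 2)"
  have "norm z < R (Suc m) / 2" unfolding m_def using m0 by (rule LeastI)
  moreover have "m = 0 \<or> 4 * R (m - 1) < norm z"
  proof (cases m)
    case (Suc m')
    then have "\<not> norm z < R (Suc m') / 2" using not_less_Least[of m' "\<lambda>m. norm z < R (Suc m) / 2"] by (simp add: m_def)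
    then show ?thesis using Suc R_Suc_ge[of m'] R_pos[of m'] by simp
  qed simp
  ultimately show ?thesis by (auto simp: zone_def)
qed

definition tail :: "nat \<Rightarrow> complex \<Rightarrow> complex" where
  "tail m z = (\<Sum>k. if k = m then 0 else lev k z)"

lemma tail_term_bound: "z \<in> zone m \<Longrightarrow> norm (if k = m then 0 else lev k z) \<le> (1/4) ^ k"
  using lev_far_bound[OF zone_far] by simp

lemma tail_summable: "z \<in> zone m \<Longrightarrow> summable (\<lambda>k. if k = m then 0 else lev k z)"
  by (rule summable_comparison_test'[of "\<lambda>k. (1/4) ^ k"]) (use tail_term_bound in auto)

lemma tail_bound: "z \<in> zone m \<Longrightarrow> norm (tail m z) \<le> 2"
proof -
  assume z: "z \<in> zone m"
  have "norm (tail m z) \<le> (\<Sum>k. (1/4::real) ^ k)"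
    unfolding tail_def by (rule norm_suminf_le[OF tail_term_bound[OF z]]) (simp add: summable_geometric)
  also have "\<dots> = 4/3" by (subst suminf_geometric) auto
  finally show ?thesis by simp
qed

lemma tail_holomorphic: "tail m holomorphic_on zone m"
proof (rule holomorphic_uniform_sequence[OF open_zone])
  show "(\<lambda>z. \<Sum>k<n. if k = m then 0 else lev k z) holomorphic_on zone m" for n
  proof (rule holomorphic_on_sum)
    fix k
    show "(\<lambda>z. if k = m then 0 else lev k z) holomorphic_on zone m"
      using holomorphic_on_subset[OF lev_holomorphic_far, of "zone m" k] zone_far[of _ m k]
      by (cases "k = m") auto
  qed
  fix x assume "x \<in> zone m"
  then obtain d where d: "0 < d" "cball x d \<subseteq> zone m" using open_zone open_contains_cball by blast
  have "uniform_limit (cball x d) (\<lambda>n z. \<Sum>k<n. if k = m then 0 else lev k z) (\<lambda>z. \<Sum>k. if k = m then 0 else lev k z) sequentially"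
    by (rule Weierstrass_m_test[where M = "\<lambda>k. (1/4) ^ k"], rule tail_term_bound) (use d in auto)
  then show "\<exists>d. 0 < d \<and> cball x d \<subseteq> zone m \<and> uniform_limit (cball x d) (\<lambda>n z. \<Sum>k<n. if k = m then 0 else lev k z) (tail m) sequentially"
    using d by (intro exI[of _ d]) (auto simp: tail_def[abs_def])
qed

section \<open>The set of poles and the function g\<close>

definition Ix :: "(nat \<times> (nat \<times> nat) \<times> complex) set" where
  "Ix = {(k, c, \<omega>). c \<in> cells k \<and> \<omega> \<in> U4}"

definition pt :: "nat \<times> (nat \<times> nat) \<times> complex \<Rightarrow> complex" where
  "pt = (\<lambda>(k, c, \<omega>). ctr k c + of_real (sc k) * \<omega>)"

definition P :: "complex set" where
  "P = pt ` Ix"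

lemma P_cases:
  assumes "p \<in> P"
  obtains k c \<omega> where "c \<in> cells k" "\<omega> \<in> U4" "p = pt (k, c, \<omega>)"
  using assms by (auto simp: P_def Ix_def)

lemma pt_in_P: "c \<in> cells k \<Longrightarrow> \<omega> \<in> U4 \<Longrightarrow> pt (k, c, \<omega>) \<in> P"
  by (auto simp: P_def Ix_def)

lemma dist_pt_ctr: "\<omega> \<in> U4 \<Longrightarrow> dist (pt (k, c, \<omega>)) (ctr k c) = sc k"
  using sc_pos[of k] norm_U4[of \<omega>] by (simp add: pt_def dist_norm norm_mult)

lemma norm_pt:
  assumes "c \<in> cells k" "\<omega> \<in> U4"
  shows "R k - 1 \<le> norm (pt (k, c, \<omega>))" "norm (pt (k, c, \<omega>)) \<le> 3 * R k"
  using norm_ctr[OF assms(1)] dist_pt_ctr[OF assms(2), of k c] sc_le[of k] R_ge_16[of k]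
    norm_triangle_ineq3[of "pt (k, c, \<omega>)" "ctr k c"] unfolding dist_norm by linarith+

text \<open>Three scales: poles of different levels are at distance at least 1, which suffices since
  \<open>sc\<close> is at most 1/4; different cells of a level have centres \<open>4 * sc k\<close>
  apart; within a cell distinct roots of unity are at least 7/5 apart before rescaling.\<close>

lemma dist_pt:
  assumes "c \<in> cells k" "\<omega> \<in> U4" "c' \<in> cells k'" "\<omega>' \<in> U4" "(k, c, \<omega>) \<noteq> (k', c', \<omega>')"
  shows "sc k / 2 + sc k' / 2 \<le> dist (pt (k, c, \<omega>)) (pt (k', c', \<omega>'))"
proof -
  have lt: "1 \<le> dist (pt (k, c, \<omega>)) (pt (k', c', \<omega>'))"
    if "c \<in> cells k" "\<omega> \<in> U4" "c' \<in> cells k'" "\<omega>' \<in> U4" "k < k'" for k c \<omega> k' c' \<omega>'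
    using norm_pt(2)[OF that(1,2)] norm_pt(1)[OF that(3,4)] R_less[OF that(5)] R_ge_16[of k]
      norm_triangle_ineq3[of "pt (k, c, \<omega>)" "pt (k', c', \<omega>')"] unfolding dist_norm by linarith
  consider "k < k'" | "k' < k" | "k = k'" "c \<noteq> c'" | "k = k'" "c = c'" "\<omega> \<noteq> \<omega>'" using assms(5) by fastforce
  then show ?thesis
  proof cases
    case 1
    then show ?thesis using lt[OF assms(1-4)] sc_le[of k] sc_le[of k'] by linarith
  next
    case 2
    then show ?thesis using lt[OF assms(3,4,1,2)] sc_le[of k] sc_le[of k'] by (simp add: dist_commute)
  next
    case 3
    have "dist (ctr k c) (ctr k c') \<le> dist (ctr k c) (pt (k, c, \<omega>)) + dist (pt (k, c, \<omega>)) (pt (k, c', \<omega>')) + dist (pt (k, c', \<omega>')) (ctr k c')"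
      using dist_triangle[of "ctr k c" "ctr k c'" "pt (k, c, \<omega>)"] dist_triangle[of "pt (k, c, \<omega>)" "ctr k c'" "pt (k, c', \<omega>')"]
      by linarith
    then show ?thesis using 3 dist_ctr[OF 3(2), of k] dist_pt_ctr[OF assms(2), of k c] dist_pt_ctr[OF assms(4), of k c'] sc_pos[of k]
      by (simp add: dist_commute)
  next
    case 4
    have "pt (k, c, \<omega>) - pt (k, c, \<omega>') = of_real (sc k) * (\<omega> - \<omega>')" by (simp add: pt_def algebra_simps)
    then have "dist (pt (k, c, \<omega>)) (pt (k, c, \<omega>')) = sc k * norm (\<omega> - \<omega>')"
      using sc_pos[of k] by (simp add: dist_norm norm_mult)
    moreover have "sc k * 1 \<le> sc k * norm (\<omega> - \<omega>')"
      using dist_U4[OF assms(2,4) 4(3)] sc_pos[of k] by (intro mult_left_mono) auto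
    ultimately show ?thesis using 4 by simp
  qed
qed

lemma inj_pt: "inj_on pt Ix"
proof (rule inj_onI, rule ccontr)
  fix x y assume xy: "x \<in> Ix" "y \<in> Ix" "pt x = pt y" "x \<noteq> y"
  obtain k c \<omega> k' c' \<omega>' where "x = (k, c, \<omega>)" "y = (k', c', \<omega>')" by (metis prod_cases3)
  then have "sc k / 2 + sc k' / 2 \<le> dist (pt x) (pt y)" using xy dist_pt[of c k \<omega> c' k' \<omega>'] by (auto simp: Ix_def)
  then show False using xy sc_pos[of k] sc_pos[of k'] by simp
qed

text \<open>The scale, and next the residue, as functions of the pole itself, the form in which
  \<open>pole_field\<close> expects them; \<open>pt\<close> is injective on its index set.\<close>

definition psc :: "complex \<Rightarrow> real" where
  "psc p = sc (fst (inv_into Ix pt p))"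

definition pres :: "complex \<Rightarrow> complex" where
  "pres p = (let (k, c, \<omega>) = inv_into Ix pt p in of_real (sc k) * \<omega>)"

lemma inv_pt: "c \<in> cells k \<Longrightarrow> \<omega> \<in> U4 \<Longrightarrow> inv_into Ix pt (pt (k, c, \<omega>)) = (k, c, \<omega>)"
  by (rule inv_into_f_f[OF inj_pt]) (simp add: Ix_def)

lemma psc_pt: "c \<in> cells k \<Longrightarrow> \<omega> \<in> U4 \<Longrightarrow> psc (pt (k, c, \<omega>)) = sc k"
  unfolding psc_def by (subst inv_pt) auto

lemma pres_pt: "c \<in> cells k \<Longrightarrow> \<omega> \<in> U4 \<Longrightarrow> pres (pt (k, c, \<omega>)) = of_real (sc k) * \<omega>"
  unfolding pres_def by (subst inv_pt) auto

text \<open>The value 0 at poles is set explicitly: there division by zero annihilates only the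
  singular term of the series.\<close>

definition g :: "complex \<Rightarrow> complex" where
  "g z = (if z \<in> P then 0 else (\<Sum>k. lev k z))"

lemma suminf_lev:
  assumes "z \<in> zone m"
  shows "(\<Sum>k. lev k z) = lev m z + tail m z"
proof -
  have "(\<lambda>k. if k = m then lev k z else 0) sums lev m z" by (rule sums_single)
  then have "(\<lambda>k. (if k = m then lev k z else 0) + (if k = m then 0 else lev k z)) sums (lev m z + tail m z)"
    unfolding tail_def by (intro sums_add summable_sums tail_summable[OF assms])
  moreover have "(\<lambda>k. (if k = m then lev k z else 0) + (if k = m then 0 else lev k z)) = (\<lambda>k. lev k z)" by auto
  ultimately show ?thesis by (simp add: sums_iff)
qed

lemma g_zone: "z \<in> zone m \<Longrightarrow> z \<notin> P \<Longrightarrow> g z = lev m z + tail m z"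
  by (simp add: g_def suminf_lev)

lemma loc_coord_U4_iff: "c \<in> cells k \<Longrightarrow> loc_coord k c z \<in> U4 \<longleftrightarrow> (\<exists>\<omega>\<in>U4. z = pt (k, c, \<omega>))"
proof -
  have "loc_coord k c z = \<omega> \<longleftrightarrow> z = pt (k, c, \<omega>)" for \<omega>
    using sc_pos[of k] by (auto simp: loc_coord_def pt_def field_simps)
  then show ?thesis by blast
qed

definition Plev :: "nat \<Rightarrow> complex set" where
  "Plev k = (\<lambda>(c, \<omega>). pt (k, c, \<omega>)) ` (cells k \<times> U4)"

lemma finite_Plev: "finite (Plev k)"
  unfolding Plev_def by (intro finite_imageI finite_cartesian_product finite_cells) auto

lemma P_eq: "P = (\<Union>k. Plev k)"
  by (auto simp: P_def Ix_def Plev_def image_iff)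

lemma norm_Plev: "p \<in> Plev k \<Longrightarrow> R k - 1 \<le> norm p" "p \<in> Plev k \<Longrightarrow> norm p \<le> 3 * R k"
  using norm_pt by (force simp: Plev_def)+

lemma Plev_zone: "p \<in> Plev k \<Longrightarrow> p \<in> zone m \<Longrightarrow> k = m"
proof (rule ccontr)
  assume p: "p \<in> Plev k" "p \<in> zone m" "k \<noteq> m"
  then have "p \<in> far k" using zone_far by blast
  then show False using norm_Plev[OF p(1)] R_ge_16[of k] by (auto simp: far_def)
qed

lemma zone_minus_P: "zone m - P = zone m - Plev m"
  using Plev_zone by (auto simp: P_eq)

lemma g_holomorphic: "g holomorphic_on - P"
proof -
  have "g holomorphic_on zone m - P" for m
  proof (rule holomorphic_transform)
    have "lev m holomorphic_on zone m - P"
      by (rule lev_holomorphic) (auto simp del: insert_iff simp: loc_coord_U4_iff dest: pt_in_P)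
    then show "(\<lambda>z. lev m z + tail m z) holomorphic_on zone m - P"
      by (intro holomorphic_intros holomorphic_on_subset[OF tail_holomorphic]) auto
    fix x assume "x \<in> zone m - P"
    then show "lev m x + tail m x = g x" using g_zone[of x m] by simp
  qed
  moreover have "open (zone m - P)" for m
    unfolding zone_minus_P using finite_Plev by (intro open_Diff open_zone finite_imp_closed)
  ultimately have "g holomorphic_on (\<Union>m. zone m - P)" by (intro holomorphic_on_UN_open) auto
  moreover have "(\<Union>m. zone m - P) = - P" using zone_exists by blast
  ultimately show ?thesis by simp
qed

lemma finite_P_cball: "finite (P \<inter> cball 0 r)"
proof -
  obtain K where K: "r + 1 < R K" using R_unbounded by blast
  have "P \<inter> cball 0 r \<subseteq> (\<Union>k<K. Plev k)"
  proof
    fix p assume p: "p \<in> P \<inter> cball 0 r"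
    then obtain k where k: "p \<in> Plev k" by (auto simp: P_eq)
    have "k < K"
    proof (rule ccontr)
      assume "\<not> k < K"
      then have "R K \<le> R k" by (intro R_mono) auto
      then show False using norm_Plev(1)[OF k] p K by simp
    qed
    then show "p \<in> (\<Union>k<K. Plev k)" using k by blast
  qed
  moreover have "finite (\<Union>k<K. Plev k)" using finite_Plev by blast
  ultimately show ?thesis by (rule finite_subset)
qed

text \<open>At most one cell has its centre within \<open>2 * sc k\<close> of z. It contributes at
  most 64, all others together at most 1125.\<close>

lemma lev_bound:
  assumes "\<And>c. c \<in> cells k \<Longrightarrow> norm (loc_coord k c z) < 2 \<Longrightarrow> norm (kern (loc_coord k c z)) \<le> 64"
  shows "norm (lev k z) \<le> 1189"
proof (cases "\<exists>c\<in>cells k. norm (loc_coord k c z) < 2")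
  case True
  then obtain c where c: "c \<in> cells k" "norm (loc_coord k c z) < 2" by blast
  have "lev k z = kern (loc_coord k c z) + (\<Sum>c\<in>cells k - {c}. kern (loc_coord k c z))"
    unfolding lev_def by (rule sum.remove[OF finite_cells c(1)])
  moreover have "norm (\<Sum>c\<in>cells k - {c}. kern (loc_coord k c z)) \<le> 1125"
    by (rule kern_sum_bound) (use loc_coord_far[OF c(2)] in \<open>auto simp: less_imp_le\<close>)
  ultimately show ?thesis using assms[OF c] norm_triangle_ineq[of "kern (loc_coord k c z)" "\<Sum>c\<in>cells k - {c}. kern (loc_coord k c z)"] by simp
next
  case False
  then have "norm (lev k z) \<le> 1125" unfolding lev_def by (intro kern_sum_bound) auto
  then show ?thesis by simp
qed

lemma dist_pt_loc: "dist z (pt (k, c, \<omega>)) = sc k * norm (loc_coord k c z - \<omega>)"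
proof -
  have "z - pt (k, c, \<omega>) = of_real (sc k) * (loc_coord k c z - \<omega>)"
    using sc_pos[of k] by (simp add: loc_coord_def pt_def field_simps)
  then show ?thesis using sc_pos[of k] by (simp add: dist_norm norm_mult)
qed

lemma g_bounded_off:
  assumes "z \<notin> (\<Union>p\<in>P. ball p (psc p / 2))"
  shows "norm (g z) \<le> 1200"
proof -
  obtain m where m: "z \<in> zone m" using zone_exists by blast
  have off: "1/2 \<le> norm (loc_coord k c z - \<omega>)" if "c \<in> cells k" "\<omega> \<in> U4" for k c \<omega>
  proof -
    have "z \<notin> ball (pt (k, c, \<omega>)) (psc (pt (k, c, \<omega>)) / 2)" using assms pt_in_P[OF that] by blast
    then have "sc k / 2 \<le> dist z (pt (k, c, \<omega>))" unfolding psc_pt[OF that] by (simp add: dist_commute)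
    then show ?thesis using sc_pos[of k] by (simp add: dist_pt_loc)
  qed
  have "z \<notin> P"
  proof
    assume "z \<in> P"
    then obtain k c \<omega> where "c \<in> cells k" "\<omega> \<in> U4" "z = pt (k, c, \<omega>)" by (rule P_cases)
    then show False using off[of c k \<omega>] dist_pt_loc[of z k c \<omega>] sc_pos[of k] by simp
  qed
  have "norm (lev m z) \<le> 1189" by (rule lev_bound, rule kern_bound_near) (rule off)
  then show ?thesis using g_zone[OF m \<open>z \<notin> P\<close>] tail_bound[OF m] norm_triangle_ineq[of "lev m z" "tail m z"] by simp
qed

lemma ball_pt_zone:
  assumes "c \<in> cells k" "\<omega> \<in> U4"
  shows "ball (pt (k, c, \<omega>)) (sc k / 2) \<subseteq> zone k"
proof
  fix z assume "z \<in> ball (pt (k, c, \<omega>)) (sc k / 2)"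
  then have "norm (pt (k, c, \<omega>) - z) < 1" using sc_le[of k] by (simp add: dist_norm)
  then have "R k - 2 \<le> norm z" "norm z \<le> 3 * R k + 1"
    using norm_pt[OF assms] norm_triangle_ineq3[of "pt (k, c, \<omega>)" z] by linarith+
  moreover have "k = 0 \<or> 16 * R (k - 1) \<le> R k" using R_Suc_ge[of "k - 1"] by (cases k) auto
  moreover have "16 \<le> R (k - 1)" by (rule R_ge_16)
  ultimately show "z \<in> zone k" using R_Suc_ge[of k] R_ge_16[of k] by (auto simp: zone_def)
qed

text \<open>Near a pole g splits into the expansion of the kernel of its own cell, the other cells
  of the level, and the other levels. The regular parts are bounded by 8, 1125 and 2.\<close>

lemma g_local:
  assumes c: "c \<in> cells k" and \<omega>: "\<omega> \<in> U4"
  defines "p \<equiv> pt (k, c, \<omega>)"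
  defines "e \<equiv> (\<lambda>z. kern_reg (loc_coord k c z / \<omega>) + (\<Sum>c\<in>cells k - {c}. kern (loc_coord k c z)) + tail k z)"
  shows "e holomorphic_on ball p (sc k / 2)"
    and "z \<in> ball p (sc k / 2) \<Longrightarrow> norm (e z) \<le> 1200"
    and "z \<in> ball p (sc k / 2) \<Longrightarrow> z \<noteq> p \<Longrightarrow> g z = of_real (sc k) * \<omega> / (z - p) + e z"
proof -
  have near: "norm (loc_coord k c z - \<omega>) < 1/2" if "z \<in> ball p (sc k / 2)" for z
    using that sc_pos[of k] dist_pt_loc[of z k c \<omega>] by (simp add: p_def dist_commute)
  have near1: "norm (loc_coord k c z / \<omega> - 1) < 1/2" if "z \<in> ball p (sc k / 2)" for z
  proof -
    have "loc_coord k c z / \<omega> - 1 = (loc_coord k c z - \<omega>) / \<omega>" using U4_nz[OF \<omega>] by (simp add: diff_divide_distrib)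
    then show ?thesis using near[OF that] norm_U4[OF \<omega>] by (simp add: norm_divide)
  qed
  have lt2: "norm (loc_coord k c z) < 2" if "z \<in> ball p (sc k / 2)" for z
    using near[OF that] norm_triangle_ineq2[of "loc_coord k c z" \<omega>] norm_U4[OF \<omega>] by linarith
  have others: "2 < norm (loc_coord k c' z)" if "z \<in> ball p (sc k / 2)" "c' \<noteq> c" for z c'
    by (rule loc_coord_far[OF lt2[OF that(1)] that(2)])
  have zn: "ball p (sc k / 2) \<subseteq> zone k" unfolding p_def by (rule ball_pt_zone[OF c \<omega>])
  have "(\<lambda>z. kern_reg (loc_coord k c z / \<omega>)) holomorphic_on ball p (sc k / 2)"
    unfolding kern_reg_def using kern_reg_bound(2,3)[OF near1] U4_nz[OF \<omega>]
    by (intro holomorphic_intros loc_coord_holomorphic) auto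
  moreover have "(\<lambda>z. \<Sum>c\<in>cells k - {c}. kern (loc_coord k c z)) holomorphic_on ball p (sc k / 2)"
    using others by (intro holomorphic_intros kern_holomorphic loc_coord_holomorphic norm_gt_1_not_U4) force
  ultimately show "e holomorphic_on ball p (sc k / 2)"
    unfolding e_def by (intro holomorphic_on_add holomorphic_on_subset[OF tail_holomorphic zn])
  {
    assume z: "z \<in> ball p (sc k / 2)"
    have "norm (\<Sum>c\<in>cells k - {c}. kern (loc_coord k c z)) \<le> 1125"
      by (rule kern_sum_bound) (use others[OF z] in \<open>auto simp: less_imp_le\<close>)
    moreover have "norm (tail k z) \<le> 2" using z zn by (intro tail_bound) auto
    ultimately have "norm (kern_reg (loc_coord k c z / \<omega>)) + norm (\<Sum>c\<in>cells k - {c}. kern (loc_coord k c z)) + norm (tail k z) \<le> 1200"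
      using kern_reg_bound(1)[OF near1[OF z]] by simp
    then show "norm (e z) \<le> 1200" unfolding e_def by (intro norm_triangle_le order_trans[OF add_right_mono[OF norm_triangle_ineq]])
  }
  {
    assume z: "z \<in> ball p (sc k / 2)" "z \<noteq> p"
    have zk: "z \<in> zone k" using z zn by blast
    have notU4: "loc_coord k c' z \<notin> U4" if "c' \<in> cells k" for c'
    proof (cases "c' = c")
      case True
      show ?thesis
      proof
        assume "loc_coord k c' z \<in> U4"
        then have "loc_coord k c z = \<omega>" using dist_U4[OF _ \<omega>, of "loc_coord k c z"] near[OF z(1)] True by fastforce
        then show False using z(2) dist_pt_loc[of z k c \<omega>] by (simp add: p_def)
      qed
    next
      case False
      show ?thesis by (rule norm_gt_1_not_U4) (use others[OF z(1) False] in simp)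
    qed
    have "z \<notin> P"
    proof
      assume "z \<in> P"
      then have "z \<in> Plev k" using zk zone_minus_P by blast
      then obtain c' \<omega>' where "c' \<in> cells k" "\<omega>' \<in> U4" "z = pt (k, c', \<omega>')" by (auto simp: Plev_def)
      then show False using notU4[of c'] loc_coord_U4_iff[of c' k z] by blast
    qed
    have "lev k z = kern (loc_coord k c z) + (\<Sum>c\<in>cells k - {c}. kern (loc_coord k c z))"
      unfolding lev_def by (rule sum.remove[OF finite_cells c])
    moreover have "kern (loc_coord k c z) = \<omega> / (loc_coord k c z - \<omega>) + kern_reg (loc_coord k c z / \<omega>)"
      by (rule kern_eq[OF \<omega> notU4[OF c]])
    moreover have "\<omega> / (loc_coord k c z - \<omega>) = of_real (sc k) * \<omega> / (z - p)"
    proof -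
      have "z - p = of_real (sc k) * (loc_coord k c z - \<omega>)"
        using sc_pos[of k] by (simp add: loc_coord_def p_def pt_def field_simps)
      then show ?thesis using sc_pos[of k] by simp
    qed
    ultimately show "g z = of_real (sc k) * \<omega> / (z - p) + e z"
      using g_zone[OF zk \<open>z \<notin> P\<close>] by (simp add: e_def)
  }
qed

sublocale pole_field g P psc pres 1200
proof
  fix p assume "p \<in> P"
  then obtain k c \<omega> where p: "c \<in> cells k" "\<omega> \<in> U4" "p = pt (k, c, \<omega>)" by (rule P_cases)
  note s = psc_pt[OF p(1,2)] and r = pres_pt[OF p(1,2)]
  show "0 < psc p" unfolding p(3) s by (rule sc_pos)
  show "norm (pres p) = psc p" unfolding p(3) s r using norm_U4[OF p(2)] sc_pos[of k] by (simp add: norm_mult)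
  show "\<exists>e. e holomorphic_on ball p (psc p / 2) \<and> (\<forall>z\<in>ball p (psc p / 2). norm (e z) \<le> 1200) \<and>
            (\<forall>z\<in>ball p (psc p / 2) - {p}. g z = pres p / (z - p) + e z)"
    unfolding p(3) s r using g_local[OF p(1,2)] by blast
  show "g p = 0" using \<open>p \<in> P\<close> by (simp add: g_def)
  fix q assume "q \<in> P" "p \<noteq> q"
  then obtain k' c' \<omega>' where q: "c' \<in> cells k'" "\<omega>' \<in> U4" "q = pt (k', c', \<omega>')" by (metis P_cases)
  show "psc p / 2 + psc q / 2 \<le> dist p q"
    unfolding p(3) q(3) s psc_pt[OF q(1,2)] using \<open>p \<noteq> q\<close> p q by (intro dist_pt) auto
qed (use finite_P_cball g_holomorphic g_bounded_off in auto)

end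

section \<open>Iterated exponentials and logarithms\<close>

lemma iter_exp_mono: "x \<le> y \<Longrightarrow> (exp ^^ n) x \<le> (exp ^^ n) (y :: real)"
  by (induction n) auto

lemma iter_exp_ge: "x \<le> (exp ^^ n) (x :: real)"
proof (induction n)
  case (Suc n)
  have "(exp ^^ n) x + 1 \<le> (exp ^^ Suc n) x" using exp_ge_add_one_self[of "(exp ^^ n) x"] by (simp add: add.commute)
  then show ?case using Suc by linarith
qed simp

lemma iter_Suc: "(f ^^ Suc n) x = (f ^^ n) (f x)"
  by (simp only: funpow_Suc_right o_apply)

lemma iter_ln_ge: "(exp ^^ n) x \<le> y \<Longrightarrow> x \<le> (ln ^^ n) (y :: real)"
proof (induction n arbitrary: y)
  case (Suc n)
  then have "exp ((exp ^^ n) x) \<le> y" by simp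
  then have "(exp ^^ n) x \<le> ln y" by (metis exp_gt_zero less_le_trans ln_ge_iff)
  then show ?case unfolding iter_Suc using Suc.IH by blast
qed simp

lemma iter_ln_mono: "(exp ^^ n) x \<le> y \<Longrightarrow> y \<le> y' \<Longrightarrow> (ln ^^ n) y \<le> (ln ^^ n) (y' :: real)"
proof (induction n arbitrary: y y')
  case (Suc n)
  then have *: "exp ((exp ^^ n) x) \<le> y" by simp
  then have "0 < y" by (meson exp_gt_zero less_le_trans)
  then have "(exp ^^ n) x \<le> ln y" "ln y \<le> ln y'" using * Suc.prems by (auto simp: ln_ge_iff)
  then show ?case unfolding iter_Suc using Suc.IH by blast
qed simp

lemma log_plus_mono: "x \<le> y \<Longrightarrow> log_plus x \<le> log_plus y"
  by (auto simp: log_plus_def max_def)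

lemma log_plus_nonneg: "0 \<le> log_plus x"
  by (auto simp: log_plus_def)

lemma log_plus_ge_1: "1 \<le> x \<Longrightarrow> log_plus x = ln x"
  by (auto simp: log_plus_def)

lemma iter_log_plus_mono: "x \<le> y \<Longrightarrow> (log_plus ^^ n) x \<le> (log_plus ^^ n) y"
  by (induction n) (auto intro: log_plus_mono)

lemma iter_log_plus_iter_exp: "0 \<le> x \<Longrightarrow> (log_plus ^^ n) ((exp ^^ n) x) = x"
proof (induction n)
  case (Suc n)
  have "0 \<le> (exp ^^ n) x" using iter_exp_ge[of x n] Suc.prems by linarith
  then have "log_plus ((exp ^^ Suc n) x) = (exp ^^ n) x" by (simp add: log_plus_def)
  then show ?case using Suc by (simp only: iter_Suc[where f = log_plus])
qed simp

text \<open>Doubling the value of an iterated exponential is paid for by doubling its innermost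
  argument, and an added constant passes inside likewise.\<close>

lemma iter_exp_double:
  fixes x b :: real
  assumes "1 \<le> x" "0 \<le> b"
  shows "2 * (exp ^^ n) x + b \<le> (exp ^^ n) (2 * x + b)"
proof (induction n)
  case (Suc n)
  define y where "y = (exp ^^ n) x"
  have y: "1 \<le> y" using iter_exp_ge[of x n] assms(1) by (simp add: y_def)
  have e2: "2 \<le> exp y" using exp_ge_add_one_self[of y] y by linarith
  have "2 * exp y + b \<le> exp y * exp y + b" using e2 by (simp add: mult_right_mono)
  also have "\<dots> \<le> exp y * exp y * (1 + b)"
  proof -
    have "1 * b \<le> (exp y * exp y) * b" using e2 y mult_mono[of 1 "exp y" 1 "exp y"] assms(2) by (intro mult_right_mono) auto
    then show ?thesis by (simp add: algebra_simps)
  qed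
  also have "\<dots> \<le> exp y * exp y * exp b" using exp_ge_add_one_self[of b] by (intro mult_left_mono) auto
  also have "\<dots> = exp (2 * y + b)" by (simp add: exp_add[symmetric])
  also have "\<dots> \<le> exp ((exp ^^ n) (2 * x + b))" using Suc by (simp add: y_def)
  finally show ?case by (simp add: y_def)
qed simp

text \<open>With at least one exponential, squaring and a factor A cost only
  \<open>2 * x + ln A\<close> in the argument. Hence the number of poles may be squared and
  multiplied by powers of r without a change of the n-th order.\<close>

lemma iter_exp_square:
  fixes x A :: real
  assumes "1 \<le> x" "1 \<le> A" "1 \<le> n"
  shows "A * ((exp ^^ n) x)\<^sup>2 \<le> (exp ^^ n) (2 * x + ln A)"
proof -
  obtain m where n: "n = Suc m" using assms(3) by (cases n) auto
  have "A * ((exp ^^ n) x)\<^sup>2 = exp (2 * (exp ^^ m) x + ln A)"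
    using assms(2) by (simp add: n exp_add exp_double)
  also have "\<dots> \<le> exp ((exp ^^ m) (2 * x + ln A))" using iter_exp_double[of x "ln A" m] assms by simp
  finally show ?thesis by (simp add: n)
qed

section \<open>Logarithmic singularities on a circle\<close>

lemma sin_half_le: "0 \<le> x \<Longrightarrow> x \<le> pi / 2 \<Longrightarrow> x / 2 \<le> sin x"
proof -
  assume x: "0 \<le> x" "x \<le> pi / 2"
  show "x / 2 \<le> sin x"
  \<comment> \<open>Up to pi/3 the derivative of sin is at least 1/2; beyond it sin is at least
    \<open>sqrt 3 / 2\<close>, which exceeds pi/4.\<close>
  proof (cases "x \<le> pi / 3")
    case True
    have "(\<lambda>x. sin x - x / 2) 0 \<le> (\<lambda>x. sin x - x / 2) x"
    proof (rule DERIV_nonneg_imp_nondecreasing[OF x(1)])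
      fix y assume y: "0 \<le> y" "y \<le> x"
      have "cos (pi / 3) \<le> cos y" by (rule cos_monotone_0_pi_le) (use y True in auto)
      then have "0 \<le> cos y - 1 / 2" by (simp add: cos_60)
      moreover have "((\<lambda>x. sin x - x / 2) has_real_derivative cos y - 1 / 2) (at y)"
        by (auto intro!: derivative_eq_intros)
      ultimately show "\<exists>d. ((\<lambda>x. sin x - x / 2) has_real_derivative d) (at y) \<and> 0 \<le> d" by blast
    qed
    then show ?thesis by simp
  next
    case False
    have "sin (pi / 3) \<le> sin x" by (rule sin_monotone_2pi_le) (use False x in auto)
    moreover have "17/10 \<le> sqrt (3::real)" by (rule real_le_rsqrt) (simp add: power2_eq_square)
    ultimately have "17/20 \<le> sin x" by (simp add: sin_60)
    moreover have "x \<le> 16/10" using x pi_less_4 pi_approx by simp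
    ultimately show ?thesis by simp
  qed
qed

text \<open>A chord has length twice the sine of half the angle. Restricting both angles to a
  half-circle keeps that half angle below pi/2.\<close>

lemma dist_cis_ge:
  assumes "\<theta> \<in> {0..pi}" "\<phi> \<in> {0..pi}"
  shows "\<bar>\<theta> - \<phi>\<bar> / 2 \<le> norm (cis \<theta> - cis \<phi>)"
proof -
  define x where "x = \<bar>\<theta> - \<phi>\<bar> / 2"
  have x: "0 \<le> x" "x \<le> pi / 2" using assms by (auto simp: x_def)
  have "(norm (cis \<theta> - cis \<phi>))\<^sup>2 = (cos \<theta> - cos \<phi>)\<^sup>2 + (sin \<theta> - sin \<phi>)\<^sup>2" by (simp add: cmod_power2)
  also have "\<dots> = 2 - 2 * cos (\<theta> - \<phi>)"
    using sin_cos_squared_add[of \<theta>] sin_cos_squared_add[of \<phi>] unfolding cos_diff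
    by (simp add: power2_eq_square algebra_simps)
  also have "cos (\<theta> - \<phi>) = cos (2 * x)" by (simp add: x_def abs_if cos_diff)
  also have "2 - 2 * cos (2 * x) = (2 * sin x)\<^sup>2" by (simp add: cos_double_sin power_mult_distrib)
  finally have "(norm (cis \<theta> - cis \<phi>))\<^sup>2 = (2 * sin x)\<^sup>2" .
  moreover have "0 \<le> 2 * sin x" using sin_half_le[OF x] x(1) by linarith
  ultimately have "norm (cis \<theta> - cis \<phi>) = 2 * sin x" by (rule power2_eq_imp_eq[OF _ norm_ge_zero])
  then show ?thesis using sin_half_le[OF x] x_def by simp
qed

text \<open>An antiderivative of \<open>ln (2 * pi / \<bar>\<theta> - \<phi>\<bar>)\<close> in
  \<theta>. It is continuous at \<phi>, because y ln |y| tends to 0 with y.\<close>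

definition log_antideriv :: "real \<Rightarrow> real \<Rightarrow> real" where
  "log_antideriv \<phi> \<theta> = (\<theta> - \<phi>) * (ln (2 * pi) + 1) - (\<theta> - \<phi>) * ln \<bar>\<theta> - \<phi>\<bar>"

text \<open>The singularity caused by a pole near the circle is integrable, with a bound that does
  not depend on the angle of the pole.\<close>

lemma log_majorant_integral:
  assumes "0 < \<phi>" "\<phi> < 2 * pi"
  shows "((\<lambda>\<theta>. ln (2 * pi / \<bar>\<theta> - \<phi>\<bar>)) has_integral (log_antideriv \<phi> (2 * pi) - log_antideriv \<phi> 0)) {0..2 * pi}"
    and "log_antideriv \<phi> (2 * pi) - log_antideriv \<phi> 0 \<le> 4 * pi"
proof -
  show "((\<lambda>\<theta>. ln (2 * pi / \<bar>\<theta> - \<phi>\<bar>)) has_integral (log_antideriv \<phi> (2 * pi) - log_antideriv \<phi> 0)) {0..2 * pi}"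
  proof (rule fundamental_theorem_of_calculus_interior_strong[of "{\<phi>}"])
    fix x assume x: "x \<in> {0<..<2 * pi} - {\<phi>}"
    have "(log_antideriv \<phi> has_real_derivative ln (2 * pi / \<bar>x - \<phi>\<bar>)) (at x)"
    proof (cases "x < \<phi>")
      case True
      have "((\<lambda>\<theta>. (\<theta> - \<phi>) * (ln (2 * pi) + 1) - (\<theta> - \<phi>) * ln (\<phi> - \<theta>)) has_real_derivative ln (2 * pi / (\<phi> - x))) (at x)"
      proof -
        have "((\<lambda>\<theta>. (\<theta> - \<phi>) * (ln (2 * pi) + 1) - (\<theta> - \<phi>) * ln (\<phi> - \<theta>)) has_real_derivative
            (ln (2 * pi) + 1) - (ln (\<phi> - x) + (x - \<phi>) * (- 1 / (\<phi> - x)))) (at x)"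
          using True by (auto intro!: derivative_eq_intros)
        moreover have "(x - \<phi>) * (- 1 / (\<phi> - x)) = 1" using True by (simp add: field_simps)
        ultimately show ?thesis using True by (simp add: ln_div)
      qed
      moreover have "eventually (\<lambda>\<theta>. log_antideriv \<phi> \<theta> = (\<theta> - \<phi>) * (ln (2 * pi) + 1) - (\<theta> - \<phi>) * ln (\<phi> - \<theta>)) (nhds x)"
        using eventually_nhds_in_open[of "{..<\<phi>}" x] True by (auto simp: log_antideriv_def elim!: eventually_mono)
      ultimately show ?thesis using True by (subst DERIV_cong_ev[OF refl _ refl]) (auto simp: abs_if)
    next
      case False
      then have xg: "\<phi> < x" using x by auto
      have "((\<lambda>\<theta>. (\<theta> - \<phi>) * (ln (2 * pi) + 1) - (\<theta> - \<phi>) * ln (\<theta> - \<phi>)) has_real_derivative ln (2 * pi / (x - \<phi>))) (at x)"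
      proof -
        have "((\<lambda>\<theta>. (\<theta> - \<phi>) * (ln (2 * pi) + 1) - (\<theta> - \<phi>) * ln (\<theta> - \<phi>)) has_real_derivative
            (ln (2 * pi) + 1) - (ln (x - \<phi>) + (x - \<phi>) * (1 / (x - \<phi>)))) (at x)"
          using xg by (auto intro!: derivative_eq_intros)
        then show ?thesis using xg by (simp add: ln_div)
      qed
      moreover have "eventually (\<lambda>\<theta>. log_antideriv \<phi> \<theta> = (\<theta> - \<phi>) * (ln (2 * pi) + 1) - (\<theta> - \<phi>) * ln (\<theta> - \<phi>)) (nhds x)"
        using eventually_nhds_in_open[of "{\<phi><..}" x] xg by (auto simp: log_antideriv_def elim!: eventually_mono)
      ultimately show ?thesis using xg by (subst DERIV_cong_ev[OF refl _ refl]) (auto simp: abs_if)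
    qed
    then show "(log_antideriv \<phi> has_vector_derivative ln (2 * pi / \<bar>x - \<phi>\<bar>)) (at x)"
      by (simp add: has_real_derivative_iff_has_vector_derivative)
  next
    have 0: "((\<lambda>x::real. x * ln \<bar>x\<bar>) \<longlongrightarrow> 0) (at 0)" by real_asymp
    have "isCont (\<lambda>x::real. x * ln \<bar>x\<bar>) x" for x
    proof (cases "x = 0")
      case True
      then show ?thesis using 0 by (simp add: isCont_def)
    next
      case False
      then show ?thesis by (intro continuous_intros) auto
    qed
    then have "continuous_on UNIV (\<lambda>x::real. x * ln \<bar>x\<bar>)" by (simp add: continuous_at_imp_continuous_on)
    then have "continuous_on {0..2 * pi} (\<lambda>\<theta>. (\<theta> - \<phi>) * ln \<bar>\<theta> - \<phi>\<bar>)"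
      by (rule continuous_on_compose2[of UNIV _ _ "\<lambda>\<theta>. \<theta> - \<phi>"]) (auto intro!: continuous_intros)
    then show "continuous_on {0..2 * pi} (log_antideriv \<phi>)"
      unfolding log_antideriv_def[abs_def] by (rule continuous_on_diff[rotated]) (intro continuous_intros)
  qed auto
  have *: "y * (ln (2 * pi) + 1) - y * ln y \<le> 2 * pi" if "0 < y" for y :: real
  proof -
    have "ln (2 * pi / y) \<le> 2 * pi / y - 1" by (rule ln_le_minus_one) (use that in simp)
    then have "y * ln (2 * pi / y) \<le> y * (2 * pi / y - 1)" using that by (intro mult_left_mono) auto
    then show ?thesis using that by (simp add: ln_div algebra_simps)
  qed
  show "log_antideriv \<phi> (2 * pi) - log_antideriv \<phi> 0 \<le> 4 * pi"
    using *[of "2 * pi - \<phi>"] *[of \<phi>] assms by (simp add: log_antideriv_def abs_if algebra_simps)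
qed

section \<open>The Nevanlinna characteristic\<close>

context pole_grid
begin

definition npoles :: "real \<Rightarrow> nat" where
  "npoles r = card (P \<inter> cball 0 r)"

lemma norm_P_ge: "p \<in> P \<Longrightarrow> 15 \<le> norm p"
  by (erule P_cases) (use norm_pt(1) R_ge_16 in \<open>smt (verit, best)\<close>)

text \<open>Places the arguments of all poles strictly between 0 and pi.\<close>

lemma Im_P_ge: "p \<in> P \<Longrightarrow> 15 \<le> Im p"
proof (erule P_cases)
  fix k c \<omega> assume p: "c \<in> cells k" "\<omega> \<in> U4" "p = pt (k, c, \<omega>)"
  have "\<bar>Im (ctr k c) - Im p\<bar> \<le> dist (ctr k c) p" by (metis abs_Im_le_cmod dist_norm minus_complex.sel(2))
  then have "\<bar>Im (ctr k c) - Im p\<bar> \<le> sc k" using dist_pt_ctr[OF p(2), of k c] p(3) by (simp add: dist_commute)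
  then show "15 \<le> Im p" using ctr_bounds(2)[OF p(1)] sc_pos[of k] R_ge_16[of k] by linarith
qed

lemma psc_le: "p \<in> P \<Longrightarrow> psc p \<le> 1/4"
  by (erule P_cases) (simp only: psc_pt sc_le)

context
  fixes M :: nat
  assumes M: "1 \<le> M"
begin

lemma pole_count_gpow: "pole_count t (gpow M) = M * npoles t"
proof -
  have "{z. is_pole (gpow M) z \<and> norm z \<le> t} = P \<inter> cball 0 t"
    using is_pole_gpow_iff[OF M] by auto
  then have "pole_count t (gpow M) = (\<Sum>z\<in>P \<inter> cball 0 t. M)"
    unfolding pole_count_def using gpow_pole(2)[OF M] by (intro sum.cong) auto
  then show ?thesis by (simp add: npoles_def)
qed

lemma pole_count_0: "pole_count 0 (gpow M) = 0"
proof -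
  have "P \<inter> cball 0 0 = {}" using norm_P_ge by force
  then show ?thesis by (simp add: pole_count_gpow npoles_def)
qed

text \<open>Exchanging sum and integral: each pole p contributes the integral of 1/t from |p| to r,
  M times.\<close>

lemma pole_counting_function_gpow:
  "pole_counting_function r (gpow M) = real M * (\<Sum>p\<in>P \<inter> cball 0 r. ln r - ln (norm p))"
proof -
  let ?A = "P \<inter> cball 0 r"
  have fin: "finite ?A" by (rule finite_P_cball)
  have one: "((\<lambda>t. if t \<in> {norm p..r} then 1 / t else 0) has_integral (ln r - ln (norm p))) {0..r}"
    if p: "p \<in> ?A" for p
  proof -
    have np: "0 < norm p" "norm p \<le> r" using p norm_P_ge[of p] by auto
    have "((\<lambda>t. 1 / t) has_integral (ln r - ln (norm p))) {norm p..r}"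
      by (rule fundamental_theorem_of_calculus)
         (use np in \<open>auto intro!: derivative_eq_intros simp del: zero_less_norm_iff simp: has_real_derivative_iff_has_vector_derivative[symmetric]\<close>)
    then show ?thesis by (subst has_integral_restrict) (use np in auto)
  qed
  have "((\<lambda>t. \<Sum>p\<in>?A. if t \<in> {norm p..r} then 1 / t else 0) has_integral (\<Sum>p\<in>?A. ln r - ln (norm p))) {0..r}"
    by (rule has_integral_sum[OF fin one])
  then have "((\<lambda>t. real M * (\<Sum>p\<in>?A. if t \<in> {norm p..r} then 1 / t else 0)) has_integral real M * (\<Sum>p\<in>?A. ln r - ln (norm p))) {0..r}"
    by (rule has_integral_mult_right)
  moreover have "real M * (\<Sum>p\<in>?A. if t \<in> {norm p..r} then 1 / t else 0) = (real (pole_count t (gpow M)) - real (pole_count 0 (gpow M))) / t"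
    if t: "t \<in> {0..r}" for t
  proof -
    have "(\<Sum>p\<in>?A. if t \<in> {norm p..r} then 1 / t else 0) = (\<Sum>p\<in>{p\<in>?A. norm p \<le> t}. 1 / t)"
      unfolding sum.inter_filter[OF fin] using t by (intro sum.cong) auto
    also have "{p\<in>?A. norm p \<le> t} = P \<inter> cball 0 t" using t by auto
    finally have "(\<Sum>p\<in>?A. if t \<in> {norm p..r} then 1 / t else 0) = real (npoles t) / t" by (simp add: npoles_def)
    then show ?thesis unfolding pole_count_0 by (simp only: pole_count_gpow of_nat_mult of_nat_0 diff_zero times_divide_eq_right)
  qed
  ultimately have "((\<lambda>t. (real (pole_count t (gpow M)) - real (pole_count 0 (gpow M))) / t) has_integral real M * (\<Sum>p\<in>?A. ln r - ln (norm p))) {0..r}"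
    by (rule has_integral_eq[rotated])
  then have "integral {0..r} (\<lambda>t. (real (pole_count t (gpow M)) - real (pole_count 0 (gpow M))) / t) = real M * (\<Sum>p\<in>?A. ln r - ln (norm p))"
    by (rule integral_unique)
  then show ?thesis unfolding pole_counting_function_def by (simp add: pole_count_0)
qed

lemma pole_counting_function_le:
  assumes "1 \<le> r"
  shows "pole_counting_function r (gpow M) \<le> real M * (real (npoles r) * r)"
proof -
  have "(\<Sum>p\<in>P \<inter> cball 0 r. ln r - ln (norm p)) \<le> (\<Sum>p\<in>P \<inter> cball 0 r. r)"
  proof (rule sum_mono)
    fix p assume "p \<in> P \<inter> cball 0 r"
    then have "0 \<le> ln (norm p)" using norm_P_ge[of p] by auto
    moreover have "ln r \<le> r" using ln_le_minus_one[of r] assms by simp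
    ultimately show "ln r - ln (norm p) \<le> r" by simp
  qed
  then show ?thesis unfolding pole_counting_function_gpow npoles_def by (intro mult_left_mono) auto
qed

lemma proximity_nonneg: "0 \<le> proximity_function r f"
proof -
  \<comment> \<open>\<open>integral\<close> has the default value 0 if the function is not
    integrable.\<close>
  have "0 \<le> integral {0..2 * pi} (\<lambda>\<theta>. log_plus (norm (f (of_real r * cis \<theta>))))"
    by (cases "(\<lambda>\<theta>. log_plus (norm (f (of_real r * cis \<theta>)))) integrable_on {0..2 * pi}")
       (auto intro!: integral_nonneg log_plus_nonneg simp: not_integrable_integral)
  then show ?thesis by (simp add: proximity_function_def)
qed

text \<open>A point within distance 1 of a pole lies in the upper half-plane, so the chord estimate
  applies on the circle of radius |p|. As |p| is at least 15, the factor 3 survives the crude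
  steps.\<close>

lemma dist_ge_angle:
  assumes p: "p \<in> P" and r: "0 < r" and \<theta>: "\<theta> \<in> {0..2 * pi}"
    and near: "dist p (of_real r * cis \<theta>) < 1"
  shows "3 * \<bar>\<theta> - Arg p\<bar> \<le> dist p (of_real r * cis \<theta>)"
proof -
  let ?z = "of_real r * cis \<theta>"
  have "\<bar>Im p - Im ?z\<bar> \<le> dist p ?z" by (metis abs_Im_le_cmod dist_norm minus_complex.sel(2))
  then have "0 < r * sin \<theta>" using Im_P_ge[OF p] near by simp
  then have sin: "0 < sin \<theta>" using r by (simp add: zero_less_mult_iff)
  have "\<theta> < pi"
  proof (rule ccontr)
    assume "\<not> \<theta> < pi"
    then have "sin \<theta> \<le> 0" using \<theta> sin_le_zero[of \<theta>] by (cases "\<theta> = 2 * pi") auto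
    then show False using sin by simp
  qed
  then have \<theta>': "\<theta> \<in> {0..pi}" using \<theta> by simp
  have "p \<noteq> 0" using norm_P_ge[OF p] by auto
  have "0 < Arg p" "Arg p < pi" using Im_P_ge[OF p] Arg_lt_pi[of p] by auto
  then have \<phi>: "Arg p \<in> {0..pi}" by simp
  have polar: "p = of_real (norm p) * cis (Arg p)"
    using rcis_cmod_Arg[of p] by (simp add: rcis_def)
  have "norm p * (\<bar>\<theta> - Arg p\<bar> / 2) \<le> norm p * norm (cis \<theta> - cis (Arg p))"
    by (intro mult_left_mono dist_cis_ge \<theta>' \<phi>) simp
  also have "\<dots> = norm (of_real (norm p) * cis \<theta> - p)"
  proof -
    have "norm p * norm (cis \<theta> - cis (Arg p)) = norm (of_real (norm p) * (cis \<theta> - cis (Arg p)))" by (simp add: norm_mult)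
    also have "of_real (norm p) * (cis \<theta> - cis (Arg p)) = of_real (norm p) * cis \<theta> - p"
      unfolding right_diff_distrib polar[symmetric] ..
    finally show ?thesis .
  qed
  \<comment> \<open>The point is moved radially to the circle of radius |p|, at a cost of at most
    the distance to p.\<close>
  also have "of_real (norm p) * cis \<theta> - p = of_real (norm p - r) * cis \<theta> - (p - ?z)" by (simp add: algebra_simps)
  also have "norm \<dots> \<le> norm (of_real (norm p - r) * cis \<theta>) + norm (p - ?z)" by (rule norm_triangle_ineq4)
  also have "norm (of_real (norm p - r) * cis \<theta>) = \<bar>norm p - norm ?z\<bar>" using r by (simp add: norm_mult del: of_real_diff)
  also have "\<dots> \<le> norm (p - ?z)" by (rule norm_triangle_ineq3)
  finally have "norm p * (\<bar>\<theta> - Arg p\<bar> / 2) \<le> 2 * dist p ?z" by (simp add: dist_norm)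
  moreover have "15 * (\<bar>\<theta> - Arg p\<bar> / 2) \<le> norm p * (\<bar>\<theta> - Arg p\<bar> / 2)"
    using norm_P_ge[OF p] by (intro mult_right_mono) auto
  moreover have "0 \<le> \<bar>\<theta> - Arg p\<bar>" by simp
  ultimately show ?thesis by (simp del: abs_ge_zero)
qed

text \<open>Where g exceeds 1200, the point lies in the disc of a single pole, and the distance to
  it is bounded below by the difference of angles. All logarithms in the sum are nonnegative, so
  that pole may be replaced by the sum over all poles up to radius \<open>r + 1\<close>.\<close>

lemma log_plus_gpow_le:
  assumes r: "0 < r" and \<theta>: "\<theta> \<in> {0..2 * pi}" "\<theta> \<notin> Arg ` (P \<inter> cball 0 (r + 1))"
  shows "log_plus (norm (gpow M (of_real r * cis \<theta>)))
      \<le> real M * (ln 2400 + (\<Sum>p\<in>P \<inter> cball 0 (r + 1). ln (2 * pi / \<bar>\<theta> - Arg p\<bar>)))"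
proof -
  let ?z = "of_real r * cis \<theta>" and ?A = "P \<inter> cball 0 (r + 1)"
  define X where "X = norm (g ?z)"
  define S where "S = (\<Sum>p\<in>?A. ln (2 * pi / \<bar>\<theta> - Arg p\<bar>))"
  have ge1: "1 \<le> 2 * pi / \<bar>\<theta> - Arg p\<bar>" if "p \<in> ?A" for p
  proof -
    have "0 < Arg p" "Arg p < pi" using that Im_P_ge[of p] Arg_lt_pi[of p] by auto
    moreover have "\<theta> \<noteq> Arg p" using \<theta>(2) that by auto
    ultimately show ?thesis using \<theta>(1) by (auto simp: abs_if pos_le_divide_eq)
  qed
  have nonneg: "0 \<le> ln (2 * pi / \<bar>\<theta> - Arg p\<bar>)" if "p \<in> ?A" for p
    using ge1[OF that] by (rule ln_ge_zero)
  have S0: "0 \<le> S" unfolding S_def by (rule sum_nonneg) (rule nonneg)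
  have "log_plus X \<le> ln 2400 + S"
  proof (cases "X \<le> 1200")
    case True
    have "log_plus X \<le> log_plus 1200" by (rule log_plus_mono[OF True])
    also have "\<dots> \<le> ln 2400" by (simp add: log_plus_ge_1)
    finally show ?thesis using S0 by simp
  next
    case False
    then obtain p where p: "p \<in> P" "?z \<in> ball p (psc p / 2)" "?z \<noteq> p"
      using large_imp_near[of ?z] by (auto simp: X_def)
    have d: "dist p ?z < 1" using p psc_le[OF p(1)] by simp
    have pA: "p \<in> ?A"
      using p(1) d r norm_triangle_ineq2[of p ?z] by (simp add: dist_norm norm_mult)
    have "psc p * \<bar>\<theta> - Arg p\<bar> \<le> 1 * \<bar>\<theta> - Arg p\<bar>" using psc_le[OF p(1)] by (intro mult_right_mono) auto
    also have "\<dots> \<le> dist p ?z" using dist_ge_angle[OF p(1) r \<theta>(1) d] abs_ge_zero[of "\<theta> - Arg p"] by (simp del: abs_ge_zero)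
    also have "\<dots> \<le> 2 * pi * dist p ?z" using pi_ge_two mult_right_mono[of 1 "2 * pi" "dist p ?z"] by simp
    finally have "psc p / dist p ?z \<le> 2 * pi / \<bar>\<theta> - Arg p\<bar>"
      using p(3) ge1[OF pA] \<theta>(2) pA by (auto simp: divide_simps mult.commute)
    moreover have "X \<le> norm (pres p / (?z - p)) + norm (rem p ?z)"
      unfolding X_def rem(3)[OF p] by (rule norm_triangle_ineq)
    ultimately have "X \<le> 2 * pi / \<bar>\<theta> - Arg p\<bar> + 1200"
      using rem(2)[OF p(1,2)] norm_\<alpha>[OF p(1)] by (simp add: norm_divide dist_norm norm_minus_commute)
    then have X: "X \<le> 2400 * (2 * pi / \<bar>\<theta> - Arg p\<bar>)" using ge1[OF pA] by linarith
    have "log_plus X \<le> ln (2400 * (2 * pi / \<bar>\<theta> - Arg p\<bar>))"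
      using False X by (simp add: log_plus_ge_1)
    also have "\<dots> = ln 2400 + ln (2 * pi / \<bar>\<theta> - Arg p\<bar>)" using ge1[OF pA] by (intro ln_mult_pos) auto
    also have "ln (2 * pi / \<bar>\<theta> - Arg p\<bar>) \<le> S"
      unfolding S_def by (rule member_le_sum[OF pA]) (use nonneg finite_P_cball in auto)
    finally show ?thesis by simp
  qed
  moreover have "log_plus (X ^ M) \<le> real M * log_plus X"
  proof (cases "1 \<le> X")
    case True
    then show ?thesis by (simp add: log_plus_ge_1 ln_realpow)
  next
    case False
    then have "X ^ M \<le> 1" by (intro power_le_one) (auto simp: X_def)
    then have "log_plus (X ^ M) \<le> log_plus 1" by (rule log_plus_mono)
    then have "log_plus (X ^ M) \<le> 0" by (simp add: log_plus_ge_1)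
    moreover have "0 \<le> real M * log_plus X" using log_plus_nonneg[of X] by simp
    ultimately show ?thesis by (rule order_trans)
  qed
  moreover have "norm (gpow M ?z) = X ^ M" by (simp add: gpow_def norm_power X_def)
  ultimately have "log_plus (norm (gpow M ?z)) \<le> real M * (ln 2400 + S)"
    by (simp add: order_trans[OF _ mult_left_mono])
  then show ?thesis by (simp only: S_def)
qed

lemma proximity_function_le:
  assumes r: "0 < r"
  shows "proximity_function r (gpow M) \<le> real M * (ln 2400 + 2 * real (npoles (r + 1)))"
proof (cases "(\<lambda>\<theta>. log_plus (norm (gpow M (of_real r * cis \<theta>)))) integrable_on {0..2 * pi}")
  \<comment> \<open>Here \<open>integral\<close> takes its default value 0, so only the integrable
    case has content.\<close>
  case False
  then have "proximity_function r (gpow M) = 0" by (simp add: proximity_function_def not_integrable_integral)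
  moreover have "0 \<le> ln (2400::real)" by simp
  ultimately show ?thesis by simp
next
  case True
  let ?A = "P \<inter> cball 0 (r + 1)" and ?f = "\<lambda>\<theta>. log_plus (norm (gpow M (of_real r * cis \<theta>)))"
  let ?G = "\<lambda>\<theta>. real M * (ln 2400 + (\<Sum>p\<in>?A. ln (2 * pi / \<bar>\<theta> - Arg p\<bar>)))"
  define J where "J p = log_antideriv (Arg p) (2 * pi) - log_antideriv (Arg p) 0" for p
  have fin: "finite ?A" by (rule finite_P_cball)
  have Arg: "0 < Arg p" "Arg p < 2 * pi" if "p \<in> ?A" for p
    using that Im_P_ge[of p] Arg_lt_pi[of p] by auto
  have "((\<lambda>\<theta>. ln 2400) has_integral (2 * pi * ln 2400)) {0..2 * pi}"
    using has_integral_const_real[of "ln 2400 :: real" 0 "2 * pi"] by simp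
  moreover have "((\<lambda>\<theta>. \<Sum>p\<in>?A. ln (2 * pi / \<bar>\<theta> - Arg p\<bar>)) has_integral (\<Sum>p\<in>?A. J p)) {0..2 * pi}"
    unfolding J_def by (intro has_integral_sum fin log_majorant_integral(1) Arg)
  ultimately have G: "(?G has_integral real M * (2 * pi * ln 2400 + (\<Sum>p\<in>?A. J p))) {0..2 * pi}"
    by (intro has_integral_mult_right has_integral_add)
  \<comment> \<open>The majorant is available off the finitely many angles of poles. Both functions
    are set to 0 there, which does not affect the integrals.\<close>
  have "((\<lambda>\<theta>. if \<theta> \<in> Arg ` ?A then 0 else ?f \<theta>) has_integral integral {0..2 * pi} ?f) {0..2 * pi}"
    by (rule has_integral_spike_finite[of "Arg ` ?A"]) (use fin True in \<open>auto simp: has_integral_integral\<close>)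
  moreover have "((\<lambda>\<theta>. if \<theta> \<in> Arg ` ?A then 0 else ?G \<theta>) has_integral real M * (2 * pi * ln 2400 + (\<Sum>p\<in>?A. J p))) {0..2 * pi}"
    by (rule has_integral_spike_finite[of "Arg ` ?A", OF _ _ G]) (use fin in auto)
  ultimately have "integral {0..2 * pi} ?f \<le> real M * (2 * pi * ln 2400 + (\<Sum>p\<in>?A. J p))"
    by (rule has_integral_le) (use log_plus_gpow_le[OF r] in auto)
  also have "\<dots> \<le> real M * (2 * pi * ln 2400 + (\<Sum>p\<in>?A. 4 * pi))"
    unfolding J_def by (intro mult_left_mono add_left_mono sum_mono log_majorant_integral(2) Arg) auto
  also have "\<dots> = 2 * pi * (real M * (ln 2400 + 2 * real (npoles (r + 1))))" by (simp add: npoles_def algebra_simps)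
  finally show ?thesis by (simp add: proximity_function_def pos_divide_le_eq mult.commute)
qed

lemma nevanlinna_le:
  assumes "1 \<le> r"
  shows "nevanlinna_characteristic r (gpow M) \<le> real M * (2400 + (r + 2) * real (npoles (r + 1)))"
proof -
  have "npoles r \<le> npoles (r + 1)" unfolding npoles_def by (intro card_mono finite_P_cball) auto
  then have "real (npoles r) * r \<le> real (npoles (r + 1)) * r" using assms by (intro mult_right_mono) auto
  moreover have "ln (2400::real) \<le> 2400" using ln_le_minus_one[of 2400] by simp
  ultimately have "ln 2400 + 2 * real (npoles (r + 1)) + real (npoles r) * r \<le> 2400 + (r + 2) * real (npoles (r + 1))"
    by (simp add: algebra_simps)
  then have "real M * (ln 2400 + 2 * real (npoles (r + 1)) + real (npoles r) * r) \<le> real M * (2400 + (r + 2) * real (npoles (r + 1)))"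
    by (rule mult_left_mono) simp
  then show ?thesis using proximity_function_le[of r] pole_counting_function_le[of r] assms
    unfolding nevanlinna_characteristic_def by (simp add: algebra_simps)
qed

text \<open>The poles of level k have modulus at most \<open>3 * R k\<close>, so at radius
  \<open>9 * R k\<close> each contributes at least ln 3, which is at least 1. One pole per cell is
  enough.\<close>

lemma nevanlinna_ge: "real (N k) \<le> nevanlinna_characteristic (9 * R k) (gpow M)"
proof -
  let ?A = "P \<inter> cball 0 (9 * R k)" and ?B = "(\<lambda>c. pt (k, c, 1)) ` cells k"
  have inj: "inj_on (\<lambda>c. pt (k, c, 1)) (cells k)"
  proof (rule inj_onI)
    fix c c' assume c: "c \<in> cells k" "c' \<in> cells k" "pt (k, c, 1) = pt (k, c', 1)"
    then have "(k, c, 1) = (k, c', 1 :: complex)" by (intro inj_onD[OF inj_pt c(3)]) (auto simp: Ix_def)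
    then show "c = c'" by simp
  qed
  have nn: "0 \<le> ln (9 * R k) - ln (norm p)" if p: "p \<in> ?A" for p
  proof -
    have "p \<noteq> 0" "norm p \<le> 9 * R k" using p norm_P_ge[of p] by auto
    then show ?thesis using R_pos[of k] by simp
  qed
  have B: "norm b \<le> 3 * R k" "b \<in> P" if "b \<in> ?B" for b
    using that norm_pt(2)[of _ k 1] pt_in_P[of _ k 1] by auto
  then have sub: "?B \<subseteq> ?A" using R_pos[of k] by force
  have "real (N k) * 1 \<le> real (N k) * real (N k)" using N_pos[of k] by (intro mult_left_mono) auto
  also have "\<dots> = (\<Sum>p\<in>?B. 1)" by (simp add: card_image[OF inj] card_cells)
  also have "\<dots> \<le> (\<Sum>p\<in>?B. ln (9 * R k) - ln (norm p))"
  proof (rule sum_mono)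
    fix p assume p: "p \<in> ?B"
    have "1 \<le> ln (3::real)" using exp_le by (simp add: ln_ge_iff)
    also have "\<dots> \<le> ln (9 * R k / norm p)"
    proof (rule ln_mono)
      have "0 < norm p" using B[OF p] norm_P_ge[of p] by linarith
      then show "3 \<le> 9 * R k / norm p" using B(1)[OF p] by (simp only: pos_le_divide_eq)
    qed simp
    also have "\<dots> = ln (9 * R k) - ln (norm p)"
    proof -
      have "p \<noteq> 0" using B(2)[OF p] norm_P_ge[of p] by auto
      then show ?thesis using R_pos[of k] by (simp add: ln_div)
    qed
    finally show "1 \<le> ln (9 * R k) - ln (norm p)" .
  qed
  also have "\<dots> \<le> (\<Sum>p\<in>?A. ln (9 * R k) - ln (norm p))"
  proof (rule sum_mono2[OF finite_P_cball sub])
    fix p assume "p \<in> ?A - ?B"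
    then show "0 \<le> ln (9 * R k) - ln (norm p)" by (intro nn) auto
  qed
  also have "\<dots> \<le> real M * (\<Sum>p\<in>?A. ln (9 * R k) - ln (norm p))"
  proof -
    have "0 \<le> (\<Sum>p\<in>?A. ln (9 * R k) - ln (norm p))"
    proof (rule sum_nonneg)
      fix p assume "p \<in> ?A"
      then show "0 \<le> ln (9 * R k) - ln (norm p)" by (intro nn) auto
    qed
    then show ?thesis using M mult_right_mono[of 1 "real M"] by simp
  qed
  also have "\<dots> \<le> nevanlinna_characteristic (9 * R k) (gpow M)"
    using proximity_nonneg by (simp add: nevanlinna_characteristic_def pole_counting_function_gpow)
  finally show ?thesis by simp
qed

end

text \<open>Level k is counted only if \<open>R k \<le> r + 2\<close>. As \<open>R k\<close> exceeds
  k, there are at most \<open>r + 3\<close> such levels, each with at most four poles in each of its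
  \<open>(N k)\<^sup>2\<close> cells.\<close>

lemma npoles_le:
  fixes Y :: real
  assumes r: "0 \<le> r" and Y: "\<And>k. R k \<le> r + 2 \<Longrightarrow> real (N k) \<le> 2 * Y"
  shows "real (npoles (r + 1)) \<le> (r + 3) * (16 * Y\<^sup>2)"
proof -
  define K where "K = {k. R k \<le> r + 2}"
  have K: "K \<subseteq> {..<nat \<lceil>r + 2\<rceil>}"
  proof
    fix k assume "k \<in> K"
    have "real k < 2 ^ k" using less_exp[of k] by (metis of_nat_less_iff of_nat_numeral of_nat_power)
    also have "\<dots> \<le> R k" using R_ge[of k] zero_less_power[of "2::real" k] by linarith
    also have "\<dots> \<le> r + 2" using \<open>k \<in> K\<close> by (simp add: K_def)
    finally show "k \<in> {..<nat \<lceil>r + 2\<rceil>}" by simp linarith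
  qed
  then have finK: "finite K" by (rule finite_subset) simp
  have "card K \<le> nat \<lceil>r + 2\<rceil>" using card_mono[OF _ K] by simp
  then have cardK: "real (card K) \<le> r + 3" using r by linarith
  have card4: "real (card (Plev k)) \<le> 16 * Y\<^sup>2" if "k \<in> K" for k
  proof -
    have "card (Plev k) \<le> card (cells k \<times> U4)"
      unfolding Plev_def by (intro card_image_le finite_cartesian_product finite_cells) auto
    also have "\<dots> \<le> card (cells k) * 4"
      by (simp add: card_cartesian_product card_insert_if)
    finally have "real (card (Plev k)) \<le> 4 * (real (N k) * real (N k))" by (simp add: card_cells flip: of_nat_mult)
    also have "\<dots> \<le> 4 * ((2 * Y) * (2 * Y))" using Y[of k] that by (intro mult_left_mono mult_mono) (auto simp: K_def intro: order_trans[rotated])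
    finally show ?thesis by (simp add: power2_eq_square)
  qed
  have "P \<inter> cball 0 (r + 1) \<subseteq> (\<Union>k\<in>K. Plev k)"
  proof
    fix p assume p: "p \<in> P \<inter> cball 0 (r + 1)"
    then obtain k where k: "p \<in> Plev k" by (auto simp: P_eq)
    then have "k \<in> K" using norm_Plev(1)[OF k] p by (simp add: K_def)
    then show "p \<in> (\<Union>k\<in>K. Plev k)" using k by blast
  qed
  then have "npoles (r + 1) \<le> card (\<Union>k\<in>K. Plev k)"
    unfolding npoles_def using finK finite_Plev by (intro card_mono) auto
  also have "\<dots> \<le> (\<Sum>k\<in>K. card (Plev k))" by (rule card_UN_le[OF finK])
  finally have "real (npoles (r + 1)) \<le> (\<Sum>k\<in>K. real (card (Plev k)))" by (simp flip: of_nat_sum)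
  also have "\<dots> \<le> (\<Sum>k\<in>K. 16 * Y\<^sup>2)" by (rule sum_mono) (rule card4)
  also have "\<dots> = real (card K) * (16 * Y\<^sup>2)" by simp
  also have "\<dots> \<le> (r + 3) * (16 * Y\<^sup>2)" using cardK by (intro mult_right_mono) auto
  finally show ?thesis .
qed

end

section \<open>The n-th order\<close>

locale order_grid = pole_grid +
  fixes \<rho> :: real and n :: nat
  assumes \<rho>: "0 < \<rho>" and n: "1 \<le> n"
    and N_eq: "N k = nat \<lceil>(exp ^^ n) (R k powr \<rho>)\<rceil>"
begin

lemma N_lower: "(exp ^^ n) (R k powr \<rho>) \<le> real (N k)"
  by (simp add: N_eq real_nat_ceiling_ge)

lemma R_powr_ge_1: "1 \<le> R k powr \<rho>"
  using R_ge_16[of k] \<rho> by (simp add: ge_one_powr_ge_zero)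

lemma N_upper: "real (N k) \<le> 2 * (exp ^^ n) (R k powr \<rho>)"
proof -
  have 1: "1 \<le> (exp ^^ n) (R k powr \<rho>)" using iter_exp_ge[of "R k powr \<rho>" n] R_powr_ge_1[of k] by linarith
  then have "real (N k) \<le> (exp ^^ n) (R k powr \<rho>) + 1" unfolding N_eq by linarith
  then show ?thesis using 1 by linarith
qed

context
  fixes M :: nat
  assumes M: "1 \<le> M"
begin

text \<open>The characteristic is at most a polynomial in r times the square of an n-fold
  exponential, both of which \<open>iter_exp_square\<close> moves into the innermost argument. The
  constant is 2416 = 2400 + 16.\<close>

lemma nevanlinna_upper:
  assumes r: "1 \<le> r"
  shows "nevanlinna_characteristic r (gpow M) \<le> (exp ^^ n) (2 * (r + 2) powr \<rho> + ln (2416 * real M * (r + 3)\<^sup>2))"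
proof -
  define x where "x = (r + 2) powr \<rho>"
  define Y where "Y = (exp ^^ n) x"
  define A where "A = 2416 * real M * (r + 3)\<^sup>2"
  have x1: "1 \<le> x" using r \<rho> by (simp add: x_def ge_one_powr_ge_zero)
  have Y1: "1 \<le> Y" using iter_exp_ge[of x n] x1 by (simp add: Y_def)
  have Y2: "1 \<le> Y\<^sup>2" using Y1 by simp
  have "real (npoles (r + 1)) \<le> (r + 3) * (16 * Y\<^sup>2)"
  proof (rule npoles_le)
    fix k assume "R k \<le> r + 2"
    then have "R k powr \<rho> \<le> x" unfolding x_def using R_pos[of k] \<rho> by (intro powr_mono2) auto
    then show "real (N k) \<le> 2 * Y" using N_upper[of k] iter_exp_mono[of "R k powr \<rho>" x n] by (simp add: Y_def)
  qed (use r in simp)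
  then have "(r + 2) * real (npoles (r + 1)) \<le> (r + 3) * ((r + 3) * (16 * Y\<^sup>2))"
    using r by (intro mult_mono) auto
  moreover have "2400 * (1 * 1) \<le> 2400 * ((r + 3)\<^sup>2 * Y\<^sup>2)"
    using r Y2 by (intro mult_left_mono mult_mono) (auto intro!: one_le_power)
  ultimately have "2400 + (r + 2) * real (npoles (r + 1)) \<le> 2416 * (r + 3)\<^sup>2 * Y\<^sup>2"
    by (simp add: power2_eq_square algebra_simps)
  then have "real M * (2400 + (r + 2) * real (npoles (r + 1))) \<le> real M * (2416 * (r + 3)\<^sup>2 * Y\<^sup>2)"
    by (rule mult_left_mono) simp
  also have "\<dots> = A * Y\<^sup>2" by (simp add: A_def)
  also have "A * Y\<^sup>2 \<le> (exp ^^ n) (2 * x + ln A)"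
  proof -
    have "1 * 1 \<le> 2416 * real M * (r + 3)\<^sup>2" using M r by (intro mult_mono one_le_power) auto
    then show ?thesis unfolding Y_def by (intro iter_exp_square x1 n) (simp add: A_def)
  qed
  finally show ?thesis using nevanlinna_le[OF M r] by (simp add: x_def A_def)
qed

text \<open>From above, the innermost argument is of order \<open>r powr \<rho>\<close>. From below,
  the radii \<open>9 * R k\<close> suffice for a limit superior.\<close>

lemma nth_order_gpow: "nth_order n (gpow M) = ereal \<rho>"
proof (rule antisym)
  let ?T = "\<lambda>r. nevanlinna_characteristic r (gpow M)"
  let ?u = "\<lambda>r. ln (2 * (r + 2) powr \<rho> + ln (2416 * real M * (r + 3)\<^sup>2)) / ln r"
  let ?v = "\<lambda>r. (log_plus ^^ (n + 1)) (?T r) / ln r"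
  have le: "?v r \<le> ?u r" if r: "2 \<le> r" for r
  proof -
    let ?w = "2 * (r + 2) powr \<rho> + ln (2416 * real M * (r + 3)\<^sup>2)"
    have "1 \<le> (r + 2) powr \<rho>" using r \<rho> by (simp add: ge_one_powr_ge_zero)
    moreover have "1 * 1 \<le> 2416 * real M * (r + 3)\<^sup>2" using M r by (intro mult_mono one_le_power) auto
    then have "0 \<le> ln (2416 * real M * (r + 3)\<^sup>2)" by (intro ln_ge_zero) simp
    ultimately have w: "1 \<le> ?w" by linarith
    have "(log_plus ^^ n) (?T r) \<le> (log_plus ^^ n) ((exp ^^ n) ?w)"
      by (rule iter_log_plus_mono, rule nevanlinna_upper) (use r in simp)
    also have "\<dots> = ?w" by (rule iter_log_plus_iter_exp) (use w in simp)
    finally have "log_plus ((log_plus ^^ n) (?T r)) \<le> log_plus ?w" by (rule log_plus_mono)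
    also have "\<dots> = ln ?w" by (rule log_plus_ge_1[OF w])
    finally have "(log_plus ^^ (n + 1)) (?T r) \<le> ln ?w" by simp
    then show ?thesis using r by (intro divide_right_mono) auto
  qed
  have "(?u \<longlongrightarrow> \<rho>) at_top" using \<rho> M by real_asymp
  then have "((\<lambda>r. ereal (?u r)) \<longlongrightarrow> ereal \<rho>) at_top" by simp
  then have "Limsup at_top (\<lambda>r. ereal (?u r)) = ereal \<rho>" by (intro lim_imp_Limsup) auto
  moreover have "Limsup at_top (\<lambda>r. ereal (?v r)) \<le> Limsup at_top (\<lambda>r. ereal (?u r))"
    by (rule Limsup_mono) (use eventually_ge_at_top[of 2] in \<open>eventually_elim, simp only: ereal_less_eq le\<close>)
  ultimately show "nth_order n (gpow M) \<le> ereal \<rho>" by (simp only: nth_order_def)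
  show "ereal \<rho> \<le> nth_order n (gpow M)"
  proof (rule ccontr)
    assume "\<not> ereal \<rho> \<le> nth_order n (gpow M)"
    then have "Limsup at_top (\<lambda>r. ereal (?v r)) < ereal \<rho>" by (simp only: nth_order_def not_le)
    then obtain c where c: "Limsup at_top (\<lambda>r. ereal (?v r)) < ereal c" "c < \<rho>"
      using ereal_dense2[of "Limsup at_top (\<lambda>r. ereal (?v r))" "ereal \<rho>"] by auto
    have ev1: "eventually (\<lambda>r. ereal (?v r) < ereal c) at_top" by (rule Limsup_lessD[OF c(1)])
    have "((\<lambda>r. \<rho> * ln r / ln (9 * r)) \<longlongrightarrow> \<rho>) at_top" using \<rho> by real_asymp
    then have ev2: "eventually (\<lambda>r. c < \<rho> * ln r / ln (9 * r)) at_top" using c(2) by (rule order_tendstoD)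
    obtain r1 where r1: "\<And>r. r1 \<le> r \<Longrightarrow> ?v r < c" using ev1 by (auto simp: eventually_at_top_linorder)
    obtain r2 where r2: "\<And>r. r2 \<le> r \<Longrightarrow> c < \<rho> * ln r / ln (9 * r)" using ev2 by (auto simp: eventually_at_top_linorder)
    obtain k where k: "max r1 r2 < R k" using R_unbounded by blast
    have R16: "16 \<le> R k" by (rule R_ge_16)
    have "(log_plus ^^ n) ((exp ^^ n) (R k powr \<rho>)) \<le> (log_plus ^^ n) (?T (9 * R k))"
      by (rule iter_log_plus_mono) (rule order_trans[OF N_lower nevanlinna_ge[OF M]])
    then have "R k powr \<rho> \<le> (log_plus ^^ n) (?T (9 * R k))"
      by (subst (asm) iter_log_plus_iter_exp) auto
    then have "log_plus (R k powr \<rho>) \<le> log_plus ((log_plus ^^ n) (?T (9 * R k)))" by (rule log_plus_mono)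
    moreover have "log_plus (R k powr \<rho>) = \<rho> * ln (R k)"
      using R_powr_ge_1[of k] R16 by (simp add: log_plus_ge_1 ln_powr)
    ultimately have "\<rho> * ln (R k) / ln (9 * R k) \<le> ?v (9 * R k)" using R16 by (intro divide_right_mono) auto
    then show False using r1[of "9 * R k"] r2[of "R k"] k R16 by simp
  qed
qed

end

end

section \<open>Escaping points\<close>

text \<open>The additive gap \<open>x / 2\<close> between the two arguments survives every
  exponential; one more exponential turns it into a factor in
  \<open>iter_exp_half_mult\<close>.\<close>

lemma iter_exp_gap:
  fixes x :: real
  assumes "0 \<le> x"
  shows "(exp ^^ m) (x / 2) + x / 2 \<le> (exp ^^ m) x"
proof (induction m)
  case (Suc m)
  define b where "b = (exp ^^ m) (x / 2)"
  have "0 \<le> b" using iter_exp_ge[of "x / 2" m] assms by (simp add: b_def)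
  have "exp b + x / 2 \<le> exp b * (1 + x / 2)"
    using assms \<open>0 \<le> b\<close> mult_right_mono[of 1 "exp b" "x / 2"] by (simp add: distrib_left)
  also have "\<dots> \<le> exp b * exp (x / 2)" using exp_ge_add_one_self[of "x / 2"] by (intro mult_left_mono) auto
  also have "\<dots> = exp (b + x / 2)" by (simp add: exp_add)
  also have "\<dots> \<le> exp ((exp ^^ m) x)" using Suc by (simp add: b_def)
  finally show ?case by (simp add: b_def)
qed simp

lemma iter_exp_half_mult:
  fixes x r :: real
  assumes "0 \<le> x" "0 < r" "ln r \<le> x / 2" "1 \<le> n"
  shows "r * (exp ^^ n) (x / 2) \<le> (exp ^^ n) x"
proof -
  obtain m where n: "n = Suc m" using assms(4) by (cases n) auto
  have "r * exp ((exp ^^ m) (x / 2)) = exp ((exp ^^ m) (x / 2) + ln r)" using assms by (simp add: exp_add)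
  also have "\<dots> \<le> exp ((exp ^^ m) x)" using iter_exp_gap[OF assms(1), of m] assms(3) by simp
  finally show ?thesis by (simp add: n)
qed

lemma card_le_of_width:
  fixes S :: "nat set"
  assumes "finite S" "\<And>i j. i \<in> S \<Longrightarrow> j \<in> S \<Longrightarrow> \<bar>real i - real j\<bar> \<le> d" "0 \<le> d"
  shows "real (card S) \<le> d + 1"
proof (cases "S = {}")
  case False
  have "S \<subseteq> {Min S..Max S}" using assms(1) by auto
  then have "card S \<le> Suc (Max S) - Min S" using card_mono[of "{Min S..Max S}" S] by simp
  moreover have "Min S \<le> Max S" using assms(1) False by simp
  moreover have "Max S \<in> S" "Min S \<in> S" using assms(1) False by auto
  then have "\<bar>real (Max S) - real (Min S)\<bar> \<le> d" by (rule assms(2))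
  ultimately show ?thesis by linarith
qed (use assms in simp)

text \<open>Rescaling by B reduces to the estimate for powers on the unit disc.\<close>

lemma norm_power_diff_le:
  fixes z w :: complex
  assumes "norm z \<le> B" "norm w \<le> B" "0 < B" "1 \<le> M"
  shows "norm (z ^ M - w ^ M) \<le> real M * B ^ (M - 1) * norm (z - w)"
proof -
  have "norm ((z / of_real B) ^ M - (w / of_real B) ^ M) \<le> real M * norm (z / of_real B - w / of_real B)"
    by (rule norm_power_diff) (use assms in \<open>auto simp: norm_divide\<close>)
  also have "(z / of_real B) ^ M - (w / of_real B) ^ M = (z ^ M - w ^ M) / of_real (B ^ M)"
    by (simp add: power_divide diff_divide_distrib)
  also have "z / of_real B - w / of_real B = (z - w) / of_real B" by (simp add: diff_divide_distrib)
  finally have "norm (z ^ M - w ^ M) / B ^ M \<le> real M * (norm (z - w) / B)"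
    using assms(3) by (simp add: norm_divide norm_power)
  then have "norm (z ^ M - w ^ M) \<le> real M * (norm (z - w) / B) * B ^ M"
    using assms(3) by (simp add: pos_divide_le_eq)
  also have "B ^ M = B * B ^ (M - 1)" using assms(4) by (simp add: power_eq_if)
  finally show ?thesis using assms(3) by (simp add: algebra_simps)
qed

text \<open>10800 = 9 * 1200 is the modulus from which g has inverse branches; the M-th roots of all
  points in the squares have to exceed it. \<open>growth\<close> lets the factor \<open>R k\<close>
  between the number of cells and their reciprocal side be absorbed by halving the innermost
  argument.\<close>

locale escaping_grid = order_grid +
  fixes M :: nat
  assumes M: "1 \<le> M" and R0_M: "10800 \<le> R 0 powr (1 / real M)"
    and growth: "R k * (exp ^^ n) (R k powr \<rho> / 2) \<le> (exp ^^ n) (R k powr \<rho>)"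
begin

definition Q :: "nat \<Rightarrow> complex set" where
  "Q k = cbox (Complex (- (R k / 2)) (R k)) (Complex (R k / 2) (2 * R k))"

lemma in_Q: "z \<in> Q k \<longleftrightarrow> \<bar>Re z\<bar> \<le> R k / 2 \<and> R k \<le> Im z \<and> Im z \<le> 2 * R k"
  by (auto simp: Q_def in_cbox_complex_iff abs_le_iff)

lemma norm_Q:
  assumes "z \<in> Q k"
  shows "R k \<le> norm z" "norm z \<le> 5/2 * R k" "0 < Im z"
  using assms abs_Im_le_cmod[of z] cmod_le[of z] R_pos[of k] unfolding in_Q by linarith+

section \<open>Inverse branches on the squares\<close>

definition rt :: "complex \<Rightarrow> complex" where
  "rt v = exp (Ln v / of_nat M)"

lemma rt_power: "v \<noteq> 0 \<Longrightarrow> rt v ^ M = v"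
  using M by (simp add: rt_def exp_of_nat_mult[symmetric])

lemma norm_rt: "v \<noteq> 0 \<Longrightarrow> norm (rt v) = norm v powr (1 / real M)"
  by (simp add: rt_def powr_def norm_exp_eq_Re Re_divide_of_nat)

lemma rt_continuous: "continuous_on (Q k) rt"
  unfolding rt_def
proof (intro continuous_intros)
  show "\<And>z. z \<in> Q k \<Longrightarrow> z \<notin> \<real>\<^sub>\<le>\<^sub>0" using norm_Q(3) by (force simp: complex_nonpos_Reals_iff)
qed (use M in auto)

text \<open>An upper bound for the modulus of the M-th roots of points of \<open>Q (Suc k)\<close>,
  whose moduli are at most \<open>5/2 * R (Suc k)\<close>.\<close>

definition Bd :: "nat \<Rightarrow> real" where
  "Bd k = (5/2 * R (Suc k)) powr (1 / real M)"

lemma Bd_pos: "0 < Bd k"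
  using R_pos[of "Suc k"] by (simp add: Bd_def)

lemma Bd_power: "Bd k ^ M = 5/2 * R (Suc k)"
  using R_pos[of "Suc k"] M by (simp add: Bd_def powr_realpow[symmetric] powr_powr)

lemma Bd_ge_1: "1 \<le> Bd k"
  using R_ge_16[of "Suc k"] by (simp add: Bd_def ge_one_powr_ge_zero)

lemma Bd_le: "Bd k \<le> 5/2 * R (Suc k) powr (1 / real M)"
proof -
  have "Bd k = (5/2) powr (1 / real M) * R (Suc k) powr (1 / real M)"
    unfolding Bd_def using R_pos[of "Suc k"] by (intro powr_mult)
  also have "(5/2::real) powr (1 / real M) \<le> (5/2) powr 1" using M by (intro powr_mono) auto
  finally show ?thesis by (simp add: mult_right_mono)
qed

lemma norm_rt_Q:
  assumes "v \<in> Q (Suc k)"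
  shows "10800 \<le> norm (rt v)" "norm (rt v) \<le> Bd k" "v \<noteq> 0"
proof -
  note v = norm_Q[OF assms]
  show nz: "v \<noteq> 0" using v(3) by auto
  have "R 0 powr (1 / real M) \<le> norm v powr (1 / real M)"
    using v R_mono[of 0 "Suc k"] R_pos[of 0] by (intro powr_mono2) auto
  then show "10800 \<le> norm (rt v)" unfolding norm_rt[OF nz] using R0_M by linarith
  show "norm (rt v) \<le> Bd k" unfolding norm_rt[OF nz] Bd_def using v by (intro powr_mono2) auto
qed

text \<open>Of the four poles of a cell only the one with \<omega> = 1 carries a branch.\<close>

definition pole :: "nat \<Rightarrow> nat \<times> nat \<Rightarrow> complex" where
  "pole k c = pt (k, c, 1)"

lemma pole_facts: "c \<in> cells k \<Longrightarrow> pole k c \<in> P" "c \<in> cells k \<Longrightarrow> psc (pole k c) = sc k"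
  "dist (pole k c) (ctr k c) = sc k"
  using pt_in_P[of c k 1] psc_pt[of c k 1] dist_pt_ctr[of 1 k c] by (auto simp: pole_def)

text \<open>The choice is unambiguous, since \<open>branch_bounds\<close> makes g injective where it
  is large near the pole; the same estimate gives continuity in v.\<close>

definition \<psi> :: "nat \<Rightarrow> nat \<times> nat \<Rightarrow> complex \<Rightarrow> complex" where
  "\<psi> k c v = (SOME z. z \<in> cball (pole k c) (sc k / 8) \<and> z \<noteq> pole k c \<and> g z = rt v)"

lemma \<psi>:
  assumes c: "c \<in> cells k" and v: "v \<in> Q (Suc k)"
  shows "\<psi> k c v \<in> cball (pole k c) (sc k / 8)" "\<psi> k c v \<noteq> pole k c" "g (\<psi> k c v) = rt v"
proof -
  obtain z where "z \<in> cball (pole k c) (psc (pole k c) / 8)" "z \<noteq> pole k c" "g z = rt v"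
    by (rule branch_exists[OF pole_facts(1)[OF c], of "rt v"]) (use norm_rt_Q(1)[OF v] in auto)
  then have "\<exists>z. z \<in> cball (pole k c) (sc k / 8) \<and> z \<noteq> pole k c \<and> g z = rt v"
    using pole_facts(2)[OF c] by auto
  from someI_ex[OF this] show "\<psi> k c v \<in> cball (pole k c) (sc k / 8)" "\<psi> k c v \<noteq> pole k c" "g (\<psi> k c v) = rt v"
    unfolding \<psi>_def by blast+
qed

lemma gpow_\<psi>: "c \<in> cells k \<Longrightarrow> v \<in> Q (Suc k) \<Longrightarrow> gpow M (\<psi> k c v) = v"
  using \<psi>(3)[of c k v] norm_rt_Q(3)[of v k] by (simp add: gpow_def rt_power)

lemma dist_\<psi>_ctr:
  assumes c: "c \<in> cells k" and v: "v \<in> Q (Suc k)"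
  shows "dist (\<psi> k c v) (ctr k c) \<le> 9/8 * sc k"
  using \<psi>(1)[OF c v] pole_facts(3)[of k c] dist_triangle[of "\<psi> k c v" "ctr k c" "pole k c"]
  by (simp add: dist_commute)

lemma \<psi>_bounds:
  assumes c: "c \<in> cells k" and v: "v \<in> Q (Suc k)" and w: "w \<in> Q (Suc k)"
  shows "sc k * norm (rt v - rt w) \<le> 8 * (norm (rt v) * norm (rt w)) * norm (\<psi> k c v - \<psi> k c w)"
    and "norm (\<psi> k c v - \<psi> k c w) \<le> sc k * norm (rt v - rt w)"
  using branch_bounds[OF pole_facts(1)[OF c], of "\<psi> k c v" "\<psi> k c w"] \<psi>[OF c v] \<psi>[OF c w]
    norm_rt_Q(1)[OF v] norm_rt_Q(1)[OF w] pole_facts(2)[OF c] by simp_all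

text \<open>20 = 8 * 5/2, with 8 from \<open>branch_bounds\<close> and 5/2 from the largest modulus
  in the square.\<close>

definition l :: "nat \<Rightarrow> real" where
  "l k = sc k / (20 * real M * R (Suc k) * Bd k)"

text \<open>The power map is Lipschitz with constant \<open>M * B ^ (M - 1)\<close>, and the branch
  of g contracts at most by \<open>sc k / (8 * B\<^sup>2)\<close>, where B stands for
  \<open>Bd k\<close>. The product contains \<open>B ^ M\<close>, which is known exactly, and one
  further factor B; that factor is the whole loss of density.\<close>

lemma \<psi>_expand:
  assumes c: "c \<in> cells k" and v: "v \<in> Q (Suc k)" and w: "w \<in> Q (Suc k)"
  shows "l k * dist v w \<le> dist (\<psi> k c v) (\<psi> k c w)"
proof -
  let ?B = "Bd k"
  note B = Bd_pos[of k]
  have "norm (v - w) = norm (rt v ^ M - rt w ^ M)"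
    using norm_rt_Q(3)[OF v] norm_rt_Q(3)[OF w] by (simp add: rt_power)
  also have "\<dots> \<le> real M * ?B ^ (M - 1) * norm (rt v - rt w)"
    by (rule norm_power_diff_le) (use norm_rt_Q(2)[OF v] norm_rt_Q(2)[OF w] B M in auto)
  finally have 1: "norm (v - w) \<le> real M * ?B ^ (M - 1) * norm (rt v - rt w)" .
  have "8 * (norm (rt v) * norm (rt w)) * norm (\<psi> k c v - \<psi> k c w) \<le> 8 * (?B * ?B) * norm (\<psi> k c v - \<psi> k c w)"
    using norm_rt_Q(2)[OF v] norm_rt_Q(2)[OF w] B by (intro mult_right_mono mult_left_mono mult_mono) auto
  then have 2: "sc k * norm (rt v - rt w) \<le> 8 * (?B * ?B) * norm (\<psi> k c v - \<psi> k c w)"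
    using \<psi>_bounds(1)[OF c v w] by linarith
  have "sc k * norm (v - w) \<le> sc k * (real M * ?B ^ (M - 1) * norm (rt v - rt w))"
    using 1 sc_pos[of k] by (intro mult_left_mono) auto
  also have "\<dots> = real M * ?B ^ (M - 1) * (sc k * norm (rt v - rt w))" by simp
  also have "\<dots> \<le> real M * ?B ^ (M - 1) * (8 * (?B * ?B) * norm (\<psi> k c v - \<psi> k c w))"
    using 2 B by (intro mult_left_mono) auto
  also have "\<dots> = 8 * real M * (?B * ?B ^ (M - 1)) * ?B * norm (\<psi> k c v - \<psi> k c w)" by simp
  also have "?B * ?B ^ (M - 1) = 5/2 * R (Suc k)" using M Bd_power[of k] by (simp add: power_eq_if)
  finally have "sc k * norm (v - w) \<le> (20 * real M * R (Suc k) * ?B) * norm (\<psi> k c v - \<psi> k c w)" by simp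
  moreover have "0 < 20 * real M * R (Suc k) * ?B" using M R_pos[of "Suc k"] B by simp
  ultimately have "sc k * norm (v - w) / (20 * real M * R (Suc k) * ?B) \<le> norm (\<psi> k c v - \<psi> k c w)"
    by (simp only: pos_divide_le_eq mult.commute)
  then show ?thesis by (simp add: l_def dist_norm)
qed

lemma \<psi>_maps:
  assumes c: "c \<in> cells k" and v: "v \<in> Q (Suc k)"
  shows "\<psi> k c v \<in> Q k"
proof -
  have "\<bar>Re (\<psi> k c v) - Re (ctr k c)\<bar> \<le> 9/8 * sc k" "\<bar>Im (\<psi> k c v) - Im (ctr k c)\<bar> \<le> 9/8 * sc k"
    using dist_\<psi>_ctr[OF c v] abs_Re_le_cmod[of "\<psi> k c v - ctr k c"] abs_Im_le_cmod[of "\<psi> k c v - ctr k c"]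
    by (auto simp: dist_norm)
  then show ?thesis using ctr_bounds[OF c] sc_pos[of k] unfolding in_Q by linarith
qed

lemma \<psi>_continuous:
  assumes c: "c \<in> cells k"
  shows "continuous_on (Q (Suc k)) (\<psi> k c)"
  unfolding continuous_on_iff
proof (intro ballI allI impI)
  fix v and e :: real assume v: "v \<in> Q (Suc k)" and e: "0 < e"
  have "0 < e / sc k" using e sc_pos[of k] by simp
  then obtain d where d: "0 < d" "\<And>w. w \<in> Q (Suc k) \<Longrightarrow> dist w v < d \<Longrightarrow> dist (rt w) (rt v) < e / sc k"
    using rt_continuous[of "Suc k"] v unfolding continuous_on_iff by blast
  have "dist (\<psi> k c w) (\<psi> k c v) < e" if w: "w \<in> Q (Suc k)" "dist w v < d" for w
  proof -
    have "sc k * norm (rt w - rt v) < e"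
      using d(2)[OF w] sc_pos[of k] by (simp add: dist_norm pos_less_divide_eq mult.commute)
    then show ?thesis using \<psi>_bounds(2)[OF c w(1) v] by (simp add: dist_norm)
  qed
  then show "\<exists>d>0. \<forall>w\<in>Q (Suc k). dist w v < d \<longrightarrow> dist (\<psi> k c w) (\<psi> k c v) < e" using d(1) by blast
qed

text \<open>The centres of the cells that are met are within \<open>t + 9/4 * sc k\<close>, hence
  \<open>4 * t\<close>, of each other. So either index takes at most \<open>t / sc k + 1\<close>
  values, at most \<open>2 * t / sc k\<close>, and \<open>sc k = R k / (4 * N k)\<close> produces
  the 64.\<close>

lemma cells_count:
  assumes t: "sc k \<le> t" and U: "width_le U t"
  shows "real (card {c \<in> cells k. \<exists>y\<in>Q (Suc k). \<psi> k c y \<in> U}) \<le> 64 / (R k)\<^sup>2 * t\<^sup>2 * real (card (cells k))"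
proof -
  let ?J = "{c \<in> cells k. \<exists>y\<in>Q (Suc k). \<psi> k c y \<in> U}"
  have finJ: "finite ?J" using finite_cells by simp
  have s: "0 < sc k" by (rule sc_pos)
  have close: "dist (ctr k c) (ctr k c') \<le> 4 * t" if cc: "c \<in> ?J" "c' \<in> ?J" for c c'
  proof -
    obtain y y' where y: "y \<in> Q (Suc k)" "\<psi> k c y \<in> U" "y' \<in> Q (Suc k)" "\<psi> k c' y' \<in> U" using cc by auto
    have "dist (\<psi> k c y) (\<psi> k c' y') \<le> t" using U y by (simp add: width_le_def)
    moreover have "dist (\<psi> k c y) (ctr k c) \<le> 9/8 * sc k" "dist (\<psi> k c' y') (ctr k c') \<le> 9/8 * sc k"
      using dist_\<psi>_ctr cc y by auto
    moreover have "dist (ctr k c) (ctr k c') \<le> dist (ctr k c) (\<psi> k c y) + dist (\<psi> k c y) (\<psi> k c' y') + dist (\<psi> k c' y') (ctr k c')"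
      using dist_triangle[of "ctr k c" "ctr k c'" "\<psi> k c y"] dist_triangle[of "\<psi> k c y" "ctr k c'" "\<psi> k c' y'"] by linarith
    ultimately show ?thesis using t s by (simp add: dist_commute)
  qed
  have coord: "\<bar>real i - real j\<bar> \<le> t / sc k" if "4 * sc k * \<bar>real i - real j\<bar> \<le> 4 * t" for i j
    using that s by (simp add: pos_le_divide_eq mult.commute)
  have fst_close: "\<bar>real i - real j\<bar> \<le> t / sc k" if ij: "i \<in> fst ` ?J" "j \<in> fst ` ?J" for i j
  proof -
    obtain c c' where cc: "c \<in> ?J" "c' \<in> ?J" "i = fst c" "j = fst c'" using ij by blast
    have "Re (ctr k c - ctr k c') = 4 * sc k * (real i - real j)" by (simp add: ctr_def cc algebra_simps)
    then have "4 * sc k * \<bar>real i - real j\<bar> = \<bar>Re (ctr k c - ctr k c')\<bar>" using s by (simp add: abs_mult)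
    also have "\<dots> \<le> 4 * t" using close[OF cc(1,2)] abs_Re_le_cmod[of "ctr k c - ctr k c'"] by (simp add: dist_norm)
    finally show ?thesis by (rule coord)
  qed
  have snd_close: "\<bar>real i - real j\<bar> \<le> t / sc k" if ij: "i \<in> snd ` ?J" "j \<in> snd ` ?J" for i j
  proof -
    obtain c c' where cc: "c \<in> ?J" "c' \<in> ?J" "i = snd c" "j = snd c'" using ij by blast
    have "Im (ctr k c - ctr k c') = 4 * sc k * (real i - real j)" by (simp add: ctr_def cc algebra_simps)
    then have "4 * sc k * \<bar>real i - real j\<bar> = \<bar>Im (ctr k c - ctr k c')\<bar>" using s by (simp add: abs_mult)
    also have "\<dots> \<le> 4 * t" using close[OF cc(1,2)] abs_Im_le_cmod[of "ctr k c - ctr k c'"] by (simp add: dist_norm)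
    finally show ?thesis by (rule coord)
  qed
  have ts: "1 \<le> t / sc k" using t s by simp
  have "card ?J \<le> card (fst ` ?J \<times> snd ` ?J)"
    by (intro card_mono finite_cartesian_product finite_imageI finJ) force
  then have "real (card ?J) \<le> real (card (fst ` ?J)) * real (card (snd ` ?J))"
    by (simp add: card_cartesian_product flip: of_nat_mult)
  also have "\<dots> \<le> (t / sc k + 1) * (t / sc k + 1)"
    using ts finJ fst_close snd_close by (intro mult_mono card_le_of_width) auto
  also have "\<dots> \<le> (2 * (t / sc k)) * (2 * (t / sc k))" using ts by (intro mult_mono) auto
  also have "\<dots> = 64 / (R k)\<^sup>2 * t\<^sup>2 * real (card (cells k))"
    using N_pos[of k] R_pos[of k] by (simp add: sc_def card_cells power2_eq_square field_simps)
  finally show ?thesis .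
qed

sublocale cantor: cantor_scheme Q cells \<psi> sc l "\<lambda>k. 64 / (R k)\<^sup>2"
proof
  fix k
  show "compact (Q k)" unfolding Q_def by (rule compact_cbox)
  have "Complex 0 (R k) \<in> Q k" using R_pos[of k] by (simp add: in_Q)
  then show "Q k \<noteq> {}" by blast
  show "finite (cells k)" by (rule finite_cells)
  have "16 \<le> N k" using N_ge_2(2)[of k] by simp
  then have "16 * 16 \<le> N k * N k" by (intro mult_le_mono)
  then show "2 \<le> card (cells k)" by (simp add: card_cells)
  show "0 < sc k" by (rule sc_pos)
  show "sc k \<le> 1" using sc_le[of k] by simp
  have "1 * 1 * 1 \<le> 20 * real M * R (Suc k) * Bd k"
    using M R_ge_16[of "Suc k"] Bd_ge_1[of k] by (intro mult_mono) auto
  then have "l k \<le> sc k / 1" unfolding l_def using sc_pos[of k] by (intro divide_left_mono) auto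
  then show "l k \<le> 1/2" using sc_le[of k] by simp
  show "0 < l k" unfolding l_def using sc_pos[of k] M R_pos[of "Suc k"] Bd_pos[of k] by simp
  fix c c' :: "nat \<times> nat" and x y assume *: "c \<in> cells k" "c' \<in> cells k" "c \<noteq> c'" "x \<in> Q (Suc k)" "y \<in> Q (Suc k)"
  have "dist (ctr k c) (ctr k c') \<le> dist (ctr k c) (\<psi> k c x) + dist (\<psi> k c x) (\<psi> k c' y) + dist (\<psi> k c' y) (ctr k c')"
    using dist_triangle[of "ctr k c" "ctr k c'" "\<psi> k c x"] dist_triangle[of "\<psi> k c x" "ctr k c'" "\<psi> k c' y"] by linarith
  then show "sc k \<le> dist (\<psi> k c x) (\<psi> k c' y)"
    using dist_ctr[OF *(3), of k] dist_\<psi>_ctr[OF *(1,4)] dist_\<psi>_ctr[OF *(2,5)] sc_pos[of k] by (simp add: dist_commute)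
qed (use \<psi>_continuous \<psi>_maps \<psi>_expand cells_count in auto)

section \<open>The limit set and its density\<close>

lemma iterate_in_Q: "z \<in> cantor.E m k \<Longrightarrow> j \<le> m \<Longrightarrow> (gpow M ^^ j) z \<in> Q (k + j)"
proof (induction m arbitrary: z k j)
  case (Suc m)
  show ?case
  proof (cases j)
    case 0
    then show ?thesis using cantor.E_subset_Q[of "Suc m" k] Suc.prems by auto
  next
    case (Suc i)
    obtain c y where c: "c \<in> cells k" "y \<in> cantor.E m (Suc k)" "z = \<psi> k c y" using Suc.prems by auto
    then have "gpow M z = y" using gpow_\<psi> cantor.E_subset_Q by blast
    then have "(gpow M ^^ j) z = (gpow M ^^ i) y" by (simp only: Suc iter_Suc)
    then show ?thesis using Suc.IH[OF c(2), of i] Suc Suc.prems by simp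
  qed
qed simp

lemma limit_set_escapes: "(\<Inter>m. cantor.E m 0) \<subseteq> escaping_set (gpow M)"
proof
  fix z assume z: "z \<in> (\<Inter>m. cantor.E m 0)"
  then have Q: "(gpow M ^^ j) z \<in> Q j" for j using iterate_in_Q[of z j 0 j] by auto
  have "\<not> is_pole (gpow M) ((gpow M ^^ j) z)" for j
  proof
    assume "is_pole (gpow M) ((gpow M ^^ j) z)"
    \<comment> \<open>A pole would be sent to the conventional value 0, which lies in no
      square.\<close>
    then have "(gpow M ^^ Suc j) z = 0" using is_pole_gpow_iff[OF M] zero M by (simp add: gpow_def)
    then show False using norm_Q(1)[OF Q[of "Suc j"]] R_pos[of "Suc j"] by simp
  qed
  moreover have "filterlim (\<lambda>j. (gpow M ^^ j) z) at_infinity sequentially"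
  proof (rule filterlim_norm_at_top_imp_at_infinity)
    show "filterlim (\<lambda>j. norm ((gpow M ^^ j) z)) at_top sequentially"
    proof (rule filterlim_at_top_mono)
      show "filterlim (\<lambda>j. 2 ^ j :: real) at_top sequentially" by real_asymp
      show "eventually (\<lambda>j. 2 ^ j \<le> norm ((gpow M ^^ j) z)) sequentially"
      proof (intro always_eventually allI)
        fix j show "2 ^ j \<le> norm ((gpow M ^^ j) z)"
          using norm_Q(1)[OF Q[of j]] R_ge[of j] zero_less_power[of "2::real" j] by linarith
      qed
    qed
  qed
  ultimately show "z \<in> escaping_set (gpow M)" by (simp add: escaping_set_def)
qed

text \<open>Squaring closes the induction:
  \<open>(R k)\<^sup>2 * R (Suc k) = (R (Suc k))\<^sup>2\<close>.\<close>

lemma prod_R: "(\<Prod>j<k. R (Suc j)) \<le> (R k)\<^sup>2"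
proof (induction k)
  case 0
  then show ?case using R_ge_16[of 0] by (simp add: one_le_power)
next
  case (Suc k)
  have "(\<Prod>j<Suc k. R (Suc j)) \<le> (R k)\<^sup>2 * R (Suc k)"
    using Suc R_pos[of "Suc k"] by (simp add: mult_right_mono)
  also have "\<dots> = (R (Suc k))\<^sup>2" by (simp add: R_Suc power2_eq_square)
  finally show ?case .
qed

text \<open>The numbers of cells cancel against the scales in \<open>l j\<close>, and the quotients
  \<open>R j / R (Suc j)\<close> telescope and cancel \<open>1 / (R k)\<^sup>2\<close>. What remains
  are the factors \<open>Bd j\<close>, whose product is controlled by \<open>prod_R\<close>.\<close>

lemma scheme_bound:
  "64 / (R k)\<^sup>2 / (\<Prod>j<k. (l j)\<^sup>2 * real (card (cells j))) \<le> 64 * (200 * real M) ^ (2 * k) * R k powr (4 / real M)"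
proof -
  define G where "G = (\<Prod>j<k. 80 * real M * Bd j)"
  \<comment> \<open>80 = 4 * 20, because \<open>sc j * N j = R j / 4\<close>; below, 200 = 80 *
    5/2.\<close>
  have lN: "l j * real (N j) = R j / R (Suc j) / (80 * real M * Bd j)" for j
    using sc_N[of j] M Bd_pos[of j] R_pos[of j] R_pos[of "Suc j"] N_pos[of j] by (simp add: l_def sc_def field_simps)
  have tel: "(\<Prod>j<k. R j / R (Suc j)) = R 0 / R k" for k
    using R_pos by (induction k) (auto simp: less_imp_neq[symmetric])
  have "(\<Prod>j<k. (l j)\<^sup>2 * real (card (cells j))) = (\<Prod>j<k. l j * real (N j))\<^sup>2"
    by (simp add: card_cells power2_eq_square prod.distrib algebra_simps)
  also have "(\<Prod>j<k. l j * real (N j)) = R 0 / R k / G"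
    unfolding lN prod_dividef tel[symmetric] G_def ..
  finally have "64 / (R k)\<^sup>2 / (\<Prod>j<k. (l j)\<^sup>2 * real (card (cells j))) = 64 * G\<^sup>2 / (R 0)\<^sup>2"
    using R_pos[of k] by (simp add: power_divide power_mult_distrib)
  also have "\<dots> \<le> 64 * G\<^sup>2 / 1"
    using R_ge_16[of 0] by (intro divide_left_mono) (auto intro!: one_le_power)
  also have "G\<^sup>2 \<le> ((200 * real M) ^ k * (R k powr (2 / real M)))\<^sup>2"
  proof (rule power_mono)
    show "0 \<le> G" unfolding G_def using Bd_pos by (intro prod_nonneg) (auto simp: less_imp_le)
    have "G \<le> (\<Prod>j<k. 200 * real M * R (Suc j) powr (1 / real M))"
      unfolding G_def
    proof (rule prod_mono)
      fix j assume "j \<in> {..<k}"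
      have "80 * real M * Bd j \<le> 80 * real M * (5/2 * R (Suc j) powr (1 / real M))"
        by (intro mult_left_mono Bd_le) auto
      then show "0 \<le> 80 * real M * Bd j \<and> 80 * real M * Bd j \<le> 200 * real M * R (Suc j) powr (1 / real M)"
        using Bd_pos[of j] by simp
    qed
    also have "\<dots> = (200 * real M) ^ k * (\<Prod>j<k. R (Suc j) powr (1 / real M))" by (simp add: prod.distrib)
    also have "(\<Prod>j<k. R (Suc j) powr (1 / real M)) = (\<Prod>j<k. R (Suc j)) powr (1 / real M)"
      by (rule prod_powr_distrib[symmetric])
    also have "\<dots> \<le> ((R k)\<^sup>2) powr (1 / real M)"
      using prod_R R_pos by (intro powr_mono2) (auto intro!: prod_nonneg simp: less_imp_le)
    also have "(R k)\<^sup>2 = R k powr 2" using R_pos[of k] by simp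
    also have "(R k powr 2) powr (1 / real M) = R k powr (2 / real M)" by (simp only: powr_powr) simp
    finally show "G \<le> (200 * real M) ^ k * (R k powr (2 / real M))" by (simp add: mult_left_mono)
  qed
  also have "((200 * real M) ^ k * (R k powr (2 / real M)))\<^sup>2 = (200 * real M) ^ (2 * k) * R k powr (4 / real M)"
    using R_pos[of k] by (simp add: power_mult_distrib power_mult[symmetric] mult.commute powr_powr flip: powr_realpow)
  finally show ?thesis by (simp add: mult.assoc)
qed

text \<open>Doubly exponential growth is what lets any positive power of \<open>R k\<close> outweigh
  the geometric factor in \<open>scheme_bound\<close>.\<close>

lemma R_double_exp: "2 ^ (2 ^ k) \<le> R k"
proof (induction k)
  case (Suc k)
  have "(2::real) ^ (2 ^ Suc k) = (2 ^ (2 ^ k))\<^sup>2" by (simp add: power_mult[symmetric] mult.commute)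
  also have "\<dots> \<le> (R k)\<^sup>2" using Suc by (intro power_mono) auto
  finally show ?case by (simp add: R_Suc)
qed (use R0 in simp)

text \<open>\<open>1 / t\<close> exceeds \<open>4 * N k / R k\<close>, and \<open>growth\<close>
  makes up for the division by \<open>R k\<close>.\<close>

lemma iter_ln_small:
  assumes "0 < t" "t < sc k"
  shows "R k powr \<rho> / 2 \<le> (ln ^^ n) (1 / t)"
proof (rule iter_ln_ge)
  have "R k * (exp ^^ n) (R k powr \<rho> / 2) \<le> real (N k)" using growth[of k] N_lower[of k] by linarith
  then have "(exp ^^ n) (R k powr \<rho> / 2) \<le> real (N k) / R k" using R_pos[of k] by (simp add: pos_le_divide_eq mult.commute)
  also have "\<dots> \<le> 4 * real (N k) / R k" using R_pos[of k] by (intro divide_right_mono) auto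
  also have "\<dots> = 1 / sc k" by (simp add: sc_def)
  also have "\<dots> \<le> 1 / t" using assms by (intro divide_left_mono) auto
  finally show "(exp ^^ n) (R k powr \<rho> / 2) \<le> 1 / t" .
qed

lemma hausdorff_measure_infinite:
  fixes \<gamma> :: real and h :: "real \<Rightarrow> real"
  assumes \<gamma>: "8 / (real M * \<rho>) < \<gamma>"
    and h: "\<forall>t \<in> {0<..1 / (exp ^^ n) \<gamma>}. h t = t\<^sup>2 * ((ln ^^ n) (1 / t)) powr \<gamma>"
  shows "hausdorff_measure h (escaping_set (gpow M)) = \<infinity>"
proof -
  have "0 < 8 / (real M * \<rho>)" using M \<rho> by simp
  then have \<gamma>0: "0 < \<gamma>" using \<gamma> by linarith
  define \<delta>0 where "\<delta>0 = 1 / (exp ^^ n) \<gamma>"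
  have e\<gamma>: "0 < (exp ^^ n) \<gamma>" using iter_exp_ge[of \<gamma> n] \<gamma>0 by linarith
  \<comment> \<open>The surplus of the gauge over the loss of density, as an exponent of
    \<open>R k\<close>.\<close>
  define \<kappa> where "\<kappa> = \<rho> * \<gamma> - 8 / real M"
  have \<kappa>: "0 < \<kappa>" using \<gamma> \<rho> M by (simp add: \<kappa>_def field_simps)
  \<comment> \<open>On this range the iterated logarithm is at least \<gamma>, in particular
    positive, and it is monotone there although \<open>ln\<close> takes junk values
    elsewhere.\<close>
  have small: "(exp ^^ n) \<gamma> \<le> 1 / t" if "0 < t" "t < \<delta>0" for t
    using that e\<gamma> by (simp add: \<delta>0_def field_simps)
  show ?thesis
  proof (rule cantor.hausdorff_measure_scheme[of \<delta>0 h "\<lambda>t. ((ln ^^ n) (1 / t)) powr \<gamma>"])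
    show "0 < \<delta>0" using e\<gamma> by (simp add: \<delta>0_def)
    show "h t = t\<^sup>2 * ((ln ^^ n) (1 / t)) powr \<gamma>" if "0 < t" "t < \<delta>0" for t
      using h that by (simp add: \<delta>0_def)
    show "((ln ^^ n) (1 / t')) powr \<gamma> \<le> ((ln ^^ n) (1 / t)) powr \<gamma>" if t: "0 < t" "t \<le> t'" "t' < \<delta>0" for t t'
    proof (rule powr_mono2)
      have e: "(exp ^^ n) \<gamma> \<le> 1 / t'" using small[of t'] t by simp
      show "0 \<le> (ln ^^ n) (1 / t')" using iter_ln_ge[OF e] \<gamma>0 by linarith
      show "(ln ^^ n) (1 / t') \<le> (ln ^^ n) (1 / t)" by (rule iter_ln_mono[OF e]) (use t in \<open>simp add: frac_le\<close>)
    qed (use \<gamma>0 in simp)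
    show "(\<Inter>m. cantor.E m 0) \<subseteq> escaping_set (gpow M)" by (rule limit_set_escapes)
    fix \<epsilon> :: real assume \<epsilon>: "0 < \<epsilon>"
    define D where "D = (200 * real M)\<^sup>2"
    have D1: "1 < D" using M unfolding D_def by (intro one_less_power) auto
    \<comment> \<open>By \<open>R_double_exp\<close> the surplus is at least
      \<open>2 powr (\<kappa> * 2 ^ k)\<close>, which beats \<open>D ^ Suc k\<close>. The factor
      \<open>2 powr \<gamma>\<close> pays for the halving in \<open>iter_ln_small\<close>.\<close>
    have "((\<lambda>k. 64 * D ^ Suc k * 2 powr \<gamma> / 2 powr (\<kappa> * 2 ^ k)) \<longlongrightarrow> 0) sequentially"
      using D1 \<kappa> \<gamma>0 by real_asymp
    then have "eventually (\<lambda>k. 64 * D ^ Suc k * 2 powr \<gamma> / 2 powr (\<kappa> * 2 ^ k) < \<epsilon>) sequentially"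
      using \<epsilon> by (rule order_tendstoD)
    then obtain k1 where k1: "\<And>k. k1 \<le> k \<Longrightarrow> 64 * D ^ Suc k * 2 powr \<gamma> / 2 powr (\<kappa> * 2 ^ k) < \<epsilon>"
      by (auto simp: eventually_sequentially)
    have "64 / (R (Suc k))\<^sup>2 / (\<Prod>j<Suc k. (l j)\<^sup>2 * real (card (cells j))) \<le> \<epsilon> * ((ln ^^ n) (1 / t)) powr \<gamma>"
      if k: "k1 \<le> k" and t: "0 < t" "t < sc k" for k t
    proof -
      have R0k: "0 < R k" by (rule R_pos)
      have "64 / (R (Suc k))\<^sup>2 / (\<Prod>j<Suc k. (l j)\<^sup>2 * real (card (cells j)))
          \<le> 64 * (200 * real M) ^ (2 * Suc k) * R (Suc k) powr (4 / real M)"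
        by (rule scheme_bound)
      also have "\<dots> = 64 * D ^ Suc k * R k powr (8 / real M)"
      proof -
        \<comment> \<open>The shift of index from the density at \<open>Suc k\<close> to the scale
          at k turns the exponent 4/M into 8/M.\<close>
        have "R (Suc k) = R k powr 2" using R0k by (simp add: R_Suc)
        then have "R (Suc k) powr (4 / real M) = R k powr (8 / real M)" by (simp only: powr_powr) simp
        then show ?thesis by (simp only: D_def power_mult)
      qed
      also have "\<dots> \<le> \<epsilon> * (R k powr \<rho> / 2) powr \<gamma>"
      proof -
        have "2 powr (\<kappa> * 2 ^ k) = (2 ^ (2 ^ k)) powr \<kappa>"
          by (simp add: powr_powr mult.commute flip: powr_realpow)
        also have "\<dots> \<le> R k powr \<kappa>" using R_double_exp[of k] \<kappa> by (intro powr_mono2) auto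
        finally have *: "2 powr (\<kappa> * 2 ^ k) \<le> R k powr \<kappa>" .
        have "64 * D ^ Suc k * 2 powr \<gamma> \<le> \<epsilon> * 2 powr (\<kappa> * 2 ^ k)"
          using k1[OF k] by (simp add: pos_divide_less_eq less_imp_le)
        also have "\<dots> \<le> \<epsilon> * R k powr \<kappa>" using * \<epsilon> by (intro mult_left_mono) auto
        finally have "64 * D ^ Suc k \<le> \<epsilon> * R k powr \<kappa> / 2 powr \<gamma>" by (simp add: pos_le_divide_eq)
        then have "64 * D ^ Suc k * R k powr (8 / real M) \<le> \<epsilon> * R k powr \<kappa> / 2 powr \<gamma> * R k powr (8 / real M)"
          by (rule mult_right_mono) simp
        also have "\<dots> = \<epsilon> * (R k powr \<kappa> * R k powr (8 / real M)) / 2 powr \<gamma>" by simp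
        also have "R k powr \<kappa> * R k powr (8 / real M) = R k powr (\<rho> * \<gamma>)"
          by (simp add: \<kappa>_def flip: powr_add)
        also have "\<epsilon> * R k powr (\<rho> * \<gamma>) / 2 powr \<gamma> = \<epsilon> * (R k powr \<rho> / 2) powr \<gamma>"
          using R0k by (simp add: powr_divide powr_powr)
        finally show ?thesis .
      qed
      also have "\<dots> \<le> \<epsilon> * ((ln ^^ n) (1 / t)) powr \<gamma>"
        using iter_ln_small[OF t] \<gamma>0 \<epsilon> by (intro mult_left_mono powr_mono2) auto
      finally show ?thesis .
    qed
    then show "\<exists>k1. \<forall>k\<ge>k1. \<forall>t. 0 < t \<longrightarrow> t < sc k \<longrightarrow>
        64 / (R (Suc k))\<^sup>2 / (\<Prod>j<Suc k. (l j)\<^sup>2 * real (card (cells j))) \<le> \<epsilon> * ((ln ^^ n) (1 / t)) powr \<gamma>"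
      by blast
  qed
qed

end

lemma escaping_grid_exists:
  assumes "0 < \<rho>" "1 \<le> n" "1 \<le> M"
  obtains R N where "escaping_grid R N \<rho> n M"
proof -
  have "eventually (\<lambda>r::real. ln r \<le> r powr \<rho> / 2) at_top" using assms(1) by real_asymp
  moreover have "filterlim (\<lambda>r::real. r powr (1 / real M)) at_top at_top" using assms(3) by real_asymp
  then have "eventually (\<lambda>r::real. 10800 \<le> r powr (1 / real M)) at_top" by (simp add: filterlim_at_top)
  ultimately have "eventually (\<lambda>r::real. ln r \<le> r powr \<rho> / 2 \<and> 10800 \<le> r powr (1 / real M)) at_top"
    by (rule eventually_conj)
  then obtain b where b: "\<And>r. b \<le> r \<Longrightarrow> ln r \<le> r powr \<rho> / 2 \<and> 10800 \<le> r powr (1 / real M)"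
    by (auto simp: eventually_at_top_linorder)
  define B where "B = max 16 b"
  define R where "R k = B ^ (2 ^ k)" for k :: nat
  define N where "N k = nat \<lceil>(exp ^^ n) (R k powr \<rho>)\<rceil>" for k
  have B: "16 \<le> B" "b \<le> B" by (auto simp: B_def)
  have RB: "B \<le> R k" for k
    unfolding R_def using B by (intro self_le_power) auto
  have growth: "R k * (exp ^^ n) (R k powr \<rho> / 2) \<le> (exp ^^ n) (R k powr \<rho>)" for k
    by (rule iter_exp_half_mult) (use b[of "R k"] RB[of k] B assms in auto)
  have "escaping_grid R N \<rho> n M"
  proof
    show "16 \<le> R 0" using B by (simp add: R_def)
    show "R (Suc k) = (R k)\<^sup>2" for k by (simp add: R_def power_mult[symmetric] mult.commute)
    show "N k = nat \<lceil>(exp ^^ n) (R k powr \<rho>)\<rceil>" for k by (rule N_def)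
    show "R k \<le> real (N k)" for k
    proof -
      obtain m where n: "n = Suc m" using assms(2) by (cases n) auto
      have "0 \<le> (exp ^^ m) (R k powr \<rho> / 2)" using iter_exp_ge[of "R k powr \<rho> / 2" m] by (rule order_trans[rotated]) simp
      then have "1 \<le> (exp ^^ n) (R k powr \<rho> / 2)" by (simp add: n)
      then have "R k * 1 \<le> R k * (exp ^^ n) (R k powr \<rho> / 2)" using RB[of k] B by (intro mult_left_mono) auto
      also have "\<dots> \<le> (exp ^^ n) (R k powr \<rho>)" by (rule growth)
      also have "\<dots> \<le> real (N k)" unfolding N_def by (rule real_nat_ceiling_ge)
      finally show ?thesis by simp
    qed
    show "10800 \<le> R 0 powr (1 / real M)" using b[of "R 0"] RB[of 0] B by simp
  qed (use assms growth in auto)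
  then show thesis by (rule that)
qed

theorem theorem1p2:
  fixes \<rho> :: real and n M :: nat
  assumes "0 < \<rho>" and "1 \<le> n" and "1 \<le> M"
  shows "\<exists>f :: complex \<Rightarrow> complex.
           f nicely_meromorphic_on UNIV \<and>
           f \<in> eremenko_lyubich_class \<and>
           nth_order n f = ereal \<rho> \<and>
           (\<forall>z. is_pole f z \<longrightarrow> zorder f z = - int M) \<and>
           \<not> infinity_asymptotic_value f \<and>
           (\<forall>\<gamma> :: real. 8 / (real M * \<rho>) < \<gamma> \<longrightarrow>
             (\<forall>h :: real \<Rightarrow> real.
               (\<forall>t \<in> {0<..1 / (exp ^^ n) \<gamma>}. h t = t\<^sup>2 * ((ln ^^ n) (1 / t)) powr \<gamma>) \<longrightarrow>
               hausdorff_measure h (escaping_set f) = \<infinity>))"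
proof -
  obtain R N where "escaping_grid R N \<rho> n M" using escaping_grid_exists[OF assms] .
  then interpret escaping_grid R N \<rho> n M .
  show ?thesis
    using gpow_nicely_meromorphic[OF M] gpow_class_B[OF M] nth_order_gpow[OF M] gpow_pole(2)[OF M]
      is_pole_gpow_iff[OF M] gpow_no_infinite_asymptotic_value[OF M] hausdorff_measure_infinite
    by (intro exI[of _ "gpow M"]) blast
qed

end
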